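(* Let $Q_n(x)$, $L_1$, $L_2$, $Li_3$ and $x^*$ be as in the context. (a) Let $X\subset(x^*,0)$ be compact. Then, as $n\to\infty$, uniformly for $x\in X$, \[ Q_n(x)=2^{7/6}\sqrt[12]{1-x}\,\frac{1}{\sqrt{6\pi n^{4/3}}}\,|Li_3(x)|^{1/6}\exp\!\left(\tfrac34\sqrt[3]{2}\,n^{2/3}|Li_3(x)|^{1/3}\right)\left(\cos\!\left(\tfrac{3\sqrt3}{4}\sqrt[3]{2}\,n^{2/3}|Li_3(x)|^{1/3}+\tfrac{\pi}{6}\right)+O_X(n^{-1/3})\right). \] (b) Let $X$ be a compact subset of $\{x:0<|x|<1,\ \Re L_1(x)=\Re L_2(x),\ x\ne x^*\}$. Then, as $n\to\infty$, uniformly for $x\in X$, \begin{align*} Q_n(x)&=\sqrt[12]{1-x}\,\sqrt{\frac{L_1(x)}{6\pi n^{4/3}}}\exp\!\left(\tfrac32n^{2/3}L_1(x)\right)\left(1+O_X(n^{-1/3})\right)\\ &\quad+(-1)^n\sqrt[24]{1-x^2}\,\sqrt[8]{\frac{1-x}{1+x}}\,\sqrt{\frac{L_2(x)}{6\pi n^{4/3}}}\exp\!\left(\tfrac32n^{2/3}L_2(x)\right)\left(1+O_X(n^{-1/3})\right). \end{align*}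
   Context: A plane partition of a positive integer $n$ is an array $(\pi_{i,j})$ of nonnegative integers with $\sum\pi_{i,j}=n$; its trace is $\sum_i\pi_{i,i}$. Let $pp_k(n)$ be the number of plane partitions of $n$ with trace $k$, and let $Q_n(x)=\sum_{k=1}^n pp_k(n)x^k$. Equivalently, $\prod_{m\ge1}(1-xu^m)^{-m}=1+\sum_{n\ge1}Q_n(x)u^n$. Let $Li_3(x)=\sum_{n\ge1}x^n/n^3$. For $k\ge1$ and $|x|<1$, set $L_k(x)=\frac1k\sqrt[3]{2\,Li_3(x^k)}$, with the principal branch of the cube root. All other roots are principal branches. It is known that the set $\{x:0<|x|<1,\ \Re L_1(x)=\Re L_2(x)\}$ contains exactly one real point $x^*\approx-0.8250030529$. The notation $O_X$ means the implied constant depends only on $X$. *)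

theory Defs
  imports "HOL-Complex_Analysis.Complex_Analysis"
begin

text \<open>The array is indexed from 0 and has finite support; as usual for plane partitions, rows and
  columns are weakly decreasing.\<close>

definition plane_partition :: "(nat \<Rightarrow> nat \<Rightarrow> nat) \<Rightarrow> nat \<Rightarrow> bool" where
  "plane_partition \<pi> n \<longleftrightarrow>
     (\<forall>i j. \<pi> (Suc i) j \<le> \<pi> i j) \<and> (\<forall>i j. \<pi> i (Suc j) \<le> \<pi> i j) \<and>
     finite {(i, j). \<pi> i j \<noteq> 0} \<and> (\<Sum>(i, j)\<in>{(i, j). \<pi> i j \<noteq> 0}. \<pi> i j) = n"

definition pp_trace :: "(nat \<Rightarrow> nat \<Rightarrow> nat) \<Rightarrow> nat" where
  "pp_trace \<pi> = (\<Sum>i\<in>{i. \<pi> i i \<noteq> 0}. \<pi> i i)"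

definition pp :: "nat \<Rightarrow> nat \<Rightarrow> nat" where
  "pp k n = card {\<pi>. plane_partition \<pi> n \<and> pp_trace \<pi> = k}"

definition pp_poly :: "nat \<Rightarrow> 'a::comm_semiring_1 \<Rightarrow> 'a" where
  "pp_poly n x = (\<Sum>k=1..n. of_nat (pp k n) * x ^ k)"

definition Li3 :: "'a::{real_normed_field, banach} \<Rightarrow> 'a" where
  "Li3 x = (\<Sum>n. x ^ Suc n / of_nat (Suc n) ^ 3)"

text \<open>On complex arguments \<open>powr\<close> and \<open>csqrt\<close> are principal branches, with argument in
  \<open>(-pi, pi]\<close>; in particular the cube root of a negative real has argument \<open>pi/3\<close>.\<close>

definition L_phase :: "nat \<Rightarrow> complex \<Rightarrow> complex" where
  "L_phase k x = (2 * Li3 (x ^ k)) powr (1/3) / of_nat k"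

definition level_set :: "complex set" where
  "level_set = {x. 0 < norm x \<and> norm x < 1 \<and> Re (L_phase 1 x) = Re (L_phase 2 x)}"

definition x_star :: real where
  "x_star = (THE x. complex_of_real x \<in> level_set)"

end

theory Submission
  imports Defs "HOL-Probability.Distributions" "HOL-Real_Asymp.Real_Asymp"
begin

text \<open>
  The diagonals of a plane partition form two interlacing chains of partitions that start at the main
  diagonal. A local rule exchanges two interlacing steps at the cost of a geometric series;
  iterating it gives \<open>\<Prod>m\<ge>1. (1 - x u^m)^(-m)\<close> for the generating function by trace.
  Hence \<open>Q_n(x)\<close> is an integral over the circle \<open>u = exp (-\<sigma> - i\<theta>)\<close>, where \<open>\<sigma> = Re L_1(x) n^(-1/3)\<close>.

  Near \<open>u = 1\<close> and \<open>u = -1\<close> the logarithm of the product, as a function of \<open>w = \<sigma> + i\<theta>\<close>, is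
  \<open>L^3 / (2 w^2)\<close> plus a constant and an error \<open>O(w^2)\<close>, for \<open>L = L_1\<close> and \<open>L = L_2\<close>, so that the saddle points
  are at \<open>w = L n^(-1/3)\<close>. On the level set \<open>Re L_1 = Re L_2\<close> a single circle passes through both of them, and
  the identity \<open>a^3/(2 b^2) + b - 3a/2 = (b - a)^2 (2b + a) / (2 b^2)\<close> controls the phase on the whole arc.
  For real \<open>x\<close> between \<open>x_star\<close> and 0 the cube root of the negative number \<open>Li_3(x)\<close> has two conjugate
  branches, hence two conjugate saddle points near \<open>u = 1\<close>, whose sum is the cosine, while the arc at
  \<open>u = -1\<close> is exponentially smaller. The rest of the circle is negligible by
  the termwise bound for the logarithm.
\<close>

section \<open>Interlacing partitions\<close>

definition fin_supp :: "(nat \<Rightarrow> nat) \<Rightarrow> bool" where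
  "fin_supp l \<longleftrightarrow> finite {i. l i \<noteq> 0}"

definition psize :: "(nat \<Rightarrow> nat) \<Rightarrow> nat" where
  "psize l = (\<Sum>i | l i \<noteq> 0. l i)"

definition interlaces :: "(nat \<Rightarrow> nat) \<Rightarrow> (nat \<Rightarrow> nat) \<Rightarrow> bool"  (infix \<open>\<preceq>i\<close> 50) where
  "m \<preceq>i l \<longleftrightarrow> fin_supp l \<and> (\<forall>i. m i \<le> l i \<and> l (Suc i) \<le> m i)"

lemma fin_supp_iff: "fin_supp l \<longleftrightarrow> (\<exists>N. \<forall>i\<ge>N. l i = 0)"
  using MOST_nat_le[of "\<lambda>i. l i = 0"] by (simp add: fin_supp_def eventually_cofinite)

lemma psize_zero [simp]: "psize (\<lambda>_. 0) = 0"
  by (simp add: psize_def)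

lemma psize_eq_sum: "(\<And>i. i \<ge> N \<Longrightarrow> l i = 0) \<Longrightarrow> psize l = (\<Sum>i<N. l i)"
  unfolding psize_def by (rule sum.mono_neutral_left) (auto intro: ccontr)

lemma interlacesD:
  assumes "m \<preceq>i l" shows "m i \<le> l i" "l (Suc i) \<le> m i"
  using assms by (auto simp: interlaces_def)

lemma interlaces_fin_supp:
  assumes "m \<preceq>i l" shows "fin_supp m" "fin_supp l"
proof -
  show "fin_supp l" using assms by (simp add: interlaces_def)
  then show "fin_supp m" unfolding fin_supp_iff using interlacesD(1)[OF assms] by (metis le_zero_eq)
qed

lemma interlaces_zero_iff [simp]: "m \<preceq>i (\<lambda>_. 0) \<longleftrightarrow> m = (\<lambda>_. 0)"
  by (auto simp: interlaces_def fin_supp_def fun_eq_iff)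

lemma psize_le_of_interlaces:
  assumes "m \<preceq>i l" shows "psize m \<le> psize l"
proof -
  obtain N where N: "\<forall>i\<ge>N. l i = 0" using interlaces_fin_supp[OF assms] by (auto simp: fin_supp_iff)
  then have "\<forall>i\<ge>N. m i = 0" using interlacesD(1)[OF assms] by (metis le_zero_eq)
  with N show ?thesis
    using psize_eq_sum[of N] interlacesD(1)[OF assms] by (auto intro: sum_mono)
qed

lemma power_psize_of_interlaces:
  fixes u :: "'a::monoid_mult"
  assumes "m \<preceq>i l" shows "u ^ psize l = u ^ psize m * u ^ (psize l - psize m)"
  using psize_le_of_interlaces[OF assms] by (simp add: power_add[symmetric])

text \<open>The piecewise linear local move behind the RSK correspondence.\<close>

definition local_move :: "(nat \<Rightarrow> nat) \<Rightarrow> (nat \<Rightarrow> nat) \<Rightarrow> nat \<times> (nat \<Rightarrow> nat) \<Rightarrow> nat \<Rightarrow> nat" where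
  "local_move m n = (\<lambda>(c, k) i. case i of 0 \<Rightarrow> max (m 0) (n 0) + c
      | Suc j \<Rightarrow> max (m (Suc j)) (n (Suc j)) + min (m j) (n j) - k j)"

definition local_move_inv :: "(nat \<Rightarrow> nat) \<Rightarrow> (nat \<Rightarrow> nat) \<Rightarrow> (nat \<Rightarrow> nat) \<Rightarrow> nat \<times> (nat \<Rightarrow> nat)" where
  "local_move_inv m n l =
     (l 0 - max (m 0) (n 0), \<lambda>j. max (m (Suc j)) (n (Suc j)) + min (m j) (n j) - l (Suc j))"

lemma interlaces_local_move:
  assumes "k \<preceq>i m" "k \<preceq>i n"
  shows "m \<preceq>i local_move m n (c, k)" "n \<preceq>i local_move m n (c, k)"
proof -
  note k = interlacesD[OF assms(1)] interlacesD[OF assms(2)]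
  obtain M N where MN: "\<forall>i\<ge>M. m i = 0" "\<forall>i\<ge>N. n i = 0"
    using interlaces_fin_supp(2)[OF assms(1)] interlaces_fin_supp(2)[OF assms(2)] by (auto simp: fin_supp_iff)
  have "local_move m n (c, k) i = 0" if "i \<ge> Suc (max M N)" for i
    using that MN by (cases i) (auto simp: local_move_def)
  then have fin: "fin_supp (local_move m n (c, k))" unfolding fin_supp_iff by blast
  have bounds: "m i \<le> local_move m n (c, k) i \<and> n i \<le> local_move m n (c, k) i \<and>
        local_move m n (c, k) (Suc i) \<le> m i \<and> local_move m n (c, k) (Suc i) \<le> n i" for i
    using k[of i] k[of "i - 1"] by (cases i) (auto simp: local_move_def)
  then show "m \<preceq>i local_move m n (c, k)" "n \<preceq>i local_move m n (c, k)"
    using fin by (auto simp: interlaces_def)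
qed

lemma interlaces_local_move_inv:
  assumes "m \<preceq>i l" "n \<preceq>i l"
  shows "snd (local_move_inv m n l) \<preceq>i m" "snd (local_move_inv m n l) \<preceq>i n"
proof -
  note l = interlacesD[OF assms(1)] interlacesD[OF assms(2)]
  have "snd (local_move_inv m n l) i \<le> min (m i) (n i) \<and>
    max (m (Suc i)) (n (Suc i)) \<le> snd (local_move_inv m n l) i" for i
    using l[of i] l[of "Suc i"] by (auto simp: local_move_inv_def)
  then show "snd (local_move_inv m n l) \<preceq>i m" "snd (local_move_inv m n l) \<preceq>i n"
    using interlaces_fin_supp(1)[OF assms(1)] interlaces_fin_supp(1)[OF assms(2)] by (auto simp: interlaces_def)
qed

lemma local_move_inv_local_move:
  assumes "k \<preceq>i m" "k \<preceq>i n" shows "local_move_inv m n (local_move m n (c, k)) = (c, k)"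
  using interlacesD(1)[OF assms(1)] interlacesD(1)[OF assms(2)]
  by (auto simp: local_move_def local_move_inv_def fun_eq_iff intro!: diff_diff_cancel trans_le_add2)

lemma local_move_local_move_inv:
  assumes "m \<preceq>i l" "n \<preceq>i l" shows "local_move m n (local_move_inv m n l) = l"
proof
  fix i
  show "local_move m n (local_move_inv m n l) i = l i"
    using interlacesD[OF assms(1)] interlacesD[OF assms(2)]
    by (cases i) (auto simp: local_move_def local_move_inv_def intro!: diff_diff_cancel trans_le_add2)
qed

lemma bij_betw_local_move:
  "bij_betw (local_move m n) (UNIV \<times> {k. k \<preceq>i m \<and> k \<preceq>i n}) {l. m \<preceq>i l \<and> n \<preceq>i l}"
proof (rule bij_betw_byWitness[where f' = "local_move_inv m n"])
  show "local_move_inv m n ` {l. m \<preceq>i l \<and> n \<preceq>i l} \<subseteq> UNIV \<times> {k. k \<preceq>i m \<and> k \<preceq>i n}"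
    using interlaces_local_move_inv by (intro image_subsetI) (simp add: mem_Times_iff)
qed (auto simp: interlaces_local_move local_move_inv_local_move local_move_local_move_inv)

lemma psize_local_move:
  assumes "k \<preceq>i m" "k \<preceq>i n"
  shows "psize (local_move m n (c, k)) + psize k = psize m + psize n + c"
proof -
  let ?l = "local_move m n (c, k)"
  obtain M N' where MN: "\<forall>i\<ge>M. m i = 0" "\<forall>i\<ge>N'. n i = 0"
    using interlaces_fin_supp(2)[OF assms(1)] interlaces_fin_supp(2)[OF assms(2)] by (auto simp: fin_supp_iff)
  define N where "N = max M N'"
  have k_le: "k j \<le> m j" "k j \<le> n j" for j
    using interlacesD(1)[OF assms(1)] interlacesD(1)[OF assms(2)] by auto
  have zero: "m i = 0" "n i = 0" "k i = 0" if "i \<ge> N" for i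
    using MN that k_le[of i] by (auto simp: N_def)
  have "?l i = 0" if "i \<ge> Suc N" for i
    using that zero by (cases i) (auto simp: local_move_def)
  then have "psize ?l + psize k = (\<Sum>i<Suc N. ?l i) + (\<Sum>i<N. k i)"
    using psize_eq_sum[of "Suc N" ?l] psize_eq_sum[of N k] zero by simp
  also have "\<dots> = max (m 0) (n 0) + c + (\<Sum>j<N. ?l (Suc j) + k j)"
    by (subst sum.lessThan_Suc_shift) (simp add: local_move_def sum.distrib)
  also have "(\<Sum>j<N. ?l (Suc j) + k j) = (\<Sum>j<N. max (m (Suc j)) (n (Suc j)) + min (m j) (n j))"
    using k_le by (intro sum.cong) (auto simp: local_move_def intro!: le_add_diff_inverse2 trans_le_add2)
  also have "max (m 0) (n 0) + c + \<dots> = c + (\<Sum>j<Suc N. max (m j) (n j)) + (\<Sum>j<N. min (m j) (n j))"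
    by (subst sum.lessThan_Suc_shift) (simp add: sum.distrib)
  also have "\<dots> = c + (\<Sum>j<N. max (m j) (n j) + min (m j) (n j))"
    using zero[of N] by (simp add: sum.distrib)
  also have "(\<Sum>j<N. max (m j) (n j) + min (m j) (n j)) = (\<Sum>j<N. m j + n j)"
    by (intro sum.cong) auto
  also have "\<dots> = psize m + psize n"
    using psize_eq_sum[of N m] psize_eq_sum[of N n] zero by (simp add: sum.distrib)
  finally show ?thesis by simp
qed

section \<open>Sums over chains of interlacing partitions\<close>

lemma nn_integral_count_space_swap:
  "(\<integral>\<^sup>+x. \<integral>\<^sup>+y. f x y \<partial>count_space UNIV \<partial>count_space UNIV) =
   (\<integral>\<^sup>+y. \<integral>\<^sup>+x. f x y \<partial>count_space UNIV \<partial>count_space UNIV)"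
  using nn_integral_fst_count_space[of "\<lambda>(x, y). f x y"] nn_integral_snd_count_space[of "\<lambda>(x, y). f x y"]
  by simp

lemma nn_integral_count_space_singleton:
  assumes "\<And>x. x \<noteq> a \<Longrightarrow> f x = 0"
  shows "(\<integral>\<^sup>+x. f x \<partial>count_space UNIV) = f a"
  using nn_integral_count_space'[of "{a}" UNIV f] assms by simp

lemma nn_integral_count_space_of_bool:
  "(\<integral>\<^sup>+x. f x \<partial>count_space A) = (\<integral>\<^sup>+x. of_bool (x \<in> A) * f x \<partial>count_space UNIV)"
  by (subst nn_integral_count_space_indicator)
     (auto intro!: nn_integral_cong simp: indicator_def mult.commute)

definition geom :: "ennreal \<Rightarrow> ennreal" where
  "geom b = (\<Sum>m. b ^ m)"

lemma sum_common_upper: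
  "(\<integral>\<^sup>+l. of_bool (m \<preceq>i l \<and> n \<preceq>i l) * (a ^ (psize l - psize m) * b ^ (psize l - psize n)) \<partial>count_space UNIV) =
    geom (a * b) * (\<integral>\<^sup>+k. of_bool (k \<preceq>i m \<and> k \<preceq>i n) * (b ^ (psize m - psize k) * a ^ (psize n - psize k)) \<partial>count_space UNIV)"
    (is "?L = geom (a * b) * ?R")
proof -
  let ?K = "{k. k \<preceq>i m \<and> k \<preceq>i n}"
  let ?w = "\<lambda>l. a ^ (psize l - psize m) * b ^ (psize l - psize n)"
  let ?v = "\<lambda>k. b ^ (psize m - psize k) * a ^ (psize n - psize k)"
  have move: "?w (local_move m n (c, k)) = (a * b) ^ c * ?v k" if "k \<in> ?K" for c k
  proof -
    have "psize (local_move m n (c, k)) - psize n = c + (psize m - psize k)"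
      "psize (local_move m n (c, k)) - psize m = c + (psize n - psize k)"
      using that psize_local_move[of k m n c] psize_le_of_interlaces[of k m] psize_le_of_interlaces[of k n] by auto
    then show ?thesis by (simp add: power_add power_mult_distrib mult_ac)
  qed
  have "?L = (\<integral>\<^sup>+l. ?w l \<partial>count_space {l. m \<preceq>i l \<and> n \<preceq>i l})"
    by (simp add: nn_integral_count_space_of_bool[of "Collect _"])
  also have "\<dots> = (\<integral>\<^sup>+p. ?w (local_move m n p) \<partial>count_space (UNIV \<times> ?K))"
    by (rule nn_integral_bij_count_space[OF bij_betw_local_move, symmetric])
  also have "\<dots> = (\<integral>\<^sup>+p. of_bool (snd p \<in> ?K) * ((a * b) ^ fst p * ?v (snd p)) \<partial>count_space UNIV)"
    unfolding nn_integral_count_space_of_bool[of "UNIV \<times> ?K"]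
    by (intro nn_integral_cong) (use move in auto)
  also have "\<dots> = (\<integral>\<^sup>+c. \<integral>\<^sup>+k. of_bool (k \<in> ?K) * ((a * b) ^ c * ?v k) \<partial>count_space UNIV \<partial>count_space UNIV)"
    by (subst nn_integral_fst_count_space[symmetric]) simp
  also have "\<dots> = (\<integral>\<^sup>+c. (a * b) ^ c * ?R \<partial>count_space UNIV)"
    by (subst nn_integral_cmult[symmetric]) (auto intro!: nn_integral_cong simp: mult_ac)
  also have "\<dots> = geom (a * b) * ?R"
    by (subst nn_integral_multc) (auto simp: geom_def nn_integral_count_space_nat)
  finally show ?thesis .
qed

definition up_sum :: "ennreal \<Rightarrow> ((nat \<Rightarrow> nat) \<Rightarrow> ennreal) \<Rightarrow> (nat \<Rightarrow> nat) \<Rightarrow> ennreal" where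
  "up_sum b F n = (\<integral>\<^sup>+l. of_bool (n \<preceq>i l) * b ^ (psize l - psize n) * F l \<partial>count_space UNIV)"

definition down_sum :: "ennreal \<Rightarrow> ((nat \<Rightarrow> nat) \<Rightarrow> ennreal) \<Rightarrow> (nat \<Rightarrow> nat) \<Rightarrow> ennreal" where
  "down_sum a F l = (\<integral>\<^sup>+n. of_bool (n \<preceq>i l) * a ^ (psize l - psize n) * F n \<partial>count_space UNIV)"

lemma down_sum_cmult: "down_sum a (\<lambda>n. c * F n) l = c * down_sum a F l"
  unfolding down_sum_def by (subst nn_integral_cmult[symmetric]) (auto simp: mult_ac)

lemma up_sum_power_psize: "up_sum b (\<lambda>l. u ^ psize l * F l) n = u ^ psize n * up_sum (b * u) F n"
proof -
  have "of_bool (n \<preceq>i l) * b ^ (psize l - psize n) * (u ^ psize l * F l) =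
      u ^ psize n * (of_bool (n \<preceq>i l) * (b * u) ^ (psize l - psize n) * F l)" for l
    using power_psize_of_interlaces[of n l u] by (auto simp: power_mult_distrib mult_ac)
  then show ?thesis unfolding up_sum_def by (simp add: nn_integral_cmult)
qed

lemma nn_integral_mult_down_sum:
  "(\<integral>\<^sup>+l. G l * down_sum 1 F l \<partial>count_space UNIV) = (\<integral>\<^sup>+n. up_sum 1 G n * F n \<partial>count_space UNIV)"
proof -
  have "(\<integral>\<^sup>+l. G l * down_sum 1 F l \<partial>count_space UNIV) =
    (\<integral>\<^sup>+l. \<integral>\<^sup>+n. of_bool (n \<preceq>i l) * G l * F n \<partial>count_space UNIV \<partial>count_space UNIV)"
    by (auto simp: down_sum_def nn_integral_cmult[symmetric] mult_ac intro!: nn_integral_cong)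
  also have "\<dots> = (\<integral>\<^sup>+n. \<integral>\<^sup>+l. of_bool (n \<preceq>i l) * G l * F n \<partial>count_space UNIV \<partial>count_space UNIV)"
    by (rule nn_integral_count_space_swap)
  also have "\<dots> = (\<integral>\<^sup>+n. up_sum 1 G n * F n \<partial>count_space UNIV)"
    by (simp add: up_sum_def nn_integral_multc)
  finally show ?thesis .
qed

text \<open>This is the commutation relation of the half vertex operators.\<close>

lemma up_sum_down_sum: "up_sum b (down_sum a F) n = geom (a * b) * down_sum a (up_sum b F) n"
proof -
  let ?w = "\<lambda>l m. a ^ (psize l - psize m) * b ^ (psize l - psize n)"
  let ?v = "\<lambda>m k. b ^ (psize m - psize k) * a ^ (psize n - psize k)"
  have "up_sum b (down_sum a F) n =
    (\<integral>\<^sup>+l. \<integral>\<^sup>+m. of_bool (m \<preceq>i l \<and> n \<preceq>i l) * ?w l m * F m \<partial>count_space UNIV \<partial>count_space UNIV)"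
    by (auto simp: up_sum_def down_sum_def nn_integral_cmult[symmetric] mult_ac of_bool_conj
        intro!: nn_integral_cong)
  also have "\<dots> = (\<integral>\<^sup>+m. \<integral>\<^sup>+l. of_bool (m \<preceq>i l \<and> n \<preceq>i l) * ?w l m * F m \<partial>count_space UNIV \<partial>count_space UNIV)"
    by (rule nn_integral_count_space_swap)
  also have "\<dots> = (\<integral>\<^sup>+m. geom (a * b) *
      (\<integral>\<^sup>+k. of_bool (k \<preceq>i m \<and> k \<preceq>i n) * ?v m k \<partial>count_space UNIV) * F m \<partial>count_space UNIV)"
    by (intro nn_integral_cong) (simp add: nn_integral_multc sum_common_upper)
  also have "\<dots> = geom (a * b) *
      (\<integral>\<^sup>+m. \<integral>\<^sup>+k. of_bool (k \<preceq>i m \<and> k \<preceq>i n) * ?v m k * F m \<partial>count_space UNIV \<partial>count_space UNIV)"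
    unfolding nn_integral_multc[OF borel_measurable_count_space]
    by (subst nn_integral_cmult[symmetric]) (simp_all add: mult.assoc)
  also have "\<dots> = geom (a * b) *
      (\<integral>\<^sup>+k. \<integral>\<^sup>+m. of_bool (k \<preceq>i m \<and> k \<preceq>i n) * ?v m k * F m \<partial>count_space UNIV \<partial>count_space UNIV)"
    by (subst nn_integral_count_space_swap) simp
  also have "\<dots> = geom (a * b) * down_sum a (up_sum b F) n"
    by (auto simp: up_sum_def down_sum_def nn_integral_cmult[symmetric] mult_ac of_bool_conj
        intro!: nn_integral_cong arg_cong[where f = "\<lambda>z. geom (a * b) * z"])
  finally show ?thesis .
qed

primrec chain_gf :: "ennreal \<Rightarrow> nat \<Rightarrow> (nat \<Rightarrow> nat) \<Rightarrow> ennreal" where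
  "chain_gf u 0 = (\<lambda>l. of_bool (l = (\<lambda>_. 0)))"
| "chain_gf u (Suc M) = down_sum 1 (\<lambda>n. u ^ psize n * chain_gf u M n)"

lemma chain_gf_zero: "chain_gf u M (\<lambda>_. 0) = 1"
proof (induction M)
  case (Suc M)
  then show ?case
    by (simp add: down_sum_def, subst nn_integral_count_space_singleton[where a = "\<lambda>_. 0"]) auto
qed simp

lemma up_sum_chain_gf:
  "up_sum b (chain_gf u M) n = (\<Prod>i<M. geom (b * u ^ i)) * chain_gf u M n"
proof (induction M arbitrary: b n)
  case 0
  show ?case
    unfolding up_sum_def by (subst nn_integral_count_space_singleton[where a = "\<lambda>_. 0"]) auto
next
  case (Suc M)
  have "up_sum b (\<lambda>m. u ^ psize m * chain_gf u M m) =
    (\<lambda>k. (\<Prod>i<M. geom (b * u * u ^ i)) * (u ^ psize k * chain_gf u M k))"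
    unfolding up_sum_power_psize[abs_def] Suc.IH by (simp add: mult_ac)
  then have "up_sum b (chain_gf u (Suc M)) n =
    geom b * ((\<Prod>i<M. geom (b * u * u ^ i)) * chain_gf u (Suc M) n)"
    by (simp add: up_sum_down_sum down_sum_cmult)
  also have "\<dots> = (\<Prod>i<Suc M. geom (b * u ^ i)) * chain_gf u (Suc M) n"
    by (subst prod.lessThan_Suc_shift) (simp add: mult_ac del: chain_gf.simps)
  finally show ?case .
qed

lemma chain_gf_Cauchy:
  "(\<integral>\<^sup>+l. y ^ psize l * chain_gf u N l * chain_gf u M l \<partial>count_space UNIV) =
   (\<Prod>j<N. \<Prod>i<M. geom (y * u ^ (i + j)))"
proof (induction N arbitrary: y)
  case 0
  show ?case
    by (subst nn_integral_count_space_singleton[where a = "\<lambda>_. 0"]) (auto simp: chain_gf_zero)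
next
  case (Suc N)
  have "(\<integral>\<^sup>+l. y ^ psize l * chain_gf u (Suc N) l * chain_gf u M l \<partial>count_space UNIV) =
    (\<integral>\<^sup>+l. (y ^ psize l * chain_gf u M l) * down_sum 1 (\<lambda>n. u ^ psize n * chain_gf u N n) l \<partial>count_space UNIV)"
    by (simp add: mult_ac)
  also have "\<dots> = (\<integral>\<^sup>+n. up_sum 1 (\<lambda>l. y ^ psize l * chain_gf u M l) n * (u ^ psize n * chain_gf u N n) \<partial>count_space UNIV)"
    by (rule nn_integral_mult_down_sum)
  also have "\<dots> = (\<integral>\<^sup>+n. (\<Prod>i<M. geom (y * u ^ i)) * ((y * u) ^ psize n * chain_gf u N n * chain_gf u M n) \<partial>count_space UNIV)"
    unfolding up_sum_power_psize up_sum_chain_gf by (simp add: power_mult_distrib mult_ac)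
  also have "\<dots> = (\<Prod>i<M. geom (y * u ^ i)) * (\<Prod>j<N. \<Prod>i<M. geom (y * u * u ^ (i + j)))"
    by (simp add: nn_integral_cmult Suc.IH)
  also have "\<dots> = (\<Prod>j<Suc N. \<Prod>i<M. geom (y * u ^ (i + j)))"
    by (subst prod.lessThan_Suc_shift) (simp add: mult_ac)
  finally show ?case .
qed

definition interlacing_chains :: "nat \<Rightarrow> (nat \<Rightarrow> nat \<Rightarrow> nat) set" where
  "interlacing_chains N = {C. (\<forall>d. C (Suc d) \<preceq>i C d) \<and> (\<forall>d\<ge>N. C d = (\<lambda>_. 0))}"

definition tail_size :: "nat \<Rightarrow> (nat \<Rightarrow> nat \<Rightarrow> nat) \<Rightarrow> nat" where
  "tail_size N C = (\<Sum>d<N. psize (C (Suc d)))"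

lemma interlacing_chains_0: "interlacing_chains 0 = {\<lambda>_ _. 0}"
  by (auto simp: interlacing_chains_def)

lemma interlacing_chains_Suc_iff: "C \<in> interlacing_chains (Suc N) \<longleftrightarrow> C \<circ> Suc \<in> interlacing_chains N \<and> C 1 \<preceq>i C 0"
proof
  assume "C \<in> interlacing_chains (Suc N)"
  then show "C \<circ> Suc \<in> interlacing_chains N \<and> C 1 \<preceq>i C 0" by (auto simp: interlacing_chains_def)
next
  assume C: "C \<circ> Suc \<in> interlacing_chains N \<and> C 1 \<preceq>i C 0"
  have "C (Suc d) \<preceq>i C d" for d using C by (cases d) (auto simp: interlacing_chains_def)
  moreover have "C d = (\<lambda>_. 0)" if "d \<ge> Suc N" for d using C that by (cases d) (auto simp: interlacing_chains_def)
  ultimately show "C \<in> interlacing_chains (Suc N)" by (auto simp: interlacing_chains_def)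
qed

lemma bij_betw_chain_tail:
  "bij_betw (\<lambda>C. C \<circ> Suc) {C \<in> interlacing_chains (Suc N). C 0 = l} {C \<in> interlacing_chains N. C 0 \<preceq>i l}"
proof (rule bij_betw_byWitness[where f' = "case_nat l"])
  show "\<forall>C\<in>{C \<in> interlacing_chains (Suc N). C 0 = l}. case_nat l (C \<circ> Suc) = C"
    by (auto simp: fun_eq_iff split: nat.splits)
  have tail: "case_nat l C \<circ> Suc = C" for C :: "nat \<Rightarrow> nat \<Rightarrow> nat" by auto
  then show "\<forall>C\<in>{C \<in> interlacing_chains N. C 0 \<preceq>i l}. case_nat l C \<circ> Suc = C" by blast
  show "(\<lambda>C. C \<circ> Suc) ` {C \<in> interlacing_chains (Suc N). C 0 = l} \<subseteq> {C \<in> interlacing_chains N. C 0 \<preceq>i l}"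
    by (auto simp: interlacing_chains_Suc_iff)
  show "case_nat l ` {C \<in> interlacing_chains N. C 0 \<preceq>i l} \<subseteq> {C \<in> interlacing_chains (Suc N). C 0 = l}"
    using tail by (auto simp: interlacing_chains_Suc_iff)
qed

lemma chain_gf_eq_sum_interlacing_chains:
  "chain_gf u N l = (\<integral>\<^sup>+C. of_bool (C \<in> interlacing_chains N \<and> C 0 = l) * u ^ tail_size N C \<partial>count_space UNIV)"
proof (induction N arbitrary: l)
  case 0
  show ?case
    by (subst nn_integral_count_space_singleton[where a = "\<lambda>_ _. 0"]) (auto simp: interlacing_chains_0 tail_size_def)
next
  case (Suc N)
  let ?w = "\<lambda>C. u ^ (psize (C 0) + tail_size N C)"
  have "chain_gf u (Suc N) l = (\<integral>\<^sup>+n. \<integral>\<^sup>+C. of_bool (C \<in> interlacing_chains N \<and> C 0 \<preceq>i l \<and> C 0 = n) * ?w C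
      \<partial>count_space UNIV \<partial>count_space UNIV)"
    by (auto simp: down_sum_def Suc.IH nn_integral_cmult[symmetric] power_add intro!: nn_integral_cong)
  also have "\<dots> = (\<integral>\<^sup>+C. \<integral>\<^sup>+n. of_bool (C \<in> interlacing_chains N \<and> C 0 \<preceq>i l \<and> C 0 = n) * ?w C
      \<partial>count_space UNIV \<partial>count_space UNIV)"
    by (rule nn_integral_count_space_swap)
  also have "\<dots> = (\<integral>\<^sup>+C. of_bool (C \<in> {C \<in> interlacing_chains N. C 0 \<preceq>i l}) * ?w C \<partial>count_space UNIV)"
    by (rule nn_integral_cong, subst nn_integral_count_space_singleton[where a = "_ 0"]) auto
  also have "\<dots> = (\<integral>\<^sup>+C. ?w C \<partial>count_space {C \<in> interlacing_chains N. C 0 \<preceq>i l})"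
    by (rule nn_integral_count_space_of_bool[symmetric])
  also have "\<dots> = (\<integral>\<^sup>+C. ?w (C \<circ> Suc) \<partial>count_space {C \<in> interlacing_chains (Suc N). C 0 = l})"
    by (rule nn_integral_bij_count_space[OF bij_betw_chain_tail, symmetric])
  also have "\<dots> = (\<integral>\<^sup>+C. u ^ tail_size (Suc N) C \<partial>count_space {C \<in> interlacing_chains (Suc N). C 0 = l})"
    by (intro nn_integral_cong) (simp only: tail_size_def sum.lessThan_Suc_shift, simp)
  finally show ?case by (simp add: nn_integral_count_space_of_bool[of "Collect _"])
qed

section \<open>The trace generating function of plane partitions\<close>

definition pp_size :: "(nat \<Rightarrow> nat \<Rightarrow> nat) \<Rightarrow> nat" where
  "pp_size \<pi> = (\<Sum>(i, j)\<in>{(i, j). \<pi> i j \<noteq> 0}. \<pi> i j)"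

definition is_pp :: "(nat \<Rightarrow> nat \<Rightarrow> nat) \<Rightarrow> bool" where
  "is_pp \<pi> \<longleftrightarrow> plane_partition \<pi> (pp_size \<pi>)"

definition banded_pps :: "nat \<Rightarrow> (nat \<Rightarrow> nat \<Rightarrow> nat) set" where
  "banded_pps N = {\<pi>. is_pp \<pi> \<and> (\<forall>i d. d \<ge> N \<longrightarrow> \<pi> i (i + d) = 0 \<and> \<pi> (i + d) i = 0)}"

definition glue :: "(nat \<Rightarrow> nat \<Rightarrow> nat) \<times> (nat \<Rightarrow> nat \<Rightarrow> nat) \<Rightarrow> nat \<Rightarrow> nat \<Rightarrow> nat" where
  "glue = (\<lambda>(C, C') i j. if i \<le> j then C (j - i) i else C' (i - j) j)"

definition diagonals :: "(nat \<Rightarrow> nat \<Rightarrow> nat) \<Rightarrow> (nat \<Rightarrow> nat \<Rightarrow> nat) \<times> (nat \<Rightarrow> nat \<Rightarrow> nat)" where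
  "diagonals \<pi> = (\<lambda>d i. \<pi> i (i + d), \<lambda>d i. \<pi> (i + d) i)"

definition chain_pairs :: "nat \<Rightarrow> ((nat \<Rightarrow> nat \<Rightarrow> nat) \<times> (nat \<Rightarrow> nat \<Rightarrow> nat)) set" where
  "chain_pairs N = {(C, C'). C \<in> interlacing_chains N \<and> C' \<in> interlacing_chains N \<and> C 0 = C' 0}"

lemma plane_partition_iff: "plane_partition \<pi> n \<longleftrightarrow> is_pp \<pi> \<and> pp_size \<pi> = n"
proof -
  have "plane_partition \<pi> n \<Longrightarrow> pp_size \<pi> = n"
    unfolding plane_partition_def pp_size_def by (elim conjE)
  then show ?thesis unfolding is_pp_def by blast
qed

lemma is_pp_iff:
  "is_pp \<pi> \<longleftrightarrow> (\<forall>i j. \<pi> (Suc i) j \<le> \<pi> i j) \<and> (\<forall>i j. \<pi> i (Suc j) \<le> \<pi> i j) \<and> finite {(i, j). \<pi> i j \<noteq> 0}"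
  by (auto simp: is_pp_def plane_partition_def pp_size_def)

lemma glue_support_eq:
  assumes "C \<in> interlacing_chains N" "C' \<in> interlacing_chains N"
  shows "{(i, j). glue (C, C') i j \<noteq> 0} =
    (\<lambda>(d, i). (i, i + d)) ` (SIGMA d:{..<N}. {i. C d i \<noteq> 0}) \<union>
    (\<lambda>(d, i). (i + Suc d, i)) ` (SIGMA d:{..<N}. {i. C' (Suc d) i \<noteq> 0})" (is "?S = ?f ` ?U \<union> ?g ` ?V")
proof (intro equalityI subsetI)
  have d_less: "d < N" if "C d i \<noteq> 0 \<or> C' d i \<noteq> 0" for d i
    using assms that by (force simp: interlacing_chains_def not_less[symmetric])
  fix p assume "p \<in> ?S"
  then obtain i j where p: "p = (i, j)" "glue (C, C') i j \<noteq> 0" by auto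
  show "p \<in> ?f ` ?U \<union> ?g ` ?V"
  proof (cases "i \<le> j")
    case True
    then have "p = ?f (j - i, i)" "(j - i, i) \<in> ?U" using p d_less by (auto simp: glue_def)
    then show ?thesis by blast
  next
    case False
    then have "C' (i - j) j \<noteq> 0" using p by (simp add: glue_def)
    from False d_less[OF disjI2[OF this]] this have "p = ?g (i - j - 1, j)" "(i - j - 1, j) \<in> ?V"
      using p by (auto simp: Suc_diff_Suc)
    then show ?thesis by blast
  qed
qed (auto simp: glue_def)

lemma fin_supp_chain: "C \<in> interlacing_chains N \<Longrightarrow> fin_supp (C d)"
  using interlaces_fin_supp(2) by (auto simp: interlacing_chains_def)

lemma finite_glue_support:
  assumes "C \<in> interlacing_chains N" "C' \<in> interlacing_chains N" shows "finite {(i, j). glue (C, C') i j \<noteq> 0}"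
  unfolding glue_support_eq[OF assms]
  using fin_supp_chain[OF assms(1)] fin_supp_chain[OF assms(2)] by (auto simp: fin_supp_def)

lemma pp_size_glue:
  assumes "C \<in> interlacing_chains N" "C' \<in> interlacing_chains N"
  shows "pp_size (glue (C, C')) = psize (C 0) + tail_size N C + tail_size N C'"
proof -
  let ?U = "SIGMA d:{..<N}. {i. C d i \<noteq> 0}" and ?V = "SIGMA d:{..<N}. {i. C' (Suc d) i \<noteq> 0}"
  let ?f = "\<lambda>(d, i). (i, i + d) :: nat \<times> nat" and ?g = "\<lambda>(d, i). (i + Suc d, i) :: nat \<times> nat"
  have fin: "finite {i. C d i \<noteq> 0}" "finite {i. C' d i \<noteq> 0}" for d
    using fin_supp_chain[OF assms(1)] fin_supp_chain[OF assms(2)] by (auto simp: fin_supp_def)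
  have "pp_size (glue (C, C')) =
      (\<Sum>(i, j)\<in>?f ` ?U. glue (C, C') i j) + (\<Sum>(i, j)\<in>?g ` ?V. glue (C, C') i j)"
    unfolding pp_size_def glue_support_eq[OF assms]
    by (rule sum.union_disjoint) (use fin in auto)
  also have "(\<Sum>(i, j)\<in>?f ` ?U. glue (C, C') i j) = (\<Sum>(d, i)\<in>?U. C d i)"
    by (subst sum.reindex) (auto simp: glue_def inj_on_def intro!: sum.cong)
  also have "\<dots> = (\<Sum>d<N. psize (C d))"
    using fin by (subst sum.Sigma[symmetric]) (auto simp: psize_def)
  also have "\<dots> = (\<Sum>d<Suc N. psize (C d))" using assms by (simp add: interlacing_chains_def)
  also have "\<dots> = psize (C 0) + tail_size N C" unfolding tail_size_def by (rule sum.lessThan_Suc_shift)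
  also have "(\<Sum>(i, j)\<in>?g ` ?V. glue (C, C') i j) = (\<Sum>(d, i)\<in>?V. C' (Suc d) i)"
    by (subst sum.reindex) (auto simp: glue_def inj_on_def intro!: sum.cong)
  also have "\<dots> = tail_size N C'"
    using fin unfolding tail_size_def by (subst sum.Sigma[symmetric]) (auto simp: psize_def)
  finally show ?thesis .
qed

lemma pp_trace_glue: "pp_trace (glue (C, C')) = psize (C 0)"
  by (simp add: pp_trace_def psize_def glue_def)

lemma glue_decreasing:
  assumes "C \<in> interlacing_chains N" "C' \<in> interlacing_chains N" "C 0 = C' 0"
  shows "glue (C, C') (Suc i) j \<le> glue (C, C') i j" "glue (C, C') i (Suc j) \<le> glue (C, C') i j"
proof -
  have C: "C (Suc d) i \<le> C d i" "C d (Suc i) \<le> C (Suc d) i"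
    and C': "C' (Suc d) i \<le> C' d i" "C' d (Suc i) \<le> C' (Suc d) i" for d i
    using assms(1,2) interlacesD by (auto simp: interlacing_chains_def)
  have "glue (C, C') (Suc i) j \<le> glue (C, C') i j \<and> glue (C, C') i (Suc j) \<le> glue (C, C') i j"
  proof (cases i j rule: linorder_cases)
    case less
    then obtain d where "j = i + Suc d" using less_imp_Suc_add by auto
    then have "j - i = Suc d" "j - Suc i = d" "Suc j - i = Suc (Suc d)" by auto
    then show ?thesis using less C[of d i] C[of "Suc d" i] by (simp add: glue_def)
  next
    case equal
    then show ?thesis using C[of 0 i] C'[of 0 i] assms(3) by (simp add: glue_def)
  next
    case greater
    then obtain d where d: "i = j + Suc d" using less_imp_Suc_add by auto
    then have "i - j = Suc d" "i - Suc j = d" "Suc i - j = Suc (Suc d)" by auto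
    then show ?thesis using d C'[of d j] C'[of "Suc d" j] assms(3) by (auto simp: glue_def)
  qed
  then show "glue (C, C') (Suc i) j \<le> glue (C, C') i j" "glue (C, C') i (Suc j) \<le> glue (C, C') i j"
    by auto
qed

lemma glue_in_banded_pps:
  assumes "p \<in> chain_pairs N" shows "glue p \<in> banded_pps N"
proof -
  obtain C C' where p: "p = (C, C')" and C: "C \<in> interlacing_chains N" "C' \<in> interlacing_chains N" "C 0 = C' 0"
    using assms by (auto simp: chain_pairs_def)
  have "glue (C, C') i (i + d) = 0 \<and> glue (C, C') (i + d) i = 0" if "d \<ge> N" for i d
    using C that by (auto simp: glue_def interlacing_chains_def)
  then show ?thesis
    using glue_decreasing[OF C] finite_glue_support[OF C(1,2)] by (auto simp: p banded_pps_def is_pp_iff)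
qed

lemma diagonals_in_chain_pairs:
  assumes "\<pi> \<in> banded_pps N" shows "diagonals \<pi> \<in> chain_pairs N"
proof -
  have \<pi>: "is_pp \<pi>" "\<And>i d. d \<ge> N \<Longrightarrow> \<pi> i (i + d) = 0" "\<And>i d. d \<ge> N \<Longrightarrow> \<pi> (i + d) i = 0"
    using assms by (auto simp: banded_pps_def)
  then have fin: "finite {(i, j). \<pi> i j \<noteq> 0}" by (simp add: is_pp_iff)
  have "{i. \<pi> i (i + d) \<noteq> 0} \<subseteq> fst ` {(i, j). \<pi> i j \<noteq> 0}" "{i. \<pi> (i + d) i \<noteq> 0} \<subseteq> snd ` {(i, j). \<pi> i j \<noteq> 0}" for d
    by force+
  then have "fin_supp (\<lambda>i. \<pi> i (i + d))" "fin_supp (\<lambda>i. \<pi> (i + d) i)" for d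
    unfolding fin_supp_def using fin by (meson finite_imageI finite_subset)+
  with \<pi> show ?thesis
    by (auto simp: diagonals_def chain_pairs_def interlacing_chains_def interlaces_def is_pp_iff fun_eq_iff)
qed

lemma bij_betw_glue: "bij_betw glue (chain_pairs N) (banded_pps N)"
proof (rule bij_betw_byWitness[where f' = diagonals])
  show "\<forall>p\<in>chain_pairs N. diagonals (glue p) = p"
    by (auto simp: glue_def diagonals_def chain_pairs_def fun_eq_iff)
  show "\<forall>\<pi>\<in>banded_pps N. glue (diagonals \<pi>) = \<pi>"
    by (auto simp: glue_def diagonals_def fun_eq_iff)
qed (auto intro: glue_in_banded_pps diagonals_in_chain_pairs)

lemma banded_pps_gf:
  "(\<integral>\<^sup>+\<pi>. of_bool (\<pi> \<in> banded_pps N) * (x ^ pp_trace \<pi> * u ^ pp_size \<pi>) \<partial>count_space UNIV) =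
   (\<Prod>j<N. \<Prod>i<N. geom (x * u ^ (i + j + 1)))"
proof -
  let ?w = "\<lambda>\<pi>. x ^ pp_trace \<pi> * u ^ pp_size \<pi>"
  have w_glue: "?w (glue (C, C')) = (x * u) ^ psize (C 0) * u ^ tail_size N C * u ^ tail_size N C'"
    if "(C, C') \<in> chain_pairs N" for C C'
    using that by (auto simp: chain_pairs_def pp_trace_glue pp_size_glue power_mult_distrib power_add mult_ac)
  have "(\<integral>\<^sup>+\<pi>. of_bool (\<pi> \<in> banded_pps N) * ?w \<pi> \<partial>count_space UNIV) = (\<integral>\<^sup>+\<pi>. ?w \<pi> \<partial>count_space (banded_pps N))"
    by (rule nn_integral_count_space_of_bool[symmetric])
  also have "\<dots> = (\<integral>\<^sup>+p. ?w (glue p) \<partial>count_space (chain_pairs N))"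
    by (rule nn_integral_bij_count_space[OF bij_betw_glue, symmetric])
  also have "\<dots> = (\<integral>\<^sup>+C. \<integral>\<^sup>+C'. of_bool ((C, C') \<in> chain_pairs N) * ?w (glue (C, C'))
       \<partial>count_space UNIV \<partial>count_space UNIV)"
    unfolding nn_integral_count_space_of_bool[of "chain_pairs N"]
    by (subst nn_integral_fst_count_space[symmetric]) simp
  also have "\<dots> = (\<integral>\<^sup>+C. \<integral>\<^sup>+C'. of_bool (C \<in> interlacing_chains N) * (x * u) ^ psize (C 0) * u ^ tail_size N C *
      (of_bool (C' \<in> interlacing_chains N \<and> C' 0 = C 0) * u ^ tail_size N C') \<partial>count_space UNIV \<partial>count_space UNIV)"
    by (intro nn_integral_cong) (use w_glue in \<open>auto simp: chain_pairs_def of_bool_def\<close>)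
  also have "\<dots> = (\<integral>\<^sup>+C. of_bool (C \<in> interlacing_chains N) * (x * u) ^ psize (C 0) * u ^ tail_size N C *
      chain_gf u N (C 0) \<partial>count_space UNIV)"
    by (simp add: nn_integral_cmult chain_gf_eq_sum_interlacing_chains)
  also have "\<dots> = (\<integral>\<^sup>+C. \<integral>\<^sup>+l. of_bool (C \<in> interlacing_chains N \<and> C 0 = l) * u ^ tail_size N C *
      ((x * u) ^ psize l * chain_gf u N l) \<partial>count_space UNIV \<partial>count_space UNIV)"
    by (rule nn_integral_cong, subst nn_integral_count_space_singleton[where a = "_ 0"]) (auto simp: mult_ac)
  also have "\<dots> = (\<integral>\<^sup>+l. \<integral>\<^sup>+C. of_bool (C \<in> interlacing_chains N \<and> C 0 = l) * u ^ tail_size N C *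
      ((x * u) ^ psize l * chain_gf u N l) \<partial>count_space UNIV \<partial>count_space UNIV)"
    by (rule nn_integral_count_space_swap)
  also have "\<dots> = (\<integral>\<^sup>+l. (x * u) ^ psize l * chain_gf u N l * chain_gf u N l \<partial>count_space UNIV)"
    by (subst nn_integral_multc, simp, simp only: chain_gf_eq_sum_interlacing_chains[symmetric]) (simp add: mult_ac)
  also have "\<dots> = (\<Prod>j<N. \<Prod>i<N. geom (x * u * u ^ (i + j)))" by (rule chain_gf_Cauchy)
  finally show ?thesis by (simp add: mult_ac)
qed

lemma mono_banded_pps: "N \<le> M \<Longrightarrow> banded_pps N \<subseteq> banded_pps M"
  by (auto simp: banded_pps_def)

lemma is_pp_iff_banded: "is_pp \<pi> \<longleftrightarrow> (\<exists>N. \<pi> \<in> banded_pps N)"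
proof
  assume pp: "is_pp \<pi>"
  then have "finite ((\<lambda>(i, j). i + j) ` {(i, j). \<pi> i j \<noteq> 0})" by (simp add: is_pp_iff)
  then obtain N where "(\<lambda>(i, j). i + j) ` {(i, j). \<pi> i j \<noteq> 0} \<subseteq> {..<N}"
    using finite_nat_bounded by blast
  then have "\<pi> i j \<noteq> 0 \<Longrightarrow> i + j < N" for i j by force
  from this[of _ "_ + _"] this[of "_ + _"] have "\<pi> \<in> banded_pps N"
    using pp by (force simp: banded_pps_def)
  then show "\<exists>N. \<pi> \<in> banded_pps N" ..
qed (auto simp: banded_pps_def)

lemma pp_gf_product_LIMSEQ:
  "(\<lambda>N. \<Prod>j<N. \<Prod>i<N. geom (x * u ^ (i + j + 1))) \<longlonglongrightarrow>
   (\<integral>\<^sup>+\<pi>. of_bool (is_pp \<pi>) * (x ^ pp_trace \<pi> * u ^ pp_size \<pi>) \<partial>count_space UNIV)"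
proof -
  let ?w = "\<lambda>\<pi>. x ^ pp_trace \<pi> * u ^ pp_size \<pi>"
  have "(\<lambda>N. \<integral>\<^sup>+\<pi>. of_bool (\<pi> \<in> banded_pps N) * ?w \<pi> \<partial>count_space UNIV) \<longlonglongrightarrow>
    (\<integral>\<^sup>+\<pi>. of_bool (is_pp \<pi>) * ?w \<pi> \<partial>count_space UNIV)"
  proof (rule nn_integral_LIMSEQ)
    show "incseq (\<lambda>N \<pi>. of_bool (\<pi> \<in> banded_pps N) * ?w \<pi>)"
      using mono_banded_pps by (auto simp: incseq_def le_fun_def of_bool_def)
    fix \<pi>
    have "eventually (\<lambda>N. \<pi> \<in> banded_pps N \<longleftrightarrow> is_pp \<pi>) sequentially"
      unfolding is_pp_iff_banded eventually_sequentially using mono_banded_pps by blast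
    then have "eventually (\<lambda>N. of_bool (\<pi> \<in> banded_pps N) * ?w \<pi> = of_bool (is_pp \<pi>) * ?w \<pi>) sequentially"
      by (rule eventually_mono) simp
    then show "(\<lambda>N. of_bool (\<pi> \<in> banded_pps N) * ?w \<pi>) \<longlonglongrightarrow> of_bool (is_pp \<pi>) * ?w \<pi>"
      by (rule tendsto_eventually)
  qed simp
  then show ?thesis by (simp add: banded_pps_gf)
qed

section \<open>The logarithm of the generating function\<close>

definition koebe :: "'a::field \<Rightarrow> 'a" where
  "koebe v = v / (1 - v)\<^sup>2"

definition pp_log :: "'a::{real_normed_field,banach} \<Rightarrow> 'a \<Rightarrow> 'a" where
  "pp_log x u = (\<Sum>k. x ^ Suc k / of_nat (Suc k) * koebe (u ^ Suc k))"

lemma norm_koebe_le: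
  fixes v :: "'a::real_normed_field"
  assumes "norm v \<le> \<rho>" "\<rho> < 1" shows "norm (koebe v) \<le> 1 / (1 - \<rho>)\<^sup>2"
  unfolding koebe_def norm_divide norm_power
proof (rule frac_le)
  have "1 - \<rho> \<le> norm (1 - v)" using assms norm_triangle_ineq2[of 1 v] by simp
  then show "(1 - \<rho>)\<^sup>2 \<le> norm (1 - v) ^ 2" using assms by (intro power_mono) auto
qed (use assms in auto)

lemma norm_power_Suc_le:
  fixes u :: "'a::real_normed_div_algebra"
  assumes "norm u \<le> 1" shows "norm (u ^ Suc k) \<le> norm u"
  using assms by (simp add: norm_mult norm_power mult_left_le power_le_one)

lemma norm_pp_log_term_le:
  fixes x u :: "'a::real_normed_field"
  assumes "norm u \<le> \<rho>" "\<rho> < 1"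
  shows "norm (x ^ Suc k / of_nat (Suc k) * koebe (u ^ Suc k)) \<le> norm x ^ Suc k / (1 - \<rho>)\<^sup>2"
proof -
  have "norm (x ^ Suc k / of_nat (Suc k)) = norm x ^ Suc k / real (Suc k)"
    unfolding norm_divide norm_power norm_of_nat ..
  also have "\<dots> \<le> norm x ^ Suc k / 1" by (rule divide_left_mono) auto
  finally have "norm (x ^ Suc k / of_nat (Suc k)) \<le> norm x ^ Suc k" by simp
  moreover have "norm (koebe (u ^ Suc k)) \<le> 1 / (1 - \<rho>)\<^sup>2"
    using assms norm_power_Suc_le[of u k] by (intro norm_koebe_le) auto
  ultimately have "norm (x ^ Suc k / of_nat (Suc k)) * norm (koebe (u ^ Suc k)) \<le> norm x ^ Suc k * (1 / (1 - \<rho>)\<^sup>2)"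
    by (intro mult_mono) auto
  then show ?thesis unfolding norm_mult[symmetric] by simp
qed

lemma summable_power_Suc_divide:
  fixes y :: real assumes "0 \<le> y" "y < 1" shows "summable (\<lambda>k. y ^ Suc k / c)"
  using assms by (intro summable_divide) (simp add: summable_mult summable_geometric)

lemma summable_norm_pp_log:
  fixes x u :: "'a::real_normed_field"
  assumes "norm x < 1" "norm u < 1"
  shows "summable (\<lambda>k. norm (x ^ Suc k / of_nat (Suc k) * koebe (u ^ Suc k)))"
  by (rule summable_comparison_test'[OF summable_power_Suc_divide, where N = 0])
     (use norm_pp_log_term_le[OF order_refl assms(2), of x] assms in auto)

lemma pp_log_sums:
  fixes x u :: "'a::{real_normed_field,banach}"
  assumes "norm x < 1" "norm u < 1"
  shows "(\<lambda>k. x ^ Suc k / of_nat (Suc k) * koebe (u ^ Suc k)) sums pp_log x u"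
  unfolding pp_log_def using summable_norm_pp_log[OF assms] by (rule summable_sums[OF summable_norm_cancel])

lemma pp_log_of_real:
  fixes x u :: real assumes "\<bar>x\<bar> < 1" "\<bar>u\<bar> < 1"
  shows "pp_log (complex_of_real x) (complex_of_real u) = complex_of_real (pp_log x u)"
proof -
  have "(\<lambda>k. complex_of_real (x ^ Suc k / of_nat (Suc k) * koebe (u ^ Suc k))) sums complex_of_real (pp_log x u)"
    using assms by (intro sums_of_real pp_log_sums) auto
  then have "(\<lambda>k. complex_of_real x ^ Suc k / of_nat (Suc k) * koebe (complex_of_real u ^ Suc k))
      sums complex_of_real (pp_log x u)"
    by (simp add: koebe_def)
  moreover have "(\<lambda>k. complex_of_real x ^ Suc k / of_nat (Suc k) * koebe (complex_of_real u ^ Suc k)) sums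
      pp_log (complex_of_real x) (complex_of_real u)"
    using assms by (intro pp_log_sums) auto
  ultimately show ?thesis using sums_unique2 by blast
qed

lemma holomorphic_pp_log_fst:
  assumes "norm u < 1" shows "(\<lambda>x. pp_log x u) holomorphic_on ball (0::complex) 1"
proof (rule power_series_holomorphic)
  fix x :: complex assume "x \<in> ball 0 1"
  then have "(\<lambda>k. x ^ Suc k / of_nat (Suc k) * koebe (u ^ Suc k)) sums pp_log x u"
    using assms by (intro pp_log_sums) auto
  then have "(\<lambda>k. koebe (u ^ Suc k) / of_nat (Suc k) * (x - 0) ^ Suc k) sums pp_log x u"
    by (simp add: mult_ac)
  then show "(\<lambda>n. koebe (u ^ n) / of_nat n * (x - 0) ^ n) sums pp_log x u"
    using sums_Suc_iff[of "\<lambda>n. koebe (u ^ n) / of_nat n * (x - 0) ^ n" "pp_log x u"] by simp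
qed

lemma holomorphic_koebe_power: "(\<lambda>u. koebe (u ^ Suc k)) holomorphic_on ball (0::complex) 1"
  unfolding koebe_def
proof (intro holomorphic_intros)
  fix u :: complex assume "u \<in> ball 0 1"
  then have "norm (u ^ Suc k) < 1" using norm_power_Suc_le[of u k] by simp
  then show "(1 - u ^ Suc k)\<^sup>2 \<noteq> 0" by auto
qed

lemma holomorphic_pp_log_snd:
  assumes "norm x < 1" shows "pp_log x holomorphic_on ball (0::complex) 1"
proof (rule holomorphic_uniform_sequence)
  let ?f = "\<lambda>k u. x ^ Suc k / of_nat (Suc k) * koebe (u ^ Suc k)"
  show "(\<lambda>u. \<Sum>k<n. ?f k u) holomorphic_on ball 0 1" for n
    by (intro holomorphic_intros holomorphic_koebe_power) simp
  fix u :: complex assume "u \<in> ball 0 1"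
  then have u: "norm u < 1" by simp
  define d where "d = (1 - norm u) / 2"
  have d: "d > 0" "norm u + d < 1" using u by (auto simp: d_def field_simps)
  have norm_le: "norm v \<le> norm u + d" if "v \<in> cball u d" for v
    using that norm_triangle_ineq2[of v u] by (simp add: dist_norm norm_minus_commute)
  have "uniform_limit (cball u d) (\<lambda>n v. \<Sum>k<n. ?f k v) (\<lambda>v. \<Sum>k. ?f k v) sequentially"
    using norm_pp_log_term_le[OF norm_le d(2)] assms
    by (intro Weierstrass_m_test[OF _ summable_power_Suc_divide]) auto
  then show "\<exists>d>0. cball u d \<subseteq> ball 0 1 \<and> uniform_limit (cball u d) (\<lambda>n v. \<Sum>k<n. ?f k v) (pp_log x) sequentially"
    using d norm_le unfolding pp_log_def[abs_def] by (intro exI[of _ d]) force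
qed simp

subsection \<open>The infinite product\<close>

lemma abs_mult_power_less_1:
  fixes x u :: real assumes "\<bar>x\<bar> < 1" "\<bar>u\<bar> \<le> 1" shows "\<bar>x * u ^ n\<bar> < 1"
proof -
  have "\<bar>x * u ^ n\<bar> \<le> \<bar>x\<bar>" using assms by (simp add: abs_mult power_abs mult_left_le power_le_one)
  then show ?thesis using assms by linarith
qed

lemma sum_grid_power:
  fixes x u :: "'a::comm_semiring_1"
  shows "(\<Sum>j<N. \<Sum>i<N. (x * u ^ (i + j + 1)) ^ K) = x ^ K * (u ^ K * (\<Sum>i<N. (u ^ K) ^ i)\<^sup>2)"
proof -
  have "(\<Sum>j<N. \<Sum>i<N. (x * u ^ (i + j + 1)) ^ K) = (\<Sum>j<N. \<Sum>i<N. x ^ K * u ^ K * ((u ^ K) ^ i * (u ^ K) ^ j))"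
    by (intro sum.cong refl) (simp add: power_mult_distrib power_mult[symmetric] power_add[symmetric] algebra_simps)
  also have "\<dots> = x ^ K * (u ^ K * (\<Sum>i<N. (u ^ K) ^ i)\<^sup>2)"
    by (simp add: power2_eq_square sum_product sum_distrib_left mult_ac)
  finally show ?thesis .
qed

lemma minus_ln_one_minus_sums:
  fixes y :: real assumes "\<bar>y\<bar> < 1" shows "(\<lambda>k. y ^ Suc k / real (Suc k)) sums (- ln (1 - y))"
proof -
  have "(\<lambda>k. - (y ^ k) / real k) sums ln (1 - y)" using ln_series'[of "- y"] assms by simp
  then have "(\<lambda>k. - (y ^ Suc k) / real (Suc k)) sums ln (1 - y)"
    using sums_Suc_iff[of "\<lambda>k. - (y ^ k) / real k" "ln (1 - y)"] by simp
  from sums_minus[OF this] show ?thesis by simp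
qed

lemma grid_product_eq_exp:
  fixes x u :: real
  assumes "\<bar>x\<bar> < 1" "\<bar>u\<bar> < 1"
  shows "(\<Prod>j<N. \<Prod>i<N. 1 / (1 - x * u ^ (i + j + 1))) =
    exp (\<Sum>k. x ^ Suc k / real (Suc k) * (u ^ Suc k * (\<Sum>i<N. (u ^ Suc k) ^ i)\<^sup>2))"
proof -
  let ?z = "\<lambda>i j. x * u ^ (i + j + 1)"
  have z: "\<bar>?z i j\<bar> < 1" for i j using assms by (intro abs_mult_power_less_1) auto
  have "(\<lambda>k. \<Sum>j<N. \<Sum>i<N. ?z i j ^ Suc k / real (Suc k)) sums (\<Sum>j<N. \<Sum>i<N. - ln (1 - ?z i j))"
    by (intro sums_sum minus_ln_one_minus_sums z)
  moreover have "(\<Sum>j<N. \<Sum>i<N. ?z i j ^ Suc k / real (Suc k)) =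
      x ^ Suc k / real (Suc k) * (u ^ Suc k * (\<Sum>i<N. (u ^ Suc k) ^ i)\<^sup>2)" for k
    using sum_grid_power[of x u "Suc k" N] by (simp only: sum_divide_distrib[symmetric]) simp
  ultimately have "(\<Sum>k. x ^ Suc k / real (Suc k) * (u ^ Suc k * (\<Sum>i<N. (u ^ Suc k) ^ i)\<^sup>2)) =
      (\<Sum>j<N. \<Sum>i<N. - ln (1 - ?z i j))"
    by (simp add: sums_iff)
  moreover have "exp (- ln (1 - ?z i j)) = 1 / (1 - ?z i j)" for i j
    using z[of i j] by (simp add: exp_minus inverse_eq_divide)
  ultimately show ?thesis by (simp add: exp_sum)
qed

lemma norm_sum_power_le:
  fixes v :: "'a::real_normed_field"
  assumes "norm v \<le> \<rho>" "\<rho> < 1" shows "norm (\<Sum>i<N. v ^ i) \<le> 1 / (1 - \<rho>)"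
proof -
  have \<rho>: "0 \<le> \<rho>" using assms norm_ge_zero order_trans by blast
  have "norm (\<Sum>i<N. v ^ i) \<le> (\<Sum>i<N. \<rho> ^ i)"
    using assms by (intro sum_norm_le) (auto simp: norm_power power_mono)
  also have "\<dots> \<le> (\<Sum>i. \<rho> ^ i)" using assms \<rho> by (intro sum_le_suminf summable_geometric) auto
  also have "\<dots> = 1 / (1 - \<rho>)" using assms \<rho> by (intro suminf_geometric) auto
  finally show ?thesis .
qed

lemma grid_product_LIMSEQ:
  fixes x u :: real
  assumes "\<bar>x\<bar> < 1" "\<bar>u\<bar> < 1"
  shows "(\<lambda>N. \<Prod>j<N. \<Prod>i<N. 1 / (1 - x * u ^ (i + j + 1))) \<longlonglongrightarrow> exp (pp_log x u)"
proof -
  let ?a = "\<lambda>k N. x ^ Suc k / real (Suc k) * (u ^ Suc k * (\<Sum>i<N. (u ^ Suc k) ^ i)\<^sup>2)"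
  let ?M = "\<lambda>k. \<bar>x\<bar> ^ Suc k / (1 - \<bar>u\<bar>)\<^sup>2"
  have u: "\<bar>u ^ Suc k\<bar> \<le> \<bar>u\<bar>" for k using norm_power_Suc_le[of u k] assms by simp
  have bound: "norm (?a k N) \<le> ?M k" for k N
  proof -
    have "norm (?a k N) = \<bar>x\<bar> ^ Suc k / real (Suc k) * (\<bar>u ^ Suc k\<bar> * \<bar>\<Sum>i<N. (u ^ Suc k) ^ i\<bar>\<^sup>2)"
      by (simp only: real_norm_def abs_mult abs_divide power_abs abs_of_nat)
    also have "\<dots> \<le> \<bar>x\<bar> ^ Suc k / 1 * (1 * (1 / (1 - \<bar>u\<bar>))\<^sup>2)"
      using u[of k] assms norm_sum_power_le[of "u ^ Suc k" "\<bar>u\<bar>" N]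
      by (intro mult_mono power_mono divide_left_mono) auto
    finally show ?thesis by (simp add: power_divide)
  qed
  have "(\<lambda>N. \<Sum>k. ?a k N) \<longlonglongrightarrow> (\<Sum>k. x ^ Suc k / real (Suc k) * (u ^ Suc k * (1 / (1 - u ^ Suc k))\<^sup>2))"
  proof (rule tannerys_theorem[where M = ?M, THEN conjunct2, THEN conjunct2])
    show "(\<lambda>N. ?a k N) \<longlonglongrightarrow> x ^ Suc k / real (Suc k) * (u ^ Suc k * (1 / (1 - u ^ Suc k))\<^sup>2)" for k
      using geometric_sums[of "u ^ Suc k"] u[of k] assms unfolding sums_def
      by (intro tendsto_intros) (auto simp del: power_Suc)
    show "summable ?M" using assms by (intro summable_power_Suc_divide) auto
    show "\<forall>\<^sub>F (k, N) in at_top \<times>\<^sub>F at_top. norm (?a k N) \<le> ?M k"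
      using bound by (intro always_eventually) auto
  qed auto
  then have "(\<lambda>N. \<Sum>k. ?a k N) \<longlonglongrightarrow> pp_log x u"
    by (simp add: pp_log_def koebe_def power_divide)
  then show ?thesis unfolding grid_product_eq_exp[OF assms] by (rule tendsto_exp)
qed

lemma geom_ennreal:
  assumes "0 \<le> b" "b < 1" shows "geom (ennreal b) = ennreal (1 / (1 - b))"
proof -
  have "(\<lambda>m. b ^ m) sums (1 / (1 - b))" using geometric_sums[of b] assms by simp
  then have "(\<lambda>m. ennreal (b ^ m)) sums ennreal (1 / (1 - b))" using assms by (subst sums_ennreal) auto
  then have "(\<lambda>m. ennreal b ^ m) sums ennreal (1 / (1 - b))" using assms by (simp only: ennreal_power)
  then show ?thesis unfolding geom_def by (rule sums_unique[symmetric])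
qed

lemma pp_gf_ennreal:
  fixes x u :: real
  assumes x: "0 \<le> x" "x < 1" and u: "0 \<le> u" "u < 1"
  shows "(\<integral>\<^sup>+\<pi>. of_bool (is_pp \<pi>) * (ennreal x ^ pp_trace \<pi> * ennreal u ^ pp_size \<pi>) \<partial>count_space UNIV)
    = ennreal (exp (pp_log x u))"
proof (rule LIMSEQ_unique[OF pp_gf_product_LIMSEQ])
  let ?z = "\<lambda>i j. x * u ^ (i + j + 1)"
  have z: "0 \<le> ?z i j" "?z i j < 1" for i j
    using x u abs_mult_power_less_1[of x u "i + j + 1"] by auto
  then have "0 \<le> 1 / (1 - ?z i j)" for i j by (simp add: less_imp_le)
  moreover have "geom (ennreal x * ennreal u ^ (i + j + 1)) = ennreal (1 / (1 - ?z i j))" for i j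
    using x u z[of i j] by (simp add: ennreal_power ennreal_mult[symmetric] geom_ennreal del: power_Suc)
  ultimately have "(\<Prod>j<N. \<Prod>i<N. geom (ennreal x * ennreal u ^ (i + j + 1))) =
      ennreal (\<Prod>j<N. \<Prod>i<N. 1 / (1 - ?z i j))" for N
    by (simp add: prod_ennreal prod_nonneg del: power_Suc)
  then show "(\<lambda>N. \<Prod>j<N. \<Prod>i<N. geom (ennreal x * ennreal u ^ (i + j + 1))) \<longlonglongrightarrow> ennreal (exp (pp_log x u))"
    using grid_product_LIMSEQ[of x u] x u by simp
qed

subsection \<open>The generating function by trace and size\<close>

lemma nn_integral_count_space_group:
  "(\<integral>\<^sup>+z. of_bool (P z) * f (g z) \<partial>count_space UNIV) =
   (\<integral>\<^sup>+p. emeasure (count_space UNIV) {z. P z \<and> g z = p} * f p \<partial>count_space UNIV)"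
proof -
  have "(\<integral>\<^sup>+p. emeasure (count_space UNIV) {z. P z \<and> g z = p} * f p \<partial>count_space UNIV) =
    (\<integral>\<^sup>+p. \<integral>\<^sup>+z. indicator {z. P z \<and> g z = p} z * f p \<partial>count_space UNIV \<partial>count_space UNIV)"
    by (simp add: nn_integral_multc)
  also have "\<dots> = (\<integral>\<^sup>+z. \<integral>\<^sup>+p. indicator {z. P z \<and> g z = p} z * f p \<partial>count_space UNIV \<partial>count_space UNIV)"
    by (rule nn_integral_count_space_swap)
  also have "\<dots> = (\<integral>\<^sup>+z. of_bool (P z) * f (g z) \<partial>count_space UNIV)"
  proof (rule nn_integral_cong)
    fix z
    show "(\<integral>\<^sup>+p. indicator {z. P z \<and> g z = p} z * f p \<partial>count_space UNIV) = of_bool (P z) * f (g z)"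
      by (subst nn_integral_count_space_singleton[where a = "g z"]) auto
  qed
  finally show ?thesis by simp
qed

lemma pp_gf_ennreal_pairs:
  fixes x u :: real
  assumes x: "0 < x" "x < 1" and u: "0 < u" "u < 1"
  shows "(\<integral>\<^sup>+p. ennreal (real (pp (fst p) (snd p)) * x ^ fst p * u ^ snd p) \<partial>count_space UNIV) = ennreal (exp (pp_log x u))"
proof -
  define S where "S p = {\<pi>. plane_partition \<pi> (snd p) \<and> pp_trace \<pi> = fst p}" for p
  define w where "w p = ennreal x ^ fst p * ennreal u ^ snd p" for p :: "nat \<times> nat"
  have S_eq: "S p = {\<pi>. is_pp \<pi> \<and> (pp_trace \<pi>, pp_size \<pi>) = p}" for p
    by (cases p) (auto simp: S_def plane_partition_iff)
  have sum_S: "(\<integral>\<^sup>+p. emeasure (count_space UNIV) (S p) * w p \<partial>count_space UNIV) = ennreal (exp (pp_log x u))"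
    using nn_integral_count_space_group[of is_pp w "\<lambda>\<pi>. (pp_trace \<pi>, pp_size \<pi>)"] pp_gf_ennreal[of x u] x u
    unfolding S_eq by (simp add: w_def)
  have fin: "finite (S p)" for p
  proof (rule ccontr)
    assume inf: "infinite (S p)"
    have "emeasure (count_space UNIV) (S p) * w p \<le> ennreal (exp (pp_log x u))"
      unfolding sum_S[symmetric]
      by (rule nn_integral_ge_point[of p UNIV "\<lambda>p. emeasure (count_space UNIV) (S p) * w p"]) simp
    moreover have "w p \<noteq> 0" using x u by (simp add: w_def)
    ultimately show False using inf by (simp add: ennreal_top_mult top_unique)
  qed
  have "emeasure (count_space UNIV) (S p) * w p = ennreal (real (pp (fst p) (snd p)) * x ^ fst p * u ^ snd p)" for p
    using fin[of p] x u
    by (simp add: pp_def S_def w_def emeasure_count_space ennreal_mult ennreal_power ennreal_of_nat_eq_real_of_nat mult.assoc)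
  then show ?thesis using sum_S by simp
qed

lemma pp_gf_real:
  fixes x u :: real
  assumes "0 < x" "x < 1" "0 < u" "u < 1"
  shows "((\<lambda>p. real (pp (fst p) (snd p)) * x ^ fst p * u ^ snd p) has_sum exp (pp_log x u)) UNIV"
proof -
  let ?f = "\<lambda>p. real (pp (fst p) (snd p)) * x ^ fst p * u ^ snd p"
  have "has_bochner_integral (count_space UNIV) ?f (exp (pp_log x u))"
    using assms pp_gf_ennreal_pairs[OF assms] by (intro has_bochner_integral_nn_integral) auto
  then have "Infinite_Set_Sum.abs_summable_on ?f UNIV" "infsetsum ?f UNIV = exp (pp_log x u)"
    by (auto simp: Infinite_Set_Sum.abs_summable_on_def infsetsum_def has_bochner_integral_iff)
  moreover from this have "?f summable_on UNIV"
    using abs_summable_equivalent[of ?f UNIV] by (blast intro: abs_summable_summable)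
  ultimately show ?thesis
    using has_sum_infsum[of ?f UNIV] infsetsum_infsum[of ?f UNIV] by simp
qed

lemma pp_gf_summable:
  fixes x u :: complex assumes "norm x < 1" "norm u < 1"
  shows "(\<lambda>p. of_nat (pp (fst p) (snd p)) * x ^ fst p * u ^ snd p) summable_on UNIV"
proof -
  define y v where "y = max (norm x) (1/2)" and "v = max (norm u) (1/2)"
  have yv: "0 < y" "y < 1" "0 < v" "v < 1" "norm x \<le> y" "norm u \<le> v" using assms by (auto simp: y_def v_def)
  have "(\<lambda>p. real (pp (fst p) (snd p)) * y ^ fst p * v ^ snd p) summable_on UNIV"
    using pp_gf_real[OF yv(1-4)] by (rule has_sum_imp_summable)
  then have "(\<lambda>p. norm (of_nat (pp (fst p) (snd p)) * x ^ fst p * u ^ snd p)) summable_on UNIV"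
    by (rule Infinite_Sum.abs_summable_on_comparison_test')
       (use yv in \<open>auto simp: norm_mult norm_power intro!: mult_mono power_mono\<close>)
  then show ?thesis by (rule abs_summable_summable)
qed

lemma infsum_power_sums_fibres:
  fixes c :: "'i \<Rightarrow> complex" and e :: "'i \<Rightarrow> nat"
  assumes summable: "\<And>z. norm z < 1 \<Longrightarrow> (\<lambda>p. c p * z ^ e p) summable_on UNIV" and z: "norm z < 1"
  shows "(\<lambda>n. (\<Sum>\<^sub>\<infinity>p | e p = n. c p) * z ^ n) sums (\<Sum>\<^sub>\<infinity>p. c p * z ^ e p)"
proof -
  have fibre: "c summable_on {p. e p = n}" for n
  proof -
    have "(\<lambda>p. c p * (1/2) ^ e p) summable_on {p. e p = n}"
      using summable[of "1/2"] by (rule summable_on_subset_banach) auto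
    then have "(\<lambda>p. 2 ^ n * (c p * (1/2) ^ e p)) summable_on {p. e p = n}"
      by (rule summable_on_cmult_right)
    then show ?thesis by (rule summable_on_cong[THEN iffD1, rotated]) (simp add: power_divide)
  qed
  have "((\<lambda>p. c p * z ^ e p) has_sum (\<Sum>\<^sub>\<infinity>p. c p * z ^ e p)) UNIV"
    using summable[OF z] by (rule has_sum_infsum)
  moreover have "bij_betw snd (SIGMA n:UNIV. {p. e p = n}) UNIV"
    by (auto simp: bij_betw_def inj_on_def image_iff)
  ultimately have "((\<lambda>np. c (snd np) * z ^ e (snd np)) has_sum (\<Sum>\<^sub>\<infinity>p. c p * z ^ e p)) (SIGMA n:UNIV. {p. e p = n})"
    using has_sum_reindex_bij_betw[of snd "SIGMA n:UNIV. {p. e p = n}" UNIV "\<lambda>p. c p * z ^ e p"] by simp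
  moreover have "((\<lambda>p. c (snd (n, p)) * z ^ e (snd (n, p))) has_sum (\<Sum>\<^sub>\<infinity>p | e p = n. c p) * z ^ n) {p. e p = n}" for n
    using has_sum_cmult_left[OF has_sum_infsum[OF fibre[of n]], of "z ^ n"]
    by (rule has_sum_cong[THEN iffD1, rotated]) simp
  ultimately have "((\<lambda>n. (\<Sum>\<^sub>\<infinity>p | e p = n. c p) * z ^ n) has_sum (\<Sum>\<^sub>\<infinity>p. c p * z ^ e p)) UNIV"
    by (rule has_sum_SigmaD)
  then show ?thesis by (rule has_sum_imp_sums)
qed

lemma holomorphic_infsum_power:
  fixes c :: "'i \<Rightarrow> complex" and e :: "'i \<Rightarrow> nat"
  assumes "\<And>z. norm z < 1 \<Longrightarrow> (\<lambda>p. c p * z ^ e p) summable_on UNIV"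
  shows "(\<lambda>z. \<Sum>\<^sub>\<infinity>p. c p * z ^ e p) holomorphic_on ball 0 1"
  using infsum_power_sums_fibres[OF assms] by (intro power_series_holomorphic) auto

lemma holomorphic_eq_on_unit_disc:
  assumes "f holomorphic_on ball 0 1" "g holomorphic_on ball 0 1"
    and reals: "\<And>r. 0 < r \<Longrightarrow> r < 1 \<Longrightarrow> f (complex_of_real r) = g (complex_of_real r)" and z: "norm z < 1"
  shows "f z = g z"
proof -
  let ?U = "complex_of_real ` {0<..<1}"
  have "connected ?U" by (intro connected_continuous_image continuous_intros) auto
  moreover have "complex_of_real (1/2) \<in> ?U" "complex_of_real (1/3) \<in> ?U" by (intro imageI; simp)+
  moreover have "complex_of_real (1/2) \<noteq> complex_of_real (1/3)" unfolding of_real_eq_iff by simp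
  ultimately have limit: "complex_of_real (1/2) islimpt ?U" by (metis connected_imp_perfect singletonD)
  have "f z - g z = 0"
  proof (rule analytic_continuation[where f = "\<lambda>z. f z - g z" and S = "ball 0 1" and U = ?U])
    show "(\<lambda>z. f z - g z) holomorphic_on ball 0 1" by (intro holomorphic_intros assms)
  qed (use limit reals z in auto)
  then show ?thesis by simp
qed

lemma pp_gf_complex:
  fixes x u :: complex assumes x: "norm x < 1" and u: "norm u < 1"
  shows "(\<Sum>\<^sub>\<infinity>p. of_nat (pp (fst p) (snd p)) * x ^ fst p * u ^ snd p) = exp (pp_log x u)"
proof (rule holomorphic_eq_on_unit_disc[OF _ _ _ u])
  show "(\<lambda>u. \<Sum>\<^sub>\<infinity>p. of_nat (pp (fst p) (snd p)) * x ^ fst p * u ^ snd p) holomorphic_on ball 0 1"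
    by (intro holomorphic_infsum_power pp_gf_summable x)
  show "(\<lambda>u. exp (pp_log x u)) holomorphic_on ball 0 1"
    using holomorphic_pp_log_snd[OF x] by (intro holomorphic_intros) (auto simp: comp_def)
  fix v :: real assume v: "0 < v" "v < 1"
  show "(\<Sum>\<^sub>\<infinity>p. of_nat (pp (fst p) (snd p)) * x ^ fst p * of_real v ^ snd p) = exp (pp_log x (of_real v))"
  proof (rule holomorphic_eq_on_unit_disc[OF _ _ _ x])
    have "(\<lambda>p. of_nat (pp (fst p) (snd p)) * complex_of_real v ^ snd p * x ^ fst p) summable_on UNIV"
      if "norm x < 1" for x
      using pp_gf_summable[OF that, of "of_real v"] v by (simp add: mult_ac)
    from holomorphic_infsum_power[OF this]
    show "(\<lambda>x. \<Sum>\<^sub>\<infinity>p. of_nat (pp (fst p) (snd p)) * x ^ fst p * complex_of_real v ^ snd p) holomorphic_on ball 0 1"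
      by (simp add: mult_ac)
    show "(\<lambda>x. exp (pp_log x (of_real v))) holomorphic_on ball 0 1"
      using v by (intro holomorphic_on_exp' holomorphic_pp_log_fst) simp
    fix r :: real assume r: "0 < r" "r < 1"
    have "((\<lambda>p. complex_of_real (real (pp (fst p) (snd p)) * r ^ fst p * v ^ snd p)) has_sum
        complex_of_real (exp (pp_log r v))) UNIV"
      using pp_gf_real[OF r v] by (rule has_sum_of_real)
    then show "(\<Sum>\<^sub>\<infinity>p. of_nat (pp (fst p) (snd p)) * complex_of_real r ^ fst p * of_real v ^ snd p) =
        exp (pp_log (of_real r) (of_real v))"
      using r v by (subst pp_log_of_real) (auto simp: exp_of_real intro: infsumI)
  qed
qed

lemma plane_partition_0_iff: "plane_partition \<pi> 0 \<longleftrightarrow> \<pi> = (\<lambda>_ _. 0)"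
  by (auto simp: plane_partition_def fun_eq_iff)

lemma pp_trace_le:
  assumes "plane_partition \<pi> n" shows "pp_trace \<pi> \<le> n"
proof -
  let ?S = "{(i, j). \<pi> i j \<noteq> 0}" and ?D = "{i. \<pi> i i \<noteq> 0}"
  have fin: "finite ?S" and n: "(\<Sum>(i, j)\<in>?S. \<pi> i j) = n" using assms unfolding plane_partition_def by blast+
  have "pp_trace \<pi> = (\<Sum>(i, j)\<in>(\<lambda>i. (i, i)) ` ?D. \<pi> i j)"
    unfolding pp_trace_def by (subst sum.reindex) (auto simp: inj_on_def)
  also have "\<dots> \<le> (\<Sum>(i, j)\<in>?S. \<pi> i j)" by (rule sum_mono2[OF fin]) auto
  finally show ?thesis using n by simp
qed

lemma pp_trace_eq_0:
  assumes "plane_partition \<pi> n" "pp_trace \<pi> = 0" shows "n = 0"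
proof -
  let ?S = "{(i, j). \<pi> i j \<noteq> 0}"
  have fin: "finite ?S" and n: "(\<Sum>(i, j)\<in>?S. \<pi> i j) = n"
    and row: "\<And>i j. \<pi> (Suc i) j \<le> \<pi> i j" and col: "\<And>i j. \<pi> i (Suc j) \<le> \<pi> i j"
    using assms(1) unfolding plane_partition_def by blast+
  have "{i. \<pi> i i \<noteq> 0} \<subseteq> fst ` ?S" by force
  then have "finite {i. \<pi> i i \<noteq> 0}" using fin by (meson finite_imageI finite_subset)
  then have "\<pi> 0 0 = 0" using assms(2) unfolding pp_trace_def by (auto simp: sum_eq_0_iff)
  moreover have "\<pi> i j \<le> \<pi> 0 j" for i j by (induction i) (use row order_trans in blast)+
  moreover have "\<pi> 0 j \<le> \<pi> 0 0" for j by (induction j) (use col order_trans in blast)+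
  ultimately have "\<pi> i j = 0" for i j by (metis le_zero_eq)
  then show ?thesis using n by simp
qed

lemma pp_0_0: "pp 0 0 = 1"
proof -
  have "{\<pi>. plane_partition \<pi> 0 \<and> pp_trace \<pi> = 0} = {\<lambda>_ _. 0}"
    by (auto simp: plane_partition_0_iff pp_trace_def)
  then show ?thesis by (simp add: pp_def)
qed

lemma pp_eq_0:
  assumes "n < k \<or> k = 0 \<and> 0 < n" shows "pp k n = 0"
proof -
  have "{\<pi>. plane_partition \<pi> n \<and> pp_trace \<pi> = k} = {}"
    using assms pp_trace_le pp_trace_eq_0 by fastforce
  then show ?thesis by (simp only: pp_def card.empty)
qed

lemma pp_fibre_sum:
  fixes x :: complex
  shows "(\<Sum>\<^sub>\<infinity>p | snd p = n. of_nat (pp (fst p) (snd p)) * x ^ fst p) = (if n = 0 then 1 else pp_poly n x)"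
proof -
  have "(\<Sum>\<^sub>\<infinity>p | snd p = n. of_nat (pp (fst p) (snd p)) * x ^ fst p) =
      (\<Sum>\<^sub>\<infinity>p\<in>(\<lambda>k. (k, n)) ` {..n}. of_nat (pp (fst p) (snd p)) * x ^ fst p)"
    by (rule infsum_cong_neutral) (auto simp: image_iff intro!: pp_eq_0)
  also have "\<dots> = (\<Sum>k\<le>n. of_nat (pp k n) * x ^ k)"
    by (simp add: sum.reindex inj_on_def)
  also have "\<dots> = of_nat (pp 0 n) + pp_poly n x"
    unfolding pp_poly_def by (subst sum.atMost_shift) (simp add: sum.atLeast1_atMost_eq)
  also have "\<dots> = (if n = 0 then 1 else pp_poly n x)"
    by (auto simp: pp_0_0 pp_eq_0 pp_poly_def)
  finally show ?thesis .
qed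

theorem pp_poly_gf:
  fixes x u :: complex assumes x: "norm x < 1" and u: "norm u < 1"
  shows "(\<lambda>n. (if n = 0 then 1 else pp_poly n x) * u ^ n) sums exp (pp_log x u)"
  using infsum_power_sums_fibres[OF pp_gf_summable[OF x] u] by (simp only: pp_gf_complex[OF x u] pp_fibre_sum)

subsection \<open>Coefficients as integrals over a circle\<close>

lemma Complex_eq_of_real: "Complex \<sigma> \<theta> = of_real \<sigma> + \<i> * of_real \<theta>"
  by (simp add: complex_eq_iff)

lemma has_integral_exp_ii_period:
  "((\<lambda>\<theta>. exp (\<i> * of_real (of_int m * \<theta>))) has_integral (if m = 0 then 2 * of_real pi else 0)) {a..a + 2 * pi}"
proof (cases "m = 0")
  case True
  then show ?thesis
    using has_integral_const_real[of "1::complex" a "a + 2 * pi"] by (simp add: scaleR_conv_of_real)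
next
  case False
  let ?F = "\<lambda>z. exp (\<i> * (of_int m * z)) / (\<i> * of_int m)"
  have "((\<lambda>\<theta>. ?F (of_real \<theta>)) has_vector_derivative exp (\<i> * of_real (of_int m * \<theta>))) (at \<theta> within {a..a + 2 * pi})" for \<theta>
  proof (rule has_vector_derivative_real_field)
    show "(?F has_field_derivative exp (\<i> * of_real (of_int m * \<theta>))) (at (of_real \<theta>))"
      using False by (auto intro!: derivative_eq_intros simp: mult_ac)
  qed
  then have "((\<lambda>\<theta>. exp (\<i> * of_real (of_int m * \<theta>))) has_integral ?F (of_real (a + 2 * pi)) - ?F (of_real a)) {a..a + 2 * pi}"
    by (intro fundamental_theorem_of_calculus) auto
  moreover have "exp (\<i> * (of_int m * of_real (a + 2 * pi))) = exp (\<i> * (of_int m * of_real a))"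
  proof -
    have "\<i> * (of_int m * of_real (a + 2 * pi)) = \<i> * (of_int m * of_real a) + (2 * of_int m * pi) * \<i>"
      by (simp add: algebra_simps)
    then show ?thesis by (subst exp_eq, intro exI[of _ m]) simp
  qed
  ultimately show ?thesis using False by simp
qed

lemma has_integral_suminf_Weierstrass:
  fixes g :: "nat \<Rightarrow> real \<Rightarrow> 'a::banach"
  assumes cont: "\<And>m. continuous_on {a..b} (g m)" and integral: "\<And>m. (g m has_integral I m) {a..b}"
    and bound: "\<And>m t. t \<in> {a..b} \<Longrightarrow> norm (g m t) \<le> M m" and summable: "summable M"
  shows "((\<lambda>t. \<Sum>m. g m t) has_integral (\<Sum>m. I m)) {a..b}"
proof -
  have unif: "uniform_limit {a..b} (\<lambda>N t. \<Sum>m<N. g m t) (\<lambda>t. \<Sum>m. g m t) sequentially"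
    by (rule Weierstrass_m_test[OF bound summable])
  obtain S J where S: "\<And>N. ((\<lambda>t. \<Sum>m<N. g m t) has_integral S N) {a..b}"
    and J: "((\<lambda>t. \<Sum>m. g m t) has_integral J) {a..b}" and lim: "S \<longlonglongrightarrow> J"
  proof (rule uniform_limit_integral[OF unif _ sequentially_bot])
    show "continuous_on {a..b} (\<lambda>t. \<Sum>m<N. g m t)" for N by (intro continuous_intros cont)
  qed blast
  have "((\<lambda>t. \<Sum>m<N. g m t) has_integral (\<Sum>m<N. I m)) {a..b}" for N
    by (intro has_integral_sum integral) auto
  then have "S = (\<lambda>N. \<Sum>m<N. I m)" using S has_integral_unique by blast
  then have "I sums J" using lim by (simp add: sums_def)
  then show ?thesis using J by (simp add: sums_iff)
qed

lemma has_integral_powser_coeff: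
  fixes c :: "nat \<Rightarrow> complex"
  assumes sums: "\<And>u. norm u < 1 \<Longrightarrow> (\<lambda>m. c m * u ^ m) sums f u" and \<sigma>: "\<sigma> > 0"
  shows "((\<lambda>\<theta>. f (exp (- Complex \<sigma> \<theta>)) * exp (of_nat n * Complex \<sigma> \<theta>)) has_integral 2 * of_real pi * c n) {a..a + 2 * pi}"
proof -
  let ?C = "\<lambda>m. c m * of_real (exp ((real n - real m) * \<sigma>))"
  let ?g = "\<lambda>m \<theta>. ?C m * exp (\<i> * of_real (of_int (int n - int m) * \<theta>))"
  let ?I = "\<lambda>m. if m = n then 2 * of_real pi * c n else 0"
  have g_eq: "?g m \<theta> = c m * exp (- Complex \<sigma> \<theta>) ^ m * exp (of_nat n * Complex \<sigma> \<theta>)" for m \<theta>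
    by (simp add: Complex_eq_of_real exp_of_real[symmetric] exp_of_nat_mult[symmetric] exp_add[symmetric]
        algebra_simps flip: exp_minus)
  have g_sums: "(\<lambda>m. ?g m \<theta>) sums (f (exp (- Complex \<sigma> \<theta>)) * exp (of_nat n * Complex \<sigma> \<theta>))" for \<theta>
    unfolding g_eq using \<sigma> by (intro sums_mult2 sums) simp
  have "((\<lambda>\<theta>. \<Sum>m. ?g m \<theta>) has_integral (\<Sum>m. ?I m)) {a..a + 2 * pi}"
  proof (rule has_integral_suminf_Weierstrass)
    show "continuous_on {a..a + 2 * pi} (?g m)" for m by (intro continuous_intros)
    show "(?g m has_integral ?I m) {a..a + 2 * pi}" for m
      using has_integral_mult_right[OF has_integral_exp_ii_period, of "?C m" "int n - int m" a]
      by (cases "m = n") (auto simp: mult.commute)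
    show "norm (?g m \<theta>) \<le> exp (real n * \<sigma>) * norm (c m * complex_of_real (exp (- \<sigma>)) ^ m)" for m \<theta>
      by (simp add: norm_mult norm_power exp_of_nat_mult[symmetric] exp_add[symmetric] algebra_simps flip: exp_diff)
    have "summable (\<lambda>m. c m * complex_of_real (exp (- \<sigma> / 2)) ^ m)"
      using sums[of "complex_of_real (exp (- \<sigma> / 2))"] \<sigma> by (simp add: sums_iff)
    then have "summable (\<lambda>m. norm (c m * complex_of_real (exp (- \<sigma>)) ^ m))"
      using \<sigma> by (intro powser_insidea) auto
    then show "summable (\<lambda>m. exp (real n * \<sigma>) * norm (c m * complex_of_real (exp (- \<sigma>)) ^ m))"
      by (rule summable_mult)
  qed
  moreover have "(\<Sum>m. ?I m) = 2 * of_real pi * c n" 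
    using sums_unique[OF sums_single[of n "\<lambda>_. 2 * of_real pi * c n"]] by simp
  ultimately show ?thesis using g_sums by (simp add: sums_iff)
qed

lemma has_integral_pp_poly:
  fixes x :: complex assumes "norm x < 1" "\<sigma> > 0" "n \<ge> 1"
  shows "((\<lambda>\<theta>. exp (pp_log x (exp (- Complex \<sigma> \<theta>)) + of_nat n * Complex \<sigma> \<theta>))
     has_integral 2 * of_real pi * pp_poly n x) {a..a + 2 * pi}"
  using has_integral_powser_coeff[OF pp_poly_gf[OF assms(1)] assms(2), of n a] assms(3) by (simp add: exp_add)

section \<open>The trilogarithm\<close>

lemma
  shows summable_inverse_cubes_from_3: "summable (\<lambda>k. 1 / real (k + 3) ^ 3)"
    and suminf_inverse_cubes_from_3_le: "(\<Sum>k. 1 / real (k + 3) ^ 3) \<le> 1 / 12"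
proof -
  let ?f = "\<lambda>k. 1 / (2 * real (k + 2) * real (k + 3))"
  have "?f \<longlonglongrightarrow> 0" by real_asymp
  from telescope_sums'[OF this] have telescope: "(\<lambda>k. ?f k - ?f (Suc k)) sums (1 / 12)" by simp
  have le: "1 / real (k + 3) ^ 3 \<le> ?f k - ?f (Suc k)" for k
  proof -
    have "?f k - ?f (Suc k) = 1 / ((real k + 2) * (real k + 3) * (real k + 4))"
      by (simp add: divide_simps) (simp add: algebra_simps)
    also have "\<dots> \<ge> 1 / real (k + 3) ^ 3"
      by (intro divide_left_mono mult_pos_pos zero_less_power) (auto simp: power3_eq_cube algebra_simps)
    finally show ?thesis .
  qed
  show summable: "summable (\<lambda>k. 1 / real (k + 3) ^ 3)"
    by (rule summable_comparison_test'[OF sums_summable[OF telescope], where N = 0]) (use le in auto)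
  show "(\<Sum>k. 1 / real (k + 3) ^ 3) \<le> 1 / 12"
    using suminf_le[OF le summable sums_summable[OF telescope]] telescope by (simp add: sums_iff)
qed

lemma summable_norm_Li3:
  fixes x :: "'a::{real_normed_field,banach}"
  assumes "norm x \<le> 1" shows "summable (\<lambda>n. norm (x ^ Suc n / of_nat (Suc n) ^ 3))"
proof (rule summable_comparison_test'[where N = 0])
  show "summable (\<lambda>n. 1 / real (Suc n) ^ 3)"
    using inverse_power_summable[of 3, where 'a = real] by (subst summable_Suc_iff) (simp add: field_simps)
  show "norm (norm (x ^ Suc n / of_nat (Suc n) ^ 3)) \<le> 1 / real (Suc n) ^ 3" for n
    using assms power_le_one[of "norm x" "Suc n"]
    by (simp add: norm_divide norm_power norm_mult divide_right_mono del: of_nat_Suc)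
qed

lemma Li3_sums:
  fixes x :: "'a::{real_normed_field,banach}"
  assumes "norm x \<le> 1" shows "(\<lambda>n. x ^ Suc n / of_nat (Suc n) ^ 3) sums Li3 x"
  unfolding Li3_def by (rule summable_sums[OF summable_norm_cancel[OF summable_norm_Li3[OF assms]]])

lemma Li3_of_real: "\<bar>x\<bar> \<le> 1 \<Longrightarrow> Li3 (complex_of_real x) = complex_of_real (Li3 x)"
  using suminf_of_real[of "\<lambda>n. x ^ Suc n / of_nat (Suc n) ^ 3", where 'a = complex]
    summable_norm_cancel[OF summable_norm_Li3[of x]] by (simp add: Li3_def)

lemma Li3_cnj:
  assumes "norm x \<le> 1" shows "Li3 (cnj x) = cnj (Li3 x)"
proof -
  have "(\<lambda>n. cnj (x ^ Suc n / of_nat (Suc n) ^ 3)) sums cnj (Li3 x)"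
    using Li3_sums[OF assms] by (subst sums_cnj)
  then have "(\<lambda>n. cnj x ^ Suc n / of_nat (Suc n) ^ 3) sums cnj (Li3 x)" by simp
  moreover have "(\<lambda>n. cnj x ^ Suc n / of_nat (Suc n) ^ 3) sums Li3 (cnj x)"
    using assms by (intro Li3_sums) simp
  ultimately show ?thesis by (rule sums_unique2[symmetric])
qed

lemma holomorphic_Li3: "Li3 holomorphic_on ball (0::complex) 1"
proof (rule power_series_holomorphic)
  fix x :: complex assume "x \<in> ball 0 1"
  then have "(\<lambda>n. 1 / of_nat (Suc n) ^ 3 * (x - 0) ^ Suc n) sums Li3 x" using Li3_sums[of x] by simp
  then show "(\<lambda>n. 1 / of_nat n ^ 3 * (x - 0) ^ n) sums Li3 x"
    using sums_Suc_iff[of "\<lambda>n. 1 / of_nat n ^ 3 * (x - 0) ^ n" "Li3 x"] by simp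
qed

lemma continuous_on_Li3_complex: "continuous_on (ball (0::complex) 1) Li3"
  by (rule holomorphic_on_imp_continuous_on[OF holomorphic_Li3])

lemma continuous_on_Li3_real: "continuous_on {-1<..<1::real} Li3"
proof -
  have "continuous_on {-1<..<1} (\<lambda>x. Re (Li3 (complex_of_real x)))"
    by (intro continuous_on_Re continuous_on_compose2[OF continuous_on_Li3_complex] continuous_intros) auto
  then show ?thesis by (rule continuous_on_cong[THEN iffD1, rotated -1]) (auto simp: Li3_of_real)
qed

lemma norm_Li3_minus_quadratic_le:
  fixes x :: "'a::{real_normed_field,banach}"
  assumes "norm x \<le> 1" shows "norm (Li3 x - (x + x\<^sup>2 / 8)) \<le> norm x ^ 3 / 12"
proof -
  let ?t = "\<lambda>k. x ^ Suc k / of_nat (Suc k) ^ 3"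
  have "(\<lambda>k. ?t (k + 2)) sums (Li3 x - (\<Sum>k<2. ?t k))"
    by (rule sums_split_initial_segment[OF Li3_sums[OF assms]])
  then have tail: "Li3 x - (x + x\<^sup>2 / 8) = (\<Sum>k. ?t (k + 2))"
    by (simp add: sums_iff numeral_2_eq_2)
  have term_le: "norm (?t (k + 2)) \<le> norm x ^ 3 * (1 / real (k + 3) ^ 3)" for k
  proof -
    have "norm (?t (k + 2)) = norm x ^ (k + 3) / real (k + 3) ^ 3"
      unfolding norm_divide norm_power norm_of_nat by (simp add: eval_nat_numeral)
    also have "\<dots> \<le> norm x ^ 3 / real (k + 3) ^ 3"
      using assms by (intro divide_right_mono power_decreasing) auto
    finally show ?thesis by simp
  qed
  have "norm (\<Sum>k. ?t (k + 2)) \<le> (\<Sum>k. norm x ^ 3 * (1 / real (k + 3) ^ 3))"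
    by (rule norm_suminf_le[OF term_le summable_mult[OF summable_inverse_cubes_from_3]])
  also have "\<dots> = norm x ^ 3 * (\<Sum>k. 1 / real (k + 3) ^ 3)"
    by (rule suminf_mult[OF summable_inverse_cubes_from_3])
  also have "\<dots> \<le> norm x ^ 3 * (1 / 12)"
    by (intro mult_left_mono suminf_inverse_cubes_from_3_le) auto
  finally show ?thesis by (simp add: tail)
qed

lemma norm_Li3_minus_self_le:
  fixes x :: "'a::{real_normed_field,banach}"
  assumes "norm x \<le> 1" shows "norm (Li3 x - x) \<le> 5 / 24 * norm x"
proof -
  have "norm (x\<^sup>2 / 8) \<le> norm x / 8" "norm x ^ 3 / 12 \<le> norm x / 12"
    using assms norm_power_Suc_le[of x 1] power_decreasing[of 1 3 "norm x"]
    by (auto simp: norm_divide power2_eq_square)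
  moreover have "norm (Li3 x - x) \<le> norm (Li3 x - (x + x\<^sup>2 / 8)) + norm (x\<^sup>2 / 8)"
    using norm_triangle_ineq[of "Li3 x - (x + x\<^sup>2 / 8)" "x\<^sup>2 / 8"] by simp
  ultimately show ?thesis using norm_Li3_minus_quadratic_le[OF assms] by linarith
qed

lemma norm_Li3_bounds:
  fixes x :: "'a::{real_normed_field,banach}"
  assumes "norm x \<le> 1" shows "19 / 24 * norm x \<le> norm (Li3 x)" "norm (Li3 x) \<le> 29 / 24 * norm x"
  using norm_Li3_minus_self_le[OF assms] norm_triangle_ineq2[of x "Li3 x"] norm_triangle_ineq2[of "Li3 x" x]
  by (auto simp: norm_minus_commute)

lemma Li3_eq_0_iff: "norm (x :: complex) \<le> 1 \<Longrightarrow> Li3 x = 0 \<longleftrightarrow> x = 0"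
  using norm_Li3_bounds[of x] by auto

lemma abs_Li3_minus_self_le:
  fixes x :: real assumes "\<bar>x\<bar> \<le> 1" shows "\<bar>Li3 x - x\<bar> \<le> 5 / 24 * \<bar>x\<bar>"
  using norm_Li3_minus_self_le[of x] assms by simp

lemma Li3_real_pos: fixes x :: real assumes "0 < x" "x \<le> 1" shows "Li3 x > 0"
proof -
  have "\<bar>Li3 x - x\<bar> \<le> 5 / 24 * \<bar>x\<bar>" using assms by (intro abs_Li3_minus_self_le) auto
  then show ?thesis using assms by linarith
qed

lemma Li3_real_neg: fixes x :: real assumes "-1 \<le> x" "x < 0" shows "Li3 x < 0"
proof -
  have "\<bar>Li3 x - x\<bar> \<le> 5 / 24 * \<bar>x\<bar>" using assms by (intro abs_Li3_minus_self_le) auto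
  then show ?thesis using assms by linarith
qed

lemma norm_Li3_square_less:
  fixes x :: complex assumes "0 < norm x" "norm x < 1" shows "norm (Li3 (x\<^sup>2)) < 8 * norm (Li3 x)"
proof -
  have "norm (x\<^sup>2) \<le> norm x" using assms norm_power_Suc_le[of x 1] by (simp add: power2_eq_square)
  then show ?thesis using norm_Li3_bounds[of x] norm_Li3_bounds(2)[of "x\<^sup>2"] assms by linarith
qed

subsection \<open>The imaginary part\<close>

lemma powser_average_pos:
  fixes a :: "nat \<Rightarrow> real"
  assumes K: "1 < K" and summable: "\<And>y. \<bar>y\<bar> < K \<Longrightarrow> summable (\<lambda>n. a n * y ^ n)"
    and pos: "\<And>t. 0 \<le> t \<Longrightarrow> t \<le> 1 \<Longrightarrow> 0 < (\<Sum>n. a n * t ^ n)" and t: "0 \<le> t" "t \<le> 1"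
  shows "0 < (\<Sum>n. a n / real (Suc n) * t ^ n)"
proof (cases "t = 0")
  case True
  then show ?thesis using pos[of 0] unfolding True powser_zero by simp
next
  case False
  define F where "F y = (\<Sum>n. a n / real (Suc n) * y ^ Suc n)" for y
  have deriv: "(F has_real_derivative (\<Sum>n. a n * y ^ n)) (at y)" if "0 \<le> y" "y \<le> 1" for y
    using DERIV_power_series'[of K "\<lambda>n. a n / real (Suc n)" y] K summable that
    by (simp add: F_def[abs_def] abs_less_iff del: of_nat_Suc)
  have "F 0 < F t"
  proof (rule DERIV_pos_imp_increasing[where f = F])
    fix y assume "0 \<le> y" "y \<le> t"
    then show "\<exists>D. DERIV F y :> D \<and> D > 0" using deriv[of y] pos[of y] t by (intro exI conjI) auto
  qed (use False t in auto)
  moreover have "F 0 = 0" by (simp add: F_def)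
  moreover have "summable (\<lambda>n. a n / real (Suc n) * t ^ n)"
  proof (rule summable_comparison_test'[where N = 0])
    have "summable (\<lambda>n. a n * ((1 + K) / 2) ^ n)" using K by (intro summable) (auto simp: abs_if)
    then show "summable (\<lambda>n. norm (a n * t ^ n))" using K t by (intro powser_insidea) auto
    show "norm (a n / real (Suc n) * t ^ n) \<le> norm (a n * t ^ n)" for n
      using mult_right_mono[of 1 "real (Suc n)" "\<bar>a n * t ^ n\<bar>"] by (simp add: abs_mult field_simps)
  qed
  then have "F t = t * (\<Sum>n. a n / real (Suc n) * t ^ n)"
    unfolding F_def by (subst suminf_mult[symmetric]) (simp_all add: mult_ac)
  ultimately show ?thesis using False t by (simp add: zero_less_mult_iff)
qed

lemma Im_geometric_pos:
  fixes x :: complex assumes x: "norm x < 1" "Im x > 0" and t: "0 \<le> t" "t \<le> 1"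
  shows "(\<Sum>n. Im (x ^ Suc n) * t ^ n) > 0"
proof -
  have "t * norm x \<le> norm x" using t by (simp add: mult_left_le_one_le)
  then have tx: "norm (of_real t * x) < 1" using x t by (simp add: norm_mult)
  have "(\<lambda>n. Im (x * (of_real t * x) ^ n)) sums Im (x * (1 / (1 - of_real t * x)))"
    by (intro sums_Im sums_mult geometric_sums tx)
  moreover have "x * (of_real t * x) ^ n = of_real (t ^ n) * x ^ Suc n" for n
    by (simp add: power_mult_distrib)
  then have "Im (x * (of_real t * x) ^ n) = Im (x ^ Suc n) * t ^ n" for n
    by (simp only:) simp
  ultimately have "(\<Sum>n. Im (x ^ Suc n) * t ^ n) = Im (x / (1 - of_real t * x))" by (simp add: sums_iff)
  also have "\<dots> = Im x / norm (1 - of_real t * x) ^ 2"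
    by (simp add: Im_divide cmod_power2 algebra_simps)
  also have "1 - of_real t * x \<noteq> 0" using tx by auto
  then have "Im x / norm (1 - of_real t * x) ^ 2 > 0" using x by simp
  finally show ?thesis .
qed

text \<open>The imaginary part of \<open>Li_s\<close> increases along rays: \<open>t d/dt Li_(s+1)(tx) = Li_s(tx)\<close>, and
  \<open>Im Li_0(x) = Im x / |1 - x|^2\<close>.\<close>

lemma Im_polylog_pos:
  fixes x :: complex assumes x: "norm x < 1" "Im x > 0" and "0 \<le> t" "t \<le> 1"
  shows "(\<Sum>n. Im (x ^ Suc n) / real (Suc n) ^ s * t ^ n) > 0"
  using assms(3,4)
proof (induction s arbitrary: t)
  case 0
  then show ?case using Im_geometric_pos[OF x] by simp
next
  case (Suc s)
  have "norm x > 0" using x by auto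
  have "summable (\<lambda>n. Im (x ^ Suc n) / real (Suc n) ^ s * y ^ n)" if "\<bar>y\<bar> < 1 / norm x" for y
  proof (rule summable_comparison_test'[where N = 0])
    show "summable (\<lambda>n. (norm x * \<bar>y\<bar>) ^ n)"
      using that \<open>norm x > 0\<close> by (intro summable_geometric) (simp add: field_simps)
    fix n :: nat
    have "\<bar>Im (x ^ Suc n) / real (Suc n) ^ s\<bar> \<le> norm x ^ Suc n / 1"
      unfolding abs_divide using abs_Im_le_cmod[of "x ^ Suc n"]
      by (intro frac_le) (auto simp: norm_power norm_mult one_le_power simp del: of_nat_Suc)
    also have "\<dots> \<le> norm x ^ n" using x by (simp add: mult_left_le_one_le)
    finally have "\<bar>Im (x ^ Suc n) / real (Suc n) ^ s\<bar> * \<bar>y\<bar> ^ n \<le> norm x ^ n * \<bar>y\<bar> ^ n"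
      by (rule mult_right_mono) simp
    then show "norm (Im (x ^ Suc n) / real (Suc n) ^ s * y ^ n) \<le> (norm x * \<bar>y\<bar>) ^ n"
      by (simp only: real_norm_def abs_mult power_abs power_mult_distrib)
  qed
  moreover have "1 < 1 / norm x" using x \<open>norm x > 0\<close> by simp
  ultimately show ?case
    using powser_average_pos[of "1 / norm x", OF _ _ Suc.IH Suc.prems] by (simp add: mult.commute)
qed

lemma Im_Li3_pos:
  fixes x :: complex assumes x: "norm x < 1" "Im x > 0" shows "Im (Li3 x) > 0"
proof -
  have "(\<lambda>n. Im (x ^ Suc n / of_real (real (Suc n) ^ 3))) sums Im (Li3 x)"
    using x Li3_sums[of x] by (intro sums_Im) simp
  then have "Im (Li3 x) = (\<Sum>n. Im (x ^ Suc n) / real (Suc n) ^ 3)"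
    unfolding Im_divide_of_real by (simp add: sums_iff)
  then show ?thesis using Im_polylog_pos[OF x, of 1 3] by simp
qed

lemma Im_Li3_nonzero:
  fixes x :: complex assumes x: "norm x < 1" "Im x \<noteq> 0" shows "Im (Li3 x) \<noteq> 0"
proof (cases "Im x > 0")
  case True
  then show ?thesis using Im_Li3_pos[OF x(1)] by force
next
  case False
  then have "Im (Li3 (cnj x)) > 0" using x by (intro Im_Li3_pos) auto
  then show ?thesis using Li3_cnj[of x] x by simp
qed

subsection \<open>Comparison of the trilogarithm at a negative number and at its square\<close>

lemma Li3_divide_mono:
  fixes a b :: real assumes "0 < a" "a \<le> b" "b \<le> 1" shows "Li3 a / a \<le> Li3 b / b"
proof -
  have sums: "(\<lambda>n. x ^ n / real (Suc n) ^ 3) sums (Li3 x / x)" if "0 < x" "x \<le> 1" for x :: real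
    using sums_divide[OF Li3_sums[of x], of x] that by simp
  show ?thesis
    by (rule sums_le[OF _ sums sums]) (use assms in \<open>auto intro!: divide_right_mono power_mono\<close>)
qed

lemma minus_Li3_minus_tail_sums:
  fixes x :: real assumes "0 < x" "x \<le> 1"
  shows "(\<lambda>n. (-1) ^ n / real (n + 3) ^ 3 * x ^ Suc n) sums (- Li3 (- x) / x\<^sup>2 - 1 / x + 1 / 8)"
proof -
  let ?t = "\<lambda>n. (- x) ^ Suc n / real (Suc n) ^ 3"
  have "(\<lambda>n. ?t (n + 2)) sums (Li3 (- x) - (\<Sum>n<2. ?t n))"
    using assms by (intro sums_split_initial_segment Li3_sums) auto
  then have "(\<lambda>n. - ?t (n + 2) / x\<^sup>2) sums (- (Li3 (- x) - (\<Sum>n<2. ?t n)) / x\<^sup>2)"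
    by (intro sums_divide sums_minus)
  moreover have "- ?t (n + 2) / x\<^sup>2 = (-1) ^ n / real (n + 3) ^ 3 * x ^ Suc n" for n
    using assms by (subst power_minus) (simp add: power2_eq_square eval_nat_numeral)
  moreover have "- (Li3 (- x) - (\<Sum>n<2. ?t n)) / x\<^sup>2 = - Li3 (- x) / x\<^sup>2 - 1 / x + 1 / 8"
    using assms by (simp add: numeral_2_eq_2 field_simps)
  ultimately show ?thesis by (simp only:)
qed

lemma minus_Li3_minus_divide_square_diff_le:
  fixes r s :: real assumes "0 < r" "r \<le> s" "s \<le> 1"
  shows "- Li3 (- s) / s\<^sup>2 - - Li3 (- r) / r\<^sup>2 \<le> (s - r) / 2 + (1 / s - 1 / r)"
proof -
  have "(\<lambda>n. 1 / real (n + 2)) \<longlonglongrightarrow> 0" by real_asymp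
  from telescope_sums'[OF this] have telescope: "(\<lambda>n. 1 / real (n + 2) - 1 / real (Suc n + 2)) sums (1 / 2)"
    by simp
  have diff_sums: "(\<lambda>n. (-1) ^ n / real (n + 3) ^ 3 * (s ^ Suc n - r ^ Suc n)) sums
      ((- Li3 (- s) / s\<^sup>2 - 1 / s + 1 / 8) - (- Li3 (- r) / r\<^sup>2 - 1 / r + 1 / 8))"
    using sums_diff[OF minus_Li3_minus_tail_sums[of s] minus_Li3_minus_tail_sums[of r]] assms
    by (simp add: right_diff_distrib)
  have "(- Li3 (- s) / s\<^sup>2 - 1 / s + 1 / 8) - (- Li3 (- r) / r\<^sup>2 - 1 / r + 1 / 8) \<le> 1 / 2 * (s - r)"
  proof (rule sums_le[OF _ diff_sums sums_mult2[OF telescope, of "s - r"]])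
    fix n
    have "(-1) ^ n / real (n + 3) ^ 3 * (s ^ Suc n - r ^ Suc n) \<le> \<bar>(-1) ^ n / real (n + 3) ^ 3\<bar> * \<bar>s ^ Suc n - r ^ Suc n\<bar>"
      by (metis abs_ge_self abs_mult)
    also have "\<dots> \<le> 1 / real (n + 3) ^ 3 * (real (Suc n) * (s - r))"
      using assms norm_power_diff[of s r "Suc n"]
      by (intro mult_mono) (auto simp: abs_divide power_abs simp del: power_Suc of_nat_Suc)
    also have "\<dots> \<le> real (n + 3) / real (n + 3) ^ 3 * (s - r)"
      using assms by (auto intro!: divide_right_mono mult_right_mono)
    also have "real (n + 3) / real (n + 3) ^ 3 = 1 / (real (n + 3) * real (n + 3))"
      by (simp add: power3_eq_cube)
    also have "\<dots> * (s - r) \<le> 1 / (real (n + 2) * real (n + 3)) * (s - r)"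
      using assms by (intro divide_left_mono mult_right_mono) auto
    also have "1 / (real (n + 2) * real (n + 3)) = 1 / real (n + 2) - 1 / real (Suc n + 2)"
      by (simp add: field_simps)
    finally show "(-1) ^ n / real (n + 3) ^ 3 * (s ^ Suc n - r ^ Suc n) \<le> (1 / real (n + 2) - 1 / real (Suc n + 2)) * (s - r)" .
  qed
  then show ?thesis by argo
qed

lemma minus_Li3_minus_divide_square_strict_antimono:
  fixes r s :: real assumes "0 < r" "r < s" "s \<le> 1"
  shows "- Li3 (- s) / s\<^sup>2 < - Li3 (- r) / r\<^sup>2"
proof -
  have "r * s < 1 * s" using assms by (intro mult_strict_right_mono) auto
  then have "r * s \<le> 1" using assms by linarith
  then have "1 \<le> 1 / (r * s)" using assms by (simp add: le_divide_eq)
  then have "s - r \<le> (s - r) * (1 / (r * s))"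
    using assms mult_left_mono[of 1 "1 / (r * s)" "s - r"] by simp
  also have "\<dots> = 1 / r - 1 / s" using assms by (simp add: field_simps)
  finally have "(s - r) / 2 + (1 / s - 1 / r) < 0" using assms(2) by argo
  moreover have "- Li3 (- s) / s\<^sup>2 - - Li3 (- r) / r\<^sup>2 \<le> (s - r) / 2 + (1 / s - 1 / r)"
    using assms by (intro minus_Li3_minus_divide_square_diff_le) auto
  ultimately show ?thesis by (simp only: diff_less_0_iff_less order_le_less_trans)
qed

lemma Li3_square_less_minus_Li3_minus:
  fixes s t :: real assumes "0 < t" "t < s" "s \<le> 1" "- Li3 (- s) = Li3 (s\<^sup>2)"
  shows "Li3 (t\<^sup>2) < - Li3 (- t)"
proof -
  have "Li3 (t\<^sup>2) / t\<^sup>2 \<le> Li3 (s\<^sup>2) / s\<^sup>2"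
    using assms by (intro Li3_divide_mono) (auto intro!: power_mono simp: power_le_one)
  also have "\<dots> = - Li3 (- s) / s\<^sup>2" using assms by simp
  also have "\<dots> < - Li3 (- t) / t\<^sup>2" using assms by (intro minus_Li3_minus_divide_square_strict_antimono)
  finally show ?thesis using assms by (subst (asm) divide_less_cancel) auto
qed

section \<open>The phases and the level set\<close>

lemma cube_root_principal:
  fixes z :: complex assumes "z \<noteq> 0"
  defines "w \<equiv> z powr (1/3)"
  shows "w ^ 3 = z" "norm w \<le> 2 * Re w" "z \<notin> \<real>\<^sub>\<le>\<^sub>0 \<Longrightarrow> norm w < 2 * Re w"
proof -
  have w: "w = exp (Ln z / 3)" using assms by (simp add: powr_def)
  then show "w ^ 3 = z" using assms by (simp add: exp_of_nat_mult[symmetric])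
  have w_pos: "norm w > 0" unfolding w by simp
  let ?t = "Im (Ln z) / 3"
  have Re_w: "Re w = norm w * cos \<bar>?t\<bar>" unfolding w cos_abs_real by (simp add: Re_exp)
  note Im_Ln = Im_Ln_le_pi[OF assms(1)] mpi_less_Im_Ln[OF assms(1)]
  then have "cos (pi / 3) \<le> cos \<bar>?t\<bar>" by (intro cos_monotone_0_pi_le) auto
  then show "norm w \<le> 2 * Re w" unfolding Re_w cos_60 using w_pos by simp
  show "norm w < 2 * Re w" if "z \<notin> \<real>\<^sub>\<le>\<^sub>0"
  proof -
    have "Im (Ln z) \<noteq> pi"
      using that Im_Ln_eq_pi[OF assms(1)] by (auto simp: complex_nonpos_Reals_iff)
    then have "cos (pi / 3) < cos \<bar>?t\<bar>" using Im_Ln by (intro cos_monotone_0_pi) auto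
    then show ?thesis unfolding Re_w cos_60 using w_pos by simp
  qed
qed

lemma powr_third_of_pos_real:
  assumes "y > 0" shows "complex_of_real y powr (1/3) = of_real (y powr (1/3))"
  using assms powr_of_real[of y "1/3"] by simp

lemma powr_third_of_neg_real:
  assumes "y < 0"
  shows "complex_of_real y powr (1/3) = of_real (\<bar>y\<bar> powr (1/3)) * exp (\<i> * of_real (pi / 3))"
proof -
  have "Ln (complex_of_real y) = of_real (ln \<bar>y\<bar>) + \<i> * of_real pi"
    using assms by (intro Ln_unique) (auto simp: exp_add exp_of_real)
  then have "complex_of_real y powr (1/3) = exp (of_real (ln \<bar>y\<bar> / 3) + \<i> * of_real (pi / 3))"
    using assms by (simp add: powr_def add_divide_distrib)
  also have "\<dots> = of_real (\<bar>y\<bar> powr (1/3)) * exp (\<i> * of_real (pi / 3))"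
    using assms by (simp add: exp_add powr_def exp_of_real[symmetric])
  finally show ?thesis .
qed

lemma Li3_power_nonzero:
  assumes "0 < norm x" "norm x \<le> 1" shows "Li3 (x ^ k :: complex) \<noteq> 0"
  using assms by (subst Li3_eq_0_iff) (auto simp: norm_power power_le_one)

lemma L_phase_cube:
  assumes "0 < norm x" "norm x \<le> 1" shows "L_phase k x ^ 3 = 2 * Li3 (x ^ k) / of_nat k ^ 3"
  using cube_root_principal(1)[of "2 * Li3 (x ^ k)"] Li3_power_nonzero[OF assms]
  by (simp add: L_phase_def power_divide)

lemma norm_L_phase_le:
  assumes "0 < norm x" "norm x \<le> 1" shows "norm (L_phase k x) \<le> 2 * Re (L_phase k x)"
  using cube_root_principal(2)[of "2 * Li3 (x ^ k)"] Li3_power_nonzero[OF assms]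
  by (simp add: L_phase_def norm_divide Re_divide_of_nat divide_right_mono)

lemma norm_L_phase_less:
  assumes "norm x < 1" "Im (x ^ k) \<noteq> 0" shows "norm (L_phase k x) < 2 * Re (L_phase k x)"
proof -
  have k: "k > 0" using assms by (cases k) auto
  then have "norm (x ^ k) < 1" using assms by (simp add: norm_power power_less_one_iff)
  then have "Im (Li3 (x ^ k)) \<noteq> 0" using assms by (intro Im_Li3_nonzero)
  then have "2 * Li3 (x ^ k) \<notin> \<real>\<^sub>\<le>\<^sub>0" "2 * Li3 (x ^ k) \<noteq> 0" by (auto simp: complex_nonpos_Reals_iff)
  then show ?thesis using cube_root_principal(3)[of "2 * Li3 (x ^ k)"] k
    by (simp add: L_phase_def norm_divide Re_divide_of_nat divide_strict_right_mono)
qed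

lemma Re_L_phase_pos:
  assumes "0 < norm x" "norm x \<le> 1" "k > 0" shows "Re (L_phase k x) > 0"
proof -
  have "L_phase k x \<noteq> 0"
    using L_phase_cube[OF assms(1,2), of k] Li3_power_nonzero[OF assms(1,2)] assms(3) by auto
  then show ?thesis using norm_L_phase_le[OF assms(1,2), of k] by (smt (verit) zero_less_norm_iff)
qed

lemma norm_L_phase_cube:
  assumes "0 < norm x" "norm x \<le> 1"
  shows "norm (L_phase k x) ^ 3 = 2 * norm (Li3 (x ^ k)) / real k ^ 3"
  using arg_cong[OF L_phase_cube[OF assms, of k], of norm]
  by (simp add: norm_power norm_mult norm_divide)

lemma norm_L_phase_2_less:
  assumes "0 < norm x" "norm x < 1" shows "norm (L_phase 2 x) < norm (L_phase 1 x)"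
proof (rule power_less_imp_less_base)
  show "norm (L_phase 2 x) ^ 3 < norm (L_phase 1 x) ^ 3"
    using norm_L_phase_cube[of x 1] norm_L_phase_cube[of x 2] norm_Li3_square_less[OF assms] assms by simp
qed simp

lemma Re_L_phase_1_cube_ge:
  assumes "0 < norm x" "norm x \<le> 1" shows "19 / 96 * norm x \<le> Re (L_phase 1 x) ^ 3"
proof -
  have "19 / 12 * norm x \<le> norm (L_phase 1 x) ^ 3"
    using norm_L_phase_cube[OF assms, of 1] norm_Li3_bounds(1)[OF assms(2)] by simp
  also have "\<dots> \<le> (2 * Re (L_phase 1 x)) ^ 3" by (intro power_mono norm_L_phase_le assms) auto
  finally show ?thesis by (simp add: power_mult_distrib)
qed

lemma Re_L_phase_cube_le:
  assumes "0 < norm x" "norm x \<le> 1" "k > 0" shows "Re (L_phase k x) ^ 3 \<le> 29 / 12"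
proof -
  have "norm (Li3 (x ^ k)) \<le> 29 / 24"
    using norm_Li3_bounds(2)[of "x ^ k"] power_le_one[of "norm x" k] assms by (simp add: norm_power)
  moreover have "1 \<le> real k ^ 3" using assms(3) by (intro one_le_power) simp
  ultimately have "2 * norm (Li3 (x ^ k)) / real k ^ 3 \<le> 29 / 12"
    using frac_le[of "29 / 12" "2 * norm (Li3 (x ^ k))" 1 "real k ^ 3"] by simp
  moreover have "Re (L_phase k x) ^ 3 \<le> norm (L_phase k x) ^ 3"
    using Re_L_phase_pos[OF assms] by (intro power_mono complex_Re_le_cmod) auto
  ultimately show ?thesis using norm_L_phase_cube[OF assms(1,2), of k] by linarith
qed

lemma continuous_on_L_phase:
  assumes k: "k > 0" and X: "\<And>x. x \<in> X \<Longrightarrow> norm x < 1 \<and> Im (x ^ k) \<noteq> 0"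
  shows "continuous_on X (L_phase k)"
proof -
  have Li3: "norm (x ^ k) < 1 \<and> Im (2 * Li3 (x ^ k)) \<noteq> 0" if "x \<in> X" for x
    using X[OF that] k Im_Li3_nonzero[of "x ^ k"] by (auto simp: norm_power power_less_one_iff)
  have "continuous_on X (\<lambda>x. exp (Ln (2 * Li3 (x ^ k)) / 3) / of_nat k)"
    using Li3 k
    by (intro continuous_intros continuous_on_compose2[OF continuous_on_Li3_complex])
       (auto simp: complex_nonpos_Reals_iff)
  moreover have eq: "exp (Ln (2 * Li3 (x ^ k)) / 3) / of_nat k = L_phase k x" if "x \<in> X" for x
  proof -
    have "2 * Li3 (x ^ k) \<noteq> 0" using Li3[OF that] by force
    then show ?thesis by (simp add: L_phase_def powr_def)
  qed
  ultimately show ?thesis using continuous_on_cong[OF refl eq, of X] by simp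
qed

lemma L_phase_of_pos_real:
  assumes "x ^ k = complex_of_real y" "0 < y" "y \<le> 1"
  shows "L_phase k x = of_real ((2 * Li3 y) powr (1/3) / real k)"
proof -
  have "2 * Li3 (x ^ k) = complex_of_real (2 * Li3 y)" using assms by (simp add: Li3_of_real)
  then show ?thesis
    using powr_third_of_pos_real[of "2 * Li3 y"] Li3_real_pos[OF assms(2,3)] by (simp add: L_phase_def)
qed

lemma L_phase_of_neg_real:
  assumes "x ^ k = complex_of_real y" "-1 \<le> y" "y < 0"
  shows "L_phase k x = of_real ((2 * \<bar>Li3 y\<bar>) powr (1/3) / real k) * exp (\<i> * of_real (pi / 3))"
proof -
  have "2 * Li3 (x ^ k) = complex_of_real (2 * Li3 y)" using assms by (simp add: Li3_of_real)
  then show ?thesis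
    using powr_third_of_neg_real[of "2 * Li3 y"] Li3_real_neg[OF assms(2,3)] by (simp add: L_phase_def)
qed

lemma norm_L_phase_of_neg_real:
  assumes "x ^ k = complex_of_real y" "-1 \<le> y" "y < 0"
  shows "norm (L_phase k x) = 2 * Re (L_phase k x)"
  unfolding L_phase_of_neg_real[OF assms] by (simp add: norm_mult norm_divide norm_exp_eq_Re Re_exp cos_60)

lemma level_set_Im_square:
  assumes "x \<in> level_set" "Im x \<noteq> 0" shows "Im (x\<^sup>2) \<noteq> 0"
proof
  assume "Im (x\<^sup>2) = 0"
  then have "Re x = 0" using assms by (simp add: power2_eq_square)
  then have square: "x ^ 2 = complex_of_real (- (Im x)\<^sup>2)" by (simp add: complex_eq_iff power2_eq_square)
  have x: "0 < norm x" "norm x < 1" "Re (L_phase 1 x) = Re (L_phase 2 x)" using assms by (auto simp: level_set_def)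
  then have "(Im x)\<^sup>2 \<le> 1" using abs_Im_le_cmod[of x] by (intro abs_square_le_1[THEN iffD2]) linarith
  then have "norm (L_phase 2 x) = 2 * Re (L_phase 2 x)"
    using assms by (intro norm_L_phase_of_neg_real[OF square]) auto
  then show False using norm_L_phase_2_less[OF x(1,2)] norm_L_phase_le[of x 1] x by simp
qed

lemma powr_eq_powr_iff:
  fixes a x y :: real
  assumes "0 \<le> x" "0 \<le> y" "0 < a" shows "x powr a = y powr a \<longleftrightarrow> x = y"
  using assms by (metis linorder_neq_iff powr_less_mono2)

lemma pos_real_notin_level_set:
  assumes "0 < x" shows "complex_of_real x \<notin> level_set"
proof
  assume "complex_of_real x \<in> level_set"
  then have x: "0 < norm (complex_of_real x)" "norm (complex_of_real x) < 1"
    and level: "Re (L_phase 1 (of_real x)) = Re (L_phase 2 (of_real x))" by (auto simp: level_set_def)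
  have "L_phase 1 (of_real x) = of_real ((2 * Li3 x) powr (1/3) / real 1)"
    using x assms by (intro L_phase_of_pos_real) auto
  then have "norm (L_phase 1 (of_real x)) = Re (L_phase 1 (of_real x))" by simp
  then show False
    using norm_L_phase_2_less[OF x] level complex_Re_le_cmod[of "L_phase 2 (of_real x)"] by linarith
qed

lemma L_phase_1_of_neg_real:
  fixes x :: real assumes "-1 < x" "x < 0"
  shows "L_phase 1 (of_real x) = of_real ((2 * \<bar>Li3 x\<bar>) powr (1/3)) * exp (\<i> * of_real (pi / 3))"
  using L_phase_of_neg_real[of "of_real x" 1 x] assms by simp

lemma neg_real_in_level_set_iff:
  fixes x :: real assumes "-1 < x" "x < 0"
  shows "complex_of_real x \<in> level_set \<longleftrightarrow> - Li3 x = Li3 (x\<^sup>2)"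
proof -
  have square: "0 < x\<^sup>2" "x\<^sup>2 \<le> 1" using assms by (auto simp: abs_square_le_1)
  have Re_1: "Re (L_phase 1 (of_real x)) = (2 * \<bar>Li3 x\<bar>) powr (1/3) / 2"
    unfolding L_phase_1_of_neg_real[OF assms] by (simp add: Re_exp cos_60)
  have "L_phase 2 (of_real x) = of_real ((2 * Li3 (x\<^sup>2)) powr (1/3) / real 2)"
    using square by (intro L_phase_of_pos_real) auto
  then have Re_2: "Re (L_phase 2 (of_real x)) = (2 * Li3 (x\<^sup>2)) powr (1/3) / 2"
    by (simp only: Re_complex_of_real of_nat_numeral)
  have "complex_of_real x \<in> level_set \<longleftrightarrow> (2 * \<bar>Li3 x\<bar>) powr (1/3) = (2 * Li3 (x\<^sup>2)) powr (1/3)"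
    using assms unfolding level_set_def mem_Collect_eq Re_1 Re_2 by auto
  also have "\<dots> \<longleftrightarrow> 2 * \<bar>Li3 x\<bar> = 2 * Li3 (x\<^sup>2)"
    using Li3_real_pos[OF square] by (intro powr_eq_powr_iff) auto
  finally show ?thesis using Li3_real_neg[of x] assms by auto
qed

lemma real_in_level_set_iff:
  fixes x :: real
  shows "complex_of_real x \<in> level_set \<longleftrightarrow> -1 < x \<and> x < 0 \<and> - Li3 x = Li3 (x\<^sup>2)"
  using neg_real_in_level_set_iff[of x] pos_real_notin_level_set[of x]
  by (cases x "0 :: real" rule: linorder_cases) (auto simp: level_set_def)

lemma exists_minus_Li3_minus_eq_Li3_square:
  obtains r :: real where "0 < r" "r < 1" "- Li3 (- r) = Li3 (r\<^sup>2)"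
proof -
  let ?g = "\<lambda>r::real. - Li3 (- r) - Li3 (r\<^sup>2)"
  have "\<exists>r. 1/2 \<le> r \<and> r \<le> 19/20 \<and> ?g r = 0"
  proof (rule IVT2')
    show "?g (19/20) \<le> 0"
      using norm_Li3_minus_quadratic_le[of "- (19/20) :: real"] norm_Li3_minus_quadratic_le[of "(19/20)\<^sup>2 :: real"]
      by (simp add: abs_if power2_eq_square power3_eq_cube split: if_splits)
    show "0 \<le> ?g (1/2)"
      using norm_Li3_minus_quadratic_le[of "- (1/2) :: real"] norm_Li3_minus_quadratic_le[of "(1/2)\<^sup>2 :: real"]
      by (simp add: abs_if power2_eq_square power3_eq_cube split: if_splits)
    have "r\<^sup>2 \<in> {-1<..<1}" if "r \<in> {1/2..19/20}" for r :: real
    proof -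
      have "r\<^sup>2 < 1" using that by (simp add: abs_square_less_1)
      moreover have "-1 < r\<^sup>2" using zero_le_power2[of r] by linarith
      ultimately show ?thesis by simp
    qed
    then show "continuous_on {1/2..19/20} ?g"
      by (intro continuous_intros continuous_on_compose2[OF continuous_on_Li3_real]) auto
  qed simp
  then obtain r where "1/2 \<le> r" "r \<le> 19/20" "?g r = 0" by blast
  then show ?thesis using that[of r] by simp
qed

lemma
  shows x_star_gt: "-1 < x_star" and Li3_square_less_abs_Li3: "x_star < x \<Longrightarrow> x < 0 \<Longrightarrow> Li3 (x\<^sup>2) < \<bar>Li3 x\<bar>"
    and real_level_set_eq_x_star: "complex_of_real x \<in> level_set \<Longrightarrow> x = x_star"
proof -
  obtain r :: real where r: "0 < r" "r < 1" "- Li3 (- r) = Li3 (r\<^sup>2)"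
    by (rule exists_minus_Li3_minus_eq_Li3_square)
  have r_in: "complex_of_real (- r) \<in> level_set" unfolding real_in_level_set_iff using r by simp
  have unique: "y = - r" if "complex_of_real y \<in> level_set" for y
  proof -
    have y: "-1 < y" "y < 0" "- Li3 y = Li3 (y\<^sup>2)" using that unfolding real_in_level_set_iff by auto
    have "\<not> - y < r" using Li3_square_less_minus_Li3_minus[of "- y" r] r y by auto
    moreover have "\<not> r < - y" using Li3_square_less_minus_Li3_minus[of r "- y"] r y by auto
    ultimately show ?thesis by linarith
  qed
  have x_star: "x_star = - r" unfolding x_star_def using r_in unique by (rule the_equality)
  show "-1 < x_star" using x_star r by simp
  show "x = x_star" if "complex_of_real x \<in> level_set" using unique[OF that] x_star by simp
  show "Li3 (x\<^sup>2) < \<bar>Li3 x\<bar>" if "x_star < x" "x < 0"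
    using Li3_square_less_minus_Li3_minus[of "- x" r] r that x_star by simp
qed

section \<open>The logarithm near the roots of unity\<close>

lemma koebe_exp_minus: "koebe (exp (- z)) = 1 / (exp z + exp (- z) - 2)" for z :: complex
proof -
  have "exp z * exp (- z) = 1" by (simp add: exp_minus)
  then have "(1 - exp (- z))\<^sup>2 = exp (- z) * (exp z + exp (- z) - 2)"
    by (simp add: power2_eq_square algebra_simps)
  then show ?thesis by (simp add: koebe_def)
qed

lemma norm_exp_plus_exp_minus_Taylor:
  fixes z :: complex assumes "norm z \<le> 1"
  shows "norm (exp z + exp (- z) - 2 - z\<^sup>2 - z ^ 4 / 12) \<le> norm z ^ 6 / 20"
proof -
  let ?T = "\<lambda>y::complex. \<Sum>k\<le>5. y ^ k / fact k"
  have "exp \<bar>Re z\<bar> \<le> exp 1" using assms abs_Re_le_cmod[of z] by simp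
  also have "\<dots> \<le> 3" by (rule exp_le)
  finally have exp_le_3: "exp \<bar>Re z\<bar> \<le> 3" .
  have Taylor: "norm (exp y - ?T y) \<le> norm z ^ 6 / 40" if "y = z \<or> y = - z" for y
  proof -
    have "norm (exp y - ?T y) \<le> exp \<bar>Re y\<bar> * norm y ^ Suc 5 / fact 5" by (rule Taylor_exp)
    also have "\<dots> \<le> 3 * norm z ^ 6 / 120"
      using that mult_right_mono[OF exp_le_3, of "norm z ^ 6"] by (auto simp: fact_numeral)
    finally show ?thesis by simp
  qed
  have "?T z + ?T (- z) = 2 + z\<^sup>2 + z ^ 4 / 12"
    by (simp add: eval_nat_numeral fact_numeral)
  then have "exp z + exp (- z) - 2 - z\<^sup>2 - z ^ 4 / 12 = (exp z - ?T z) + (exp (- z) - ?T (- z))"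
    by (simp add: algebra_simps)
  also have "norm \<dots> \<le> norm z ^ 6 / 40 + norm z ^ 6 / 40"
    using Taylor[of z] Taylor[of "- z"] by (intro norm_triangle_mono) auto
  finally show ?thesis by simp
qed

lemma norm_koebe_exp_minus_near_0:
  fixes z :: complex assumes "z \<noteq> 0" "norm z \<le> 1"
  shows "norm (koebe (exp (- z)) - 1 / z\<^sup>2 + 1 / 12) \<le> norm z ^ 2 / 5"
proof -
  define \<rho> where "\<rho> = (exp z + exp (- z) - 2 - z\<^sup>2 - z ^ 4 / 12) / z\<^sup>2"
  define q where "q = 1 + z\<^sup>2 / 12 + \<rho>"
  have "norm \<rho> \<le> (norm z ^ 6 / 20) / norm z ^ 2"
    unfolding \<rho>_def norm_divide norm_power
    using norm_exp_plus_exp_minus_Taylor[OF assms(2)] by (intro divide_right_mono) auto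
  also have "\<dots> = norm z ^ 4 / 20" using assms by (simp add: field_simps eval_nat_numeral)
  finally have \<rho>: "norm \<rho> \<le> norm z ^ 4 / 20" .
  have powers: "norm z ^ 2 \<le> 1" "norm z ^ 4 \<le> 1" using assms by (auto simp: power_le_one)
  have "norm (z\<^sup>2 / 12 + \<rho>) \<le> 1 / 12 + 1 / 20"
    using \<rho> powers by (intro norm_triangle_mono) (auto simp: norm_divide norm_power)
  then have q: "norm q \<ge> 1 / 2"
    using norm_diff_ineq[of 1 "z\<^sup>2 / 12 + \<rho>"] by (simp add: q_def add.assoc)
  then have "q \<noteq> 0" by auto
  have "exp z + exp (- z) - 2 = z\<^sup>2 * q"
    using assms by (simp add: q_def \<rho>_def field_simps eval_nat_numeral)
  then have "koebe (exp (- z)) - 1 / z\<^sup>2 + 1 / 12 = (1 - (1 - z\<^sup>2 / 12) * q) / (z\<^sup>2 * q)"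
    using assms \<open>q \<noteq> 0\<close> by (simp add: koebe_exp_minus field_simps)
  also have "1 - (1 - z\<^sup>2 / 12) * q = z ^ 4 / 144 - \<rho> * (1 - z\<^sup>2 / 12)"
    by (simp add: q_def algebra_simps eval_nat_numeral)
  also have "norm ((z ^ 4 / 144 - \<rho> * (1 - z\<^sup>2 / 12)) / (z\<^sup>2 * q)) \<le> (norm z ^ 4 / 10) / (norm z ^ 2 * (1 / 2))"
    unfolding norm_divide
  proof (rule frac_le)
    have "norm (1 - z\<^sup>2 / 12) \<le> 13 / 12"
      using norm_triangle_ineq4[of 1 "z\<^sup>2 / 12"] powers by (simp add: norm_divide norm_power)
    then have "norm (\<rho> * (1 - z\<^sup>2 / 12)) \<le> norm z ^ 4 / 20 * (13 / 12)"
      unfolding norm_mult using \<rho> by (intro mult_mono) auto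
    then have "norm (z ^ 4 / 144 - \<rho> * (1 - z\<^sup>2 / 12)) \<le> norm z ^ 4 / 144 + norm z ^ 4 / 20 * (13 / 12)"
      using norm_triangle_ineq4[of "z ^ 4 / 144" "\<rho> * (1 - z\<^sup>2 / 12)"] by (simp add: norm_divide norm_power)
    then show "norm (z ^ 4 / 144 - \<rho> * (1 - z\<^sup>2 / 12)) \<le> norm z ^ 4 / 10"
      using zero_le_power[of "norm z" 4, OF norm_ge_zero] by linarith
    show "norm z ^ 2 * (1 / 2) \<le> norm (z\<^sup>2 * q)"
      unfolding norm_mult norm_power using q by (intro mult_left_mono) auto
  qed (use assms in auto)
  also have "\<dots> = norm z ^ 2 / 5" using assms by (simp add: field_simps eval_nat_numeral)
  finally show ?thesis .
qed

definition cone :: "real \<Rightarrow> complex set" where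
  "cone A = {w. 0 < Re w \<and> \<bar>Im w\<bar> \<le> A * Re w}"

lemma cone_scale:
  assumes "w \<in> cone A" "c > 0" shows "of_real c * w \<in> cone A"
proof -
  have "\<bar>Im (of_real c * w)\<bar> = c * \<bar>Im w\<bar>" using assms by (simp add: abs_mult)
  also have "\<dots> \<le> c * (A * Re w)" using assms by (intro mult_left_mono) (auto simp: cone_def)
  finally show ?thesis using assms by (simp add: cone_def mult.left_commute)
qed

lemma norm_koebe_exp_minus_far:
  fixes z :: complex assumes "norm z \<ge> 1" "Re z \<ge> \<delta>" "\<delta> > 0"
  shows "norm (koebe (exp (- z)) - 1 / z\<^sup>2 + 1 / 12) \<le> (1 / (1 - exp (- \<delta>))\<^sup>2 + 2) * norm z ^ 2"
proof -
  have "norm (koebe (exp (- z))) \<le> 1 / (1 - exp (- \<delta>))\<^sup>2"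
    using assms by (intro norm_koebe_le) auto
  moreover have "norm (1 / z\<^sup>2) \<le> 1"
    using assms by (simp add: norm_divide norm_power divide_le_eq one_le_power)
  moreover have "norm (koebe (exp (- z)) - 1 / z\<^sup>2 + 1 / 12) \<le> norm (koebe (exp (- z))) + norm (1 / z\<^sup>2) + norm (1 / 12 :: complex)"
    by (intro norm_triangle_le norm_triangle_le_diff add_right_mono) (auto intro: norm_triangle_ineq4)
  ultimately have "norm (koebe (exp (- z)) - 1 / z\<^sup>2 + 1 / 12) \<le> (1 / (1 - exp (- \<delta>))\<^sup>2 + 2) * 1" by simp
  also have "\<dots> \<le> (1 / (1 - exp (- \<delta>))\<^sup>2 + 2) * norm z ^ 2"
    using assms by (intro mult_left_mono one_le_power) (auto intro!: add_nonneg_nonneg)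
  finally show ?thesis .
qed

lemma koebe_exp_minus_expansion:
  assumes "A \<ge> 0"
  obtains C where "C > 0" "\<And>z. z \<in> cone A \<Longrightarrow> norm (koebe (exp (- z)) - 1 / z\<^sup>2 + 1 / 12) \<le> C * norm z ^ 2"
proof -
  define \<delta> where "\<delta> = 1 / (1 + A)"
  define C where "C = 1 / (1 - exp (- \<delta>))\<^sup>2 + 2"
  have \<delta>: "\<delta> > 0" using assms by (simp add: \<delta>_def)
  have C: "C \<ge> 2" by (simp add: C_def)
  have "norm (koebe (exp (- z)) - 1 / z\<^sup>2 + 1 / 12) \<le> C * norm z ^ 2" if z: "z \<in> cone A" for z
  proof (cases "norm z \<le> 1")
    case True
    moreover have "z \<noteq> 0" using z by (auto simp: cone_def)
    ultimately have "norm (koebe (exp (- z)) - 1 / z\<^sup>2 + 1 / 12) \<le> 1 / 5 * norm z ^ 2"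
      using norm_koebe_exp_minus_near_0[of z] by simp
    also have "\<dots> \<le> C * norm z ^ 2" using C by (intro mult_right_mono) auto
    finally show ?thesis .
  next
    case False
    have "norm z \<le> \<bar>Re z\<bar> + \<bar>Im z\<bar>" by (rule cmod_le)
    also have "\<dots> \<le> (1 + A) * Re z" using z by (simp add: cone_def algebra_simps)
    finally have "1 \<le> (1 + A) * Re z" using False by simp
    then have "\<delta> \<le> Re z" using assms by (simp add: \<delta>_def divide_le_eq mult.commute)
    then show ?thesis unfolding C_def using False \<delta> by (intro norm_koebe_exp_minus_far) auto
  qed
  then show ?thesis using that[of C] C by simp
qed

lemma minus_Ln_one_minus_sums:
  fixes x :: complex assumes "norm x < 1" shows "(\<lambda>k. x ^ Suc k / of_nat (Suc k)) sums (- Ln (1 - x))"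
proof -
  have "(\<lambda>k. - (x ^ k) / of_nat k) sums Ln (1 - x)" using Ln_series'[of "- x"] assms by simp
  then have "(\<lambda>k. - (x ^ Suc k) / of_nat (Suc k)) sums Ln (1 - x)"
    using sums_Suc_iff[of "\<lambda>k. - (x ^ k) / of_nat k" "Ln (1 - x)"] by simp
  from sums_minus[OF this] show ?thesis by simp
qed

lemma pp_log_remainder_sums:
  fixes x w :: complex assumes "norm x < 1" "Re w > 0"
  shows "(\<lambda>k. x ^ Suc k / of_nat (Suc k) *
      (koebe (exp (- (of_nat (Suc k) * w))) - 1 / (of_nat (Suc k) * w)\<^sup>2 + 1 / 12)) sums
    (pp_log x (exp (- w)) - (Li3 x / w\<^sup>2 + Ln (1 - x) / 12))"
proof -
  let ?t = "\<lambda>k. x ^ Suc k / of_nat (Suc k)"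
  have "exp (- w) ^ Suc k = exp (- (of_nat (Suc k) * w))" for k
    by (subst exp_of_nat_mult[symmetric]) simp
  then have "(\<lambda>k. ?t k * koebe (exp (- (of_nat (Suc k) * w)))) sums pp_log x (exp (- w))"
    using pp_log_sums[of x "exp (- w)"] assms by simp
  moreover have "(\<lambda>k. x ^ Suc k / of_nat (Suc k) ^ 3 / w\<^sup>2) sums (Li3 x / w\<^sup>2)"
    using assms by (intro sums_divide Li3_sums) simp
  moreover have "(\<lambda>k. ?t k / 12) sums (- Ln (1 - x) / 12)"
    by (intro sums_divide minus_Ln_one_minus_sums assms)
  ultimately have "(\<lambda>k. ?t k * koebe (exp (- (of_nat (Suc k) * w))) - x ^ Suc k / of_nat (Suc k) ^ 3 / w\<^sup>2 + ?t k / 12) sums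
      (pp_log x (exp (- w)) - Li3 x / w\<^sup>2 + - Ln (1 - x) / 12)"
    by (intro sums_add sums_diff)
  moreover have "?t k * koebe (exp (- (of_nat (Suc k) * w))) - x ^ Suc k / of_nat (Suc k) ^ 3 / w\<^sup>2 + ?t k / 12 =
      ?t k * (koebe (exp (- (of_nat (Suc k) * w))) - 1 / (of_nat (Suc k) * w)\<^sup>2 + 1 / 12)" for k
  proof -
    have "x ^ Suc k / of_nat (Suc k) ^ 3 / w\<^sup>2 = ?t k * (1 / (of_nat (Suc k) * w)\<^sup>2)"
      by (simp add: power_mult_distrib power2_eq_square power3_eq_cube del: of_nat_Suc)
    then show ?thesis by (simp only:) (simp add: algebra_simps)
  qed
  moreover have "pp_log x (exp (- w)) - Li3 x / w\<^sup>2 + - Ln (1 - x) / 12 =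
      pp_log x (exp (- w)) - (Li3 x / w\<^sup>2 + Ln (1 - x) / 12)" by simp
  ultimately show ?thesis by (simp only:)
qed

lemma summable_Suc_mult_power:
  fixes r :: real assumes "0 \<le> r" "r < 1" shows "summable (\<lambda>k. real (Suc k) * r ^ Suc k)"
proof -
  have "summable (\<lambda>k. of_nat (Suc k) * r ^ k)" using geometric_deriv_sums[of r] assms by (simp add: sums_iff)
  from summable_mult[OF this, of r] show ?thesis by (simp add: mult_ac)
qed

lemma pp_log_expansion_at_1:
  assumes "A \<ge> 0" "0 \<le> r" "r < 1"
  obtains C where "C > 0" "\<And>x w :: complex. norm x \<le> r \<Longrightarrow> w \<in> cone A \<Longrightarrow>
    norm (pp_log x (exp (- w)) - (Li3 x / w\<^sup>2 + Ln (1 - x) / 12)) \<le> C * norm w ^ 2"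
proof -
  obtain C where C: "C > 0" "\<And>z. z \<in> cone A \<Longrightarrow> norm (koebe (exp (- z)) - 1 / z\<^sup>2 + 1 / 12) \<le> C * norm z ^ 2"
    using koebe_exp_minus_expansion[OF assms(1)] by blast
  define M where "M = (\<Sum>k. real (Suc k) * r ^ Suc k)"
  have M: "M \<ge> 0" unfolding M_def using assms by (intro suminf_nonneg summable_Suc_mult_power) auto
  show ?thesis
  proof
    show "C * (M + 1) > 0" using C M by simp
    fix x w :: complex assume x: "norm x \<le> r" and w: "w \<in> cone A"
    let ?t = "\<lambda>k. x ^ Suc k / of_nat (Suc k)"
    let ?e = "\<lambda>k. ?t k * (koebe (exp (- (of_nat (Suc k) * w))) - 1 / (of_nat (Suc k) * w)\<^sup>2 + 1 / 12)"
    have term_le: "norm (?e k) \<le> C * norm w ^ 2 * (real (Suc k) * r ^ Suc k)" for k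
    proof -
      have "norm (?t k) \<le> r ^ Suc k / real (Suc k)"
        unfolding norm_divide norm_power norm_of_nat using x by (intro divide_right_mono power_mono) auto
      then have "norm (?e k) \<le> (r ^ Suc k / real (Suc k)) * (C * norm (of_nat (Suc k) * w) ^ 2)"
        unfolding norm_mult[of "?t k"] using assms C(2)[OF cone_scale[OF w, of "real (Suc k)"]]
        by (intro mult_mono) auto
      also have "\<dots> = C * norm w ^ 2 * (real (Suc k) * r ^ Suc k)"
        unfolding norm_mult norm_of_nat by (simp add: power_mult_distrib power2_eq_square field_simps del: of_nat_Suc)
      finally show ?thesis .
    qed
    have "pp_log x (exp (- w)) - (Li3 x / w\<^sup>2 + Ln (1 - x) / 12) = suminf ?e"
      using pp_log_remainder_sums[of x w] x w assms by (simp add: sums_iff cone_def)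
    also have "norm \<dots> \<le> (\<Sum>k. C * norm w ^ 2 * (real (Suc k) * r ^ Suc k))"
      by (rule norm_suminf_le[OF term_le summable_mult[OF summable_Suc_mult_power[OF assms(2,3)]]])
    also have "\<dots> = C * norm w ^ 2 * M"
      unfolding M_def by (rule suminf_mult[OF summable_Suc_mult_power[OF assms(2,3)]])
    also have "\<dots> \<le> C * (M + 1) * norm w ^ 2" using C by (simp add: algebra_simps)
    finally show "norm (pp_log x (exp (- w)) - (Li3 x / w\<^sup>2 + Ln (1 - x) / 12)) \<le> C * (M + 1) * norm w ^ 2" .
  qed
qed

lemma koebe_minus:
  fixes v :: "'a::field" assumes "v \<noteq> 1" "v \<noteq> -1" shows "koebe (- v) = 4 * koebe (v\<^sup>2) - koebe v"
proof -
  have ne: "1 - v \<noteq> 0" "1 + v \<noteq> 0" using assms by (auto simp: add_eq_0_iff)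
  have factor: "1 - v\<^sup>2 = (1 - v) * (1 + v)" by (simp add: power2_eq_square algebra_simps)
  have "4 * v\<^sup>2 - v * (1 + v)\<^sup>2 = - v * (1 - v)\<^sup>2" by (simp add: power2_eq_square algebra_simps)
  moreover have "4 * koebe (v\<^sup>2) - koebe v = (4 * v\<^sup>2 - v * (1 + v)\<^sup>2) / ((1 - v) * (1 + v))\<^sup>2"
    using ne by (simp add: koebe_def factor power_mult_distrib divide_simps)
  ultimately show ?thesis using ne by (simp add: koebe_def power_mult_distrib)
qed

lemma sums_at_odd:
  assumes "f sums c" shows "(\<lambda>k. if even k then 0 else f ((k - 1) div 2)) sums c"
proof -
  let ?g = "\<lambda>k. if even k then 0 else f ((k - 1) div 2)"
  have "(\<lambda>j. ?g (2 * j + 1)) sums c \<longleftrightarrow> ?g sums c"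
    by (rule sums_mono_reindex) (auto simp: strict_mono_def elim!: oddE)
  then show ?thesis using assms by simp
qed

lemma koebe_minus_power:
  assumes "norm (u :: complex) < 1" "odd k"
  shows "koebe ((- u) ^ k) = 4 * koebe ((u\<^sup>2) ^ k) - koebe (u ^ k)"
proof -
  have "norm (u ^ k) < 1" unfolding norm_power using assms by (subst power_less_one_iff) (auto elim: oddE)
  then have "koebe (- (u ^ k)) = 4 * koebe ((u ^ k)\<^sup>2) - koebe (u ^ k)" by (intro koebe_minus) auto
  moreover have "(u ^ k)\<^sup>2 = (u\<^sup>2) ^ k" by (simp flip: power_mult add: mult.commute)
  ultimately show ?thesis using assms(2) by simp
qed

text \<open>The terms with even exponent are unchanged under \<open>u \<mapsto> - u\<close>; treating them like the odd ones leaves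
  a correction by series in \<open>x\<^sup>2\<close>.\<close>

lemma pp_log_minus:
  fixes x u :: complex assumes x: "norm x < 1" and u: "norm u < 1"
  shows "pp_log x (- u) = pp_log (x\<^sup>2) (u\<^sup>2) - 2 * pp_log (x\<^sup>2) (u ^ 4) + 4 * pp_log x (u\<^sup>2) - pp_log x u"
proof -
  have norms: "norm (x\<^sup>2) < 1" "norm (u\<^sup>2) < 1" "norm (u ^ 4) < 1" "norm (- u) < 1"
    using x u by (auto simp: norm_power power_less_one_iff)
  define G where "G j = (x\<^sup>2) ^ Suc j / of_nat (Suc j) * koebe ((u\<^sup>2) ^ Suc j) -
      2 * ((x\<^sup>2) ^ Suc j / of_nat (Suc j) * koebe ((u ^ 4) ^ Suc j))" for j
  define H where "H k = 4 * (x ^ Suc k / of_nat (Suc k) * koebe ((u\<^sup>2) ^ Suc k)) -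
      x ^ Suc k / of_nat (Suc k) * koebe (u ^ Suc k)" for k
  define E where "E k = (if even k then 0 else G ((k - 1) div 2))" for k :: nat
  have "G sums (pp_log (x\<^sup>2) (u\<^sup>2) - 2 * pp_log (x\<^sup>2) (u ^ 4))"
    unfolding G_def[abs_def] by (intro sums_diff sums_mult pp_log_sums norms)
  then have "E sums (pp_log (x\<^sup>2) (u\<^sup>2) - 2 * pp_log (x\<^sup>2) (u ^ 4))"
    unfolding E_def[abs_def] by (rule sums_at_odd)
  moreover have "H sums (4 * pp_log x (u\<^sup>2) - pp_log x u)"
    unfolding H_def[abs_def] by (intro sums_diff sums_mult pp_log_sums x u norms)
  ultimately have "(\<lambda>k. E k + H k) sums
      ((pp_log (x\<^sup>2) (u\<^sup>2) - 2 * pp_log (x\<^sup>2) (u ^ 4)) + (4 * pp_log x (u\<^sup>2) - pp_log x u))"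
    by (rule sums_add)
  moreover have "x ^ Suc k / of_nat (Suc k) * koebe ((- u) ^ Suc k) = E k + H k" for k
  proof (cases "even k")
    case True
    then have "koebe ((- u) ^ Suc k) = 4 * koebe ((u\<^sup>2) ^ Suc k) - koebe (u ^ Suc k)"
      using u by (intro koebe_minus_power) auto
    then show ?thesis using True
      by (simp only: E_def H_def if_True add_0 right_diff_distrib mult.left_commute)
  next
    case False
    then obtain j where k: "k = 2 * j + 1" by (elim oddE)
    then have Suc_k: "Suc k = 2 * Suc j" by simp
    have "(- u) ^ Suc k = (u\<^sup>2) ^ Suc j" "u ^ Suc k = (u\<^sup>2) ^ Suc j" "(u\<^sup>2) ^ Suc k = (u ^ 4) ^ Suc j"
      "x ^ Suc k = (x\<^sup>2) ^ Suc j"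
      unfolding Suc_k power_mult by (simp_all flip: power_mult)
    moreover have "of_nat (Suc k) = 2 * (of_nat (Suc j) :: complex)" using Suc_k by simp
    moreover have "E k = G j" using k by (simp add: E_def)
    ultimately show ?thesis unfolding G_def H_def
      by (simp only:) (simp add: field_simps del: of_nat_Suc power_Suc)
  qed
  ultimately have "pp_log x (- u) = pp_log (x\<^sup>2) (u\<^sup>2) - 2 * pp_log (x\<^sup>2) (u ^ 4) + (4 * pp_log x (u\<^sup>2) - pp_log x u)"
    using pp_log_sums[OF x norms(4)] sums_unique2 by (metis (no_types, lifting) sums_cong)
  then show ?thesis by (simp add: algebra_simps)
qed

lemma Ln_one_minus_square:
  fixes x :: complex assumes "norm x < 1"
  shows "Ln (1 - x\<^sup>2) = Ln (1 - x) + Ln (1 + x)" "Ln ((1 - x) / (1 + x)) = Ln (1 - x) - Ln (1 + x)"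
proof -
  have Re: "Re (1 - x) > 0" "Re (1 + x) > 0" using assms abs_Re_le_cmod[of x] by auto
  then have ne: "1 - x \<noteq> 0" "1 + x \<noteq> 0" by (metis less_irrefl zero_complex.sel(1))+
  have Im: "\<bar>Im (Ln (1 - x))\<bar> < pi / 2" "\<bar>Im (Ln (1 + x))\<bar> < pi / 2"
    using ne Re Re_Ln_pos_lt by blast+
  have "1 - x\<^sup>2 = (1 - x) * (1 + x)" by (simp add: power2_eq_square algebra_simps)
  then show "Ln (1 - x\<^sup>2) = Ln (1 - x) + Ln (1 + x)"
    using ne Im Ln_times_simple[of "1 - x" "1 + x"] by auto
  from ne have "exp (Ln (1 - x) - Ln (1 + x)) = (1 - x) / (1 + x)" by (simp add: exp_diff)
  then show "Ln ((1 - x) / (1 + x)) = Ln (1 - x) - Ln (1 + x)"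
    using Im by (intro Ln_unique) auto
qed

lemma pp_log_expansion_at_minus_1:
  assumes "A \<ge> 0" "0 \<le> r" "r < 1"
  obtains C where "C > 0" "\<And>x w :: complex. norm x \<le> r \<Longrightarrow> w \<in> cone A \<Longrightarrow>
    norm (pp_log x (- exp (- w)) - (Li3 (x\<^sup>2) / (8 * w\<^sup>2) + (Ln (1 - x\<^sup>2) / 24 + Ln ((1 - x) / (1 + x)) / 8))) \<le> C * norm w ^ 2"
proof -
  define e where "e y v = pp_log y (exp (- v)) - (Li3 y / v\<^sup>2 + Ln (1 - y) / 12)" for y v :: complex
  obtain C where C: "C > 0" "\<And>y v. norm y \<le> r \<Longrightarrow> v \<in> cone A \<Longrightarrow> norm (e y v) \<le> C * norm v ^ 2"
    unfolding e_def using pp_log_expansion_at_1[OF assms] by blast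
  show ?thesis
  proof
    show "53 * C > 0" using C by simp
    fix x w :: complex assume x: "norm x \<le> r" and w: "w \<in> cone A"
    then have x_less: "norm x < 1" and w_nz: "w \<noteq> 0" "Re w > 0" using assms by (auto simp: cone_def)
    have x_sq: "norm (x\<^sup>2) \<le> r" using x norm_power_Suc_le[of x 1] x_less by (simp add: power2_eq_square)
    have e_le: "norm (e y (of_real c * w)) \<le> C * (c\<^sup>2 * norm w ^ 2)" if "norm y \<le> r" "c > 0" for y c
      using C(2)[OF that(1) cone_scale[OF w that(2)]] by (simp add: norm_mult power_mult_distrib)
    have powers: "exp (- (2 * w)) = (exp (- w))\<^sup>2" "exp (- (4 * w)) = (exp (- w)) ^ 4"
      using exp_of_nat_mult[of 2 "- w"] exp_of_nat_mult[of 4 "- w"] by simp_all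
    have "pp_log x (- exp (- w)) - (Li3 (x\<^sup>2) / (8 * w\<^sup>2) + (Ln (1 - x\<^sup>2) / 24 + Ln ((1 - x) / (1 + x)) / 8)) =
       e (x\<^sup>2) (of_real 2 * w) - 2 * e (x\<^sup>2) (of_real 4 * w) + 4 * e x (of_real 2 * w) - e x (of_real 1 * w)"
      using w_nz pp_log_minus[OF x_less, of "exp (- w)"] unfolding e_def Ln_one_minus_square[OF x_less]
      by (simp add: powers power_mult_distrib) (simp add: field_simps)
    also have "norm \<dots> \<le> norm (e (x\<^sup>2) (of_real 2 * w)) + 2 * norm (e (x\<^sup>2) (of_real 4 * w)) +
        4 * norm (e x (of_real 2 * w)) + norm (e x (of_real 1 * w))"
      by (intro order_trans[OF norm_triangle_ineq4] add_mono order_trans[OF norm_triangle_ineq] order_refl)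
         (simp_all add: norm_mult)
    also have "\<dots> \<le> 53 * C * norm w ^ 2"
      using e_le[OF x_sq, of 2] e_le[OF x_sq, of 4] e_le[OF x, of 2] e_le[OF x, of 1] by simp
    finally show "norm (pp_log x (- exp (- w)) - (Li3 (x\<^sup>2) / (8 * w\<^sup>2) + (Ln (1 - x\<^sup>2) / 24 + Ln ((1 - x) / (1 + x)) / 8)))
        \<le> 53 * C * norm w ^ 2" .
  qed
qed

text \<open>The index \<open>k\<close> is the order of the root of unity: \<open>k = 1\<close> stands for \<open>u = 1\<close> and \<open>k = 2\<close> for \<open>u = -1\<close>.\<close>

definition pp_const :: "nat \<Rightarrow> complex \<Rightarrow> complex" where
  "pp_const k x = (if k = 1 then Ln (1 - x) / 12 else Ln (1 - x\<^sup>2) / 24 + Ln ((1 - x) / (1 + x)) / 8)"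

definition pp_log_error :: "nat \<Rightarrow> complex \<Rightarrow> complex \<Rightarrow> complex" where
  "pp_log_error k x w = pp_log x ((-1) ^ Suc k * exp (- w)) - (L_phase k x ^ 3 / (2 * w\<^sup>2) + pp_const k x)"

lemma pp_log_error_eq:
  assumes "0 < norm x" "norm x < 1"
  shows "pp_log_error 1 x w = pp_log x (exp (- w)) - (Li3 x / w\<^sup>2 + Ln (1 - x) / 12)"
    and "pp_log_error 2 x w =
      pp_log x (- exp (- w)) - (Li3 (x\<^sup>2) / (8 * w\<^sup>2) + (Ln (1 - x\<^sup>2) / 24 + Ln ((1 - x) / (1 + x)) / 8))"
proof -
  have "L_phase 1 x ^ 3 / (2 * w\<^sup>2) = Li3 x / w\<^sup>2" "L_phase 2 x ^ 3 / (2 * w\<^sup>2) = Li3 (x\<^sup>2) / (8 * w\<^sup>2)"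
    using assms by (subst L_phase_cube, auto)+
  then show "pp_log_error 1 x w = pp_log x (exp (- w)) - (Li3 x / w\<^sup>2 + Ln (1 - x) / 12)"
    "pp_log_error 2 x w =
      pp_log x (- exp (- w)) - (Li3 (x\<^sup>2) / (8 * w\<^sup>2) + (Ln (1 - x\<^sup>2) / 24 + Ln ((1 - x) / (1 + x)) / 8))"
    unfolding pp_log_error_def by (simp_all add: pp_const_def)
qed

lemma norm_pp_log_error_le:
  assumes "A \<ge> 0" "0 \<le> r" "r < 1"
  obtains C where "C > 0" "\<And>k x w. k \<in> {1, 2} \<Longrightarrow> 0 < norm x \<Longrightarrow> norm x \<le> r \<Longrightarrow> w \<in> cone A \<Longrightarrow>
    norm (pp_log_error k x w) \<le> C * norm w ^ 2"
proof -
  obtain C1 where C1: "C1 > 0" "\<And>x w :: complex. norm x \<le> r \<Longrightarrow> w \<in> cone A \<Longrightarrow>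
      norm (pp_log x (exp (- w)) - (Li3 x / w\<^sup>2 + Ln (1 - x) / 12)) \<le> C1 * norm w ^ 2"
    using pp_log_expansion_at_1[OF assms] by blast
  obtain C2 where C2: "C2 > 0" "\<And>x w :: complex. norm x \<le> r \<Longrightarrow> w \<in> cone A \<Longrightarrow>
      norm (pp_log x (- exp (- w)) - (Li3 (x\<^sup>2) / (8 * w\<^sup>2) + (Ln (1 - x\<^sup>2) / 24 + Ln ((1 - x) / (1 + x)) / 8))) \<le> C2 * norm w ^ 2"
    using pp_log_expansion_at_minus_1[OF assms] by blast
  have "norm (pp_log_error k x w) \<le> max C1 C2 * norm w ^ 2"
    if k: "k \<in> {1, 2}" and x: "0 < norm x" "norm x \<le> r" and w: "w \<in> cone A" for k x w
  proof -
    have "norm x < 1" using x assms by simp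
    then have "norm (pp_log_error 1 x w) \<le> C1 * norm w ^ 2" "norm (pp_log_error 2 x w) \<le> C2 * norm w ^ 2"
      using C1(2)[OF x(2) w] C2(2)[OF x(2) w] x(1) by (simp_all only: pp_log_error_eq)
    moreover have "C1 * norm w ^ 2 \<le> max C1 C2 * norm w ^ 2" "C2 * norm w ^ 2 \<le> max C1 C2 * norm w ^ 2"
      by (auto intro: mult_right_mono)
    ultimately show ?thesis using k by (auto elim: order_trans simp del: One_nat_def)
  qed
  then show ?thesis using that[of "max C1 C2"] C1(1) by simp
qed

section \<open>The minor arcs\<close>

lemma sinh_ge_self: fixes x :: real assumes "x \<ge> 0" shows "x \<le> sinh x"
proof -
  have "sinh 0 - 0 \<le> sinh x - x"
    by (rule DERIV_nonneg_imp_nondecreasing[OF assms])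
       (auto intro!: exI derivative_eq_intros simp: cosh_real_ge_1)
  then show ?thesis by simp
qed

lemma norm_exp_plus_exp_minus_minus_2:
  "norm (exp z + exp (- z) - 2) = 4 * (sinh (Re z / 2))\<^sup>2 + 4 * (sin (Im z / 2))\<^sup>2"
proof -
  have "Re (exp (z / 2) - exp (- z / 2)) = 2 * sinh (Re z / 2) * cos (Im z / 2)"
    by (simp add: Re_exp sinh_def algebra_simps)
  moreover have "Im (exp (z / 2) - exp (- z / 2)) = 2 * cosh (Re z / 2) * sin (Im z / 2)"
    by (simp add: Im_exp cosh_def algebra_simps)
  ultimately have "norm (exp (z / 2) - exp (- z / 2)) ^ 2 = 4 * (sinh (Re z / 2))\<^sup>2 + 4 * (sin (Im z / 2))\<^sup>2"
    unfolding cmod_power2 by (simp add: power_mult_distrib cosh_square_eq cos_squared_eq algebra_simps)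
  moreover have "exp z + exp (- z) - 2 = (exp (z / 2) - exp (- z / 2))\<^sup>2"
    by (simp add: power2_eq_square algebra_simps exp_add[symmetric])
  ultimately show ?thesis by (simp add: norm_power)
qed

lemma norm_koebe_exp_minus_le:
  assumes "Re z > 0"
  shows "norm (koebe (exp (- z))) \<le> 1 / ((Re z)\<^sup>2 + 4 * (sin (Im z / 2))\<^sup>2)"
proof -
  have "Re z \<le> 2 * sinh (Re z / 2)" using sinh_ge_self[of "Re z / 2"] assms by simp
  then have "(Re z)\<^sup>2 \<le> (2 * sinh (Re z / 2))\<^sup>2" using assms by (intro power_mono) auto
  then show ?thesis
    unfolding koebe_exp_minus norm_divide norm_exp_plus_exp_minus_minus_2 using assms
    by (intro frac_le) (auto intro: add_pos_nonneg simp: power_mult_distrib)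
qed

lemma norm_pp_log_term_exp_le:
  fixes x :: complex
  assumes "norm x \<le> 1" "\<sigma> > 0" and a: "0 < a" "a \<le> (real (Suc k) * \<sigma>)\<^sup>2 + 4 * (sin (real (Suc k) * \<theta> / 2))\<^sup>2"
  shows "norm (x ^ Suc k / of_nat (Suc k) * koebe (exp (- Complex \<sigma> \<theta>) ^ Suc k)) \<le> norm x / real (Suc k) * (1 / a)"
proof -
  let ?z = "of_nat (Suc k) * Complex \<sigma> \<theta>"
  have power: "exp (- Complex \<sigma> \<theta>) ^ Suc k = exp (- ?z)"
    by (subst exp_of_nat_mult[symmetric]) simp
  have z: "Re ?z = real (Suc k) * \<sigma>" "Im ?z = real (Suc k) * \<theta>" by (simp_all del: of_nat_Suc)
  have "norm (koebe (exp (- ?z))) \<le> 1 / ((real (Suc k) * \<sigma>)\<^sup>2 + 4 * (sin (real (Suc k) * \<theta> / 2))\<^sup>2)"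
    using norm_koebe_exp_minus_le[of ?z] assms(2) unfolding z by (simp del: of_nat_Suc)
  also have "\<dots> \<le> 1 / a" using a by (intro divide_left_mono mult_pos_pos) auto
  finally have "norm (koebe (exp (- ?z))) \<le> 1 / a" .
  moreover have "norm (x ^ Suc k / of_nat (Suc k)) \<le> norm x / real (Suc k)"
    using norm_power_Suc_le[OF assms(1), of k] by (simp only: norm_divide norm_of_nat divide_right_mono of_nat_0_le_iff)
  ultimately show ?thesis unfolding power norm_mult by (intro mult_mono) auto
qed

lemma abs_sin_le_double_abs_sin_half: "\<bar>sin \<theta>\<bar> \<le> 2 * \<bar>sin (\<theta> / 2)\<bar>" for \<theta> :: real
  using sin_double[of "\<theta> / 2"] mult_left_mono[OF abs_cos_le_one, of "\<bar>sin (\<theta> / 2)\<bar>" "\<theta> / 2"]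
  by (simp add: abs_mult)

text \<open>The terms \<open>k = 1\<close> and \<open>k = 2\<close> of the series are at most \<open>|x|/\<sigma>\<^sup>2\<close> times \<open>1/(1 + 12\<^sup>2) = 1/145\<close> and
  \<open>1/(2(2\<^sup>2 + 4\<cdot>12\<^sup>2)) = 1/1160\<close>, the others at most \<open>1/k\<^sup>3\<close>.\<close>

lemma norm_pp_log_minor_arc:
  fixes x :: complex
  assumes x: "norm x < 1" and \<sigma>: "\<sigma> > 0" and \<theta>: "\<bar>sin \<theta>\<bar> \<ge> 12 * \<sigma>"
  shows "norm (pp_log x (exp (- Complex \<sigma> \<theta>))) \<le> 35 / 384 * norm x / \<sigma>\<^sup>2"
proof -
  let ?t = "\<lambda>k. x ^ Suc k / of_nat (Suc k) * koebe (exp (- Complex \<sigma> \<theta>) ^ Suc k)"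
  have summable: "summable (\<lambda>k. norm (?t k))" using x \<sigma> by (intro summable_norm_pp_log) auto
  have sin_sq: "144 * \<sigma>\<^sup>2 \<le> (sin \<theta>)\<^sup>2"
    using power_mono[OF \<theta>, of 2] \<sigma> by (simp add: power_mult_distrib)
  also have "\<dots> \<le> 4 * (sin (\<theta> / 2))\<^sup>2"
    using power_mono[OF abs_sin_le_double_abs_sin_half[of \<theta>], of 2] by (simp add: power_mult_distrib)
  finally have first: "norm (?t 0) \<le> norm x / real (Suc 0) * (1 / (145 * \<sigma>\<^sup>2))"
    using x \<sigma> by (intro norm_pp_log_term_exp_le) auto
  have second: "norm (?t 1) \<le> norm x / real (Suc 1) * (1 / (580 * \<sigma>\<^sup>2))"
    using x \<sigma> sin_sq by (intro norm_pp_log_term_exp_le) (auto simp: power_mult_distrib)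
  have rest: "norm (?t (k + 2)) \<le> norm x / \<sigma>\<^sup>2 * (1 / real (k + 3) ^ 3)" for k
  proof -
    have "norm (?t (k + 2)) \<le> norm x / real (Suc (k + 2)) * (1 / (real (Suc (k + 2)) * \<sigma>)\<^sup>2)"
      using x \<sigma> by (intro norm_pp_log_term_exp_le) auto
    then show ?thesis by (simp add: power_mult_distrib power2_eq_square power3_eq_cube field_simps)
  qed
  have "pp_log x (exp (- Complex \<sigma> \<theta>)) = (\<Sum>k. ?t (k + 2)) + (\<Sum>k<2. ?t k)"
    unfolding pp_log_def by (rule suminf_split_initial_segment[OF summable_norm_cancel[OF summable]])
  also have "\<dots> = (\<Sum>k. ?t (k + 2)) + (?t 0 + ?t 1)" by (simp add: numeral_2_eq_2)
  also have "norm \<dots> \<le> norm x / \<sigma>\<^sup>2 * (1 / 12) + (norm x / \<sigma>\<^sup>2 * (1 / 145) + norm x / \<sigma>\<^sup>2 * (1 / 1160))"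
  proof (intro norm_triangle_mono)
    have "norm (\<Sum>k. ?t (k + 2)) \<le> (\<Sum>k. norm x / \<sigma>\<^sup>2 * (1 / real (k + 3) ^ 3))"
      by (rule norm_suminf_le[OF rest summable_mult[OF summable_inverse_cubes_from_3]])
    also have "\<dots> = norm x / \<sigma>\<^sup>2 * (\<Sum>k. 1 / real (k + 3) ^ 3)"
      by (rule suminf_mult[OF summable_inverse_cubes_from_3])
    also have "\<dots> \<le> norm x / \<sigma>\<^sup>2 * (1 / 12)"
      by (intro mult_left_mono suminf_inverse_cubes_from_3_le) auto
    finally show "norm (\<Sum>k. ?t (k + 2)) \<le> norm x / \<sigma>\<^sup>2 * (1 / 12)" .
  qed (use first second in simp_all)
  also have "\<dots> \<le> norm x / \<sigma>\<^sup>2 * (35 / 384)"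
    unfolding distrib_left[symmetric] by (intro mult_left_mono) auto
  finally show ?thesis by simp
qed

lemma sin_ge_half: fixes d :: real assumes d: "0 \<le> d" "d \<le> 1" shows "d / 2 \<le> sin d"
proof -
  have "sin 0 - 0 / 2 \<le> sin d - d / 2"
  proof (rule DERIV_nonneg_imp_nondecreasing[OF d(1)])
    fix y assume y: "0 \<le> y" "y \<le> d"
    have "cos (pi / 3) \<le> cos y" using y d pi_gt3 by (intro cos_monotone_0_pi_le) auto
    then have "cos y - 1 / 2 \<ge> 0" by (simp add: cos_60)
    moreover have "((\<lambda>y. sin y - y / 2) has_real_derivative cos y - 1 / 2) (at y)"
      by (auto intro!: derivative_eq_intros)
    ultimately show "\<exists>D. ((\<lambda>y. sin y - y / 2) has_real_derivative D) (at y) \<and> 0 \<le> D" by blast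
  qed
  then show ?thesis by simp
qed

lemma abs_sin_ge_off_major_arcs:
  assumes d: "0 \<le> d" "d \<le> 1"
    and \<theta>: "\<theta> \<in> {-pi/2..-d} \<union> {d..pi - d} \<union> {pi + d..3*pi/2}"
  shows "d / 2 \<le> \<bar>sin \<theta>\<bar>"
proof -
  have sin_ge: "d / 2 \<le> sin y" if "d \<le> y" "y \<le> pi / 2" for y
    using sin_ge_half[OF d] sin_monotone_2pi_le[of d y] that d pi_gt3 by linarith
  consider (fourth) "d \<le> - \<theta>" "- \<theta> \<le> pi / 2" | (first) "d \<le> \<theta>" "\<theta> \<le> pi / 2"
    | (second) "d \<le> pi - \<theta>" "pi - \<theta> \<le> pi / 2" | (third) "d \<le> \<theta> - pi" "\<theta> - pi \<le> pi / 2"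
    using \<theta> by fastforce
  then show ?thesis
  proof cases
    case fourth then show ?thesis using sin_ge[of "- \<theta>"] by simp
  next
    case first then show ?thesis using sin_ge[of \<theta>] by simp
  next
    case second then show ?thesis using sin_ge[of "pi - \<theta>"] by simp
  next
    case third then show ?thesis using sin_ge[of "\<theta> - pi"] by (simp add: sin_diff)
  qed
qed

section \<open>Complex Gaussian integrals\<close>

lemma gauss_primitive:
  obtains F :: "complex \<Rightarrow> complex"
  where "\<And>z. (F has_field_derivative exp (- z\<^sup>2)) (at z)" "\<And>z. F (- z) = - F z"
proof -
  have "(\<lambda>z::complex. exp (- z\<^sup>2)) holomorphic_on UNIV" by (intro holomorphic_intros)
  then obtain G :: "complex \<Rightarrow> complex" where G: "(G has_field_derivative exp (- z\<^sup>2)) (at z)" for z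
    using holomorphic_convex_primitive'[OF convex_UNIV open_UNIV] by auto
  have "((\<lambda>z. (G z - G (- z)) / 2) has_field_derivative exp (- z\<^sup>2)) (at z)" for z
    by (auto intro!: derivative_eq_intros DERIV_chain2[OF G] G)
  then show ?thesis by (rule that) (simp add: field_simps)
qed

lemma gauss_integral_at_top:
  "((\<lambda>y. integral {0..y} (\<lambda>t. exp (- t\<^sup>2))) \<longlongrightarrow> sqrt pi / 2) at_top"
proof -
  let ?f = "\<lambda>x. indicator {0..} x *\<^sub>R exp (- x\<^sup>2) :: real"
  have f: "integrable lborel ?f" "integral\<^sup>L lborel ?f = sqrt pi / 2"
    using gaussian_moment_0 unfolding has_bochner_integral_iff by blast+
  have "((\<lambda>y. \<integral>x. indicator {..y} x *\<^sub>R ?f x \<partial>lborel) \<longlongrightarrow> sqrt pi / 2) at_top"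
    unfolding f(2)[symmetric] by (rule tendsto_integral_at_top[OF sets_lborel f(1)])
  moreover have "(\<integral>x. indicator {..y} x *\<^sub>R ?f x \<partial>lborel) = integral {0..y} (\<lambda>t. exp (- t\<^sup>2))" for y
  proof -
    have "(\<integral>x. indicator {..y} x *\<^sub>R ?f x \<partial>lborel) = (LINT x:{0..y}|lborel. exp (- x\<^sup>2))"
      unfolding set_lebesgue_integral_def by (intro Bochner_Integration.integral_cong) (auto simp: indicator_def)
    also have "\<dots> = integral {0..y} (\<lambda>t. exp (- t\<^sup>2))"
      by (intro set_borel_integral_eq_integral borel_integrable_atLeastAtMost') (intro continuous_intros)
    finally show ?thesis .
  qed
  ultimately show ?thesis by simp
qed

lemma exp_minus_le_inverse: fixes y :: real assumes "y > 0" shows "exp (- y) \<le> 1 / y"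
proof -
  have "y \<le> exp y" using exp_ge_add_one_self[of y] by linarith
  then show ?thesis using assms by (simp add: exp_minus field_simps)
qed

lemma gauss_integral_tail:
  assumes "R > 0" shows "\<bar>integral {0..R} (\<lambda>t. exp (- t\<^sup>2)) - sqrt pi / 2\<bar> \<le> 1 / R"
proof -
  let ?\<phi> = "\<lambda>y. integral {0..y} (\<lambda>t. exp (- t\<^sup>2)) :: real"
  have integrable: "(\<lambda>t. exp (- t\<^sup>2) :: real) integrable_on {a..b}" for a b
    by (intro integrable_continuous_real continuous_intros)
  have tail: "\<bar>?\<phi> S - ?\<phi> R\<bar> \<le> 1 / R" if "S \<ge> R" for S
  proof -
    have split: "?\<phi> S - ?\<phi> R = integral {R..S} (\<lambda>t. exp (- t\<^sup>2))"
      using Henstock_Kurzweil_Integration.integral_combine[OF _ that integrable, of 0] assms by simp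
    have "((\<lambda>t. 1 / t\<^sup>2) has_integral (- 1 / S - (- 1 / R))) {R..S}"
      using that assms
      by (intro fundamental_theorem_of_calculus)
         (auto intro!: derivative_eq_intros simp: has_real_derivative_iff_has_vector_derivative[symmetric] power2_eq_square)
    moreover have "exp (- t\<^sup>2) \<le> 1 / t\<^sup>2" if "t \<in> {R..S}" for t
      using that assms by (intro exp_minus_le_inverse) auto
    ultimately have "integral {R..S} (\<lambda>t. exp (- t\<^sup>2)) \<le> - 1 / S - (- 1 / R)"
      by (rule has_integral_le[OF integrable_integral[OF integrable]])
    moreover have "integral {R..S} (\<lambda>t. exp (- t\<^sup>2) :: real) \<ge> 0" by (intro integral_nonneg integrable) auto
    moreover have "1 / S \<ge> 0" using that assms by simp
    ultimately show ?thesis using split unfolding abs_le_iff by linarith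
  qed
  have "\<bar>sqrt pi / 2 - ?\<phi> R\<bar> \<le> 1 / R"
  proof (rule tendsto_upperbound[where F = at_top])
    show "((\<lambda>S. \<bar>?\<phi> S - ?\<phi> R\<bar>) \<longlongrightarrow> \<bar>sqrt pi / 2 - ?\<phi> R\<bar>) at_top"
      by (intro tendsto_intros gauss_integral_at_top)
    show "eventually (\<lambda>S. \<bar>?\<phi> S - ?\<phi> R\<bar> \<le> 1 / R) at_top"
      using tail by (auto intro: eventually_at_top_linorderI)
  qed simp
  then show ?thesis by (simp add: abs_minus_commute)
qed

lemma gauss_primitive_of_real:
  fixes F :: "complex \<Rightarrow> complex"
  assumes F: "\<And>z. (F has_field_derivative exp (- z\<^sup>2)) (at z)" "F 0 = 0" and R: "R \<ge> 0"
  shows "F (of_real R) = of_real (integral {0..R} (\<lambda>t. exp (- t\<^sup>2)))"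
proof -
  have "((\<lambda>t. exp (- (complex_of_real t)\<^sup>2)) has_integral F (of_real R) - F (of_real 0)) {0..R}"
    using R by (intro fundamental_theorem_of_calculus has_vector_derivative_real_field F) auto
  moreover have "((\<lambda>t. complex_of_real (exp (- t\<^sup>2))) has_integral of_real (integral {0..R} (\<lambda>t. exp (- t\<^sup>2)))) {0..R}"
    by (intro has_integral_of_real integrable_integral integrable_continuous_real continuous_intros)
  ultimately show ?thesis
    using F(2) by (simp add: exp_of_real[symmetric] has_integral_unique)
qed

lemma gauss_primitive_limit:
  fixes F :: "complex \<Rightarrow> complex"
  assumes F: "\<And>z. (F has_field_derivative exp (- z\<^sup>2)) (at z)" "F 0 = 0"
    and z: "Re z > 0" "Re (z\<^sup>2) > 0"
  shows "norm (F z - complex_of_real (sqrt pi / 2)) \<le> norm z / Re (z\<^sup>2) + 1 / Re z"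
proof -
  let ?R = "Re z"
  have "norm (F z - F (of_real ?R)) \<le> exp (- Re (z\<^sup>2)) * norm (z - of_real ?R)"
  proof (rule field_differentiable_bound[where S = "closed_segment (of_real ?R) z" and f' = "\<lambda>z. exp (- z\<^sup>2)"])
    show "(F has_field_derivative exp (- y\<^sup>2)) (at y within closed_segment (of_real ?R) z)" for y
      using F(1) by (rule DERIV_subset) simp
    fix y assume "y \<in> closed_segment (of_real ?R) z"
    then have y: "Re y = Re z" "Im y \<in> closed_segment 0 (Im z)" by (auto simp: closed_segment_same_Re)
    then have "\<bar>Im y\<bar> \<le> \<bar>Im z\<bar>" by (auto simp: closed_segment_eq_real_ivl split: if_splits)
    then have "(Im y)\<^sup>2 \<le> (Im z)\<^sup>2" by (simp add: abs_le_square_iff)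
    then show "norm (exp (- y\<^sup>2)) \<le> exp (- Re (z\<^sup>2))" using y by (simp add: power2_eq_square)
  qed auto
  also have "norm (z - of_real ?R) \<le> norm z" using abs_Im_le_cmod[of z] by (simp add: cmod_eq_Im)
  also have "exp (- Re (z\<^sup>2)) \<le> 1 / Re (z\<^sup>2)" by (rule exp_minus_le_inverse[OF z(2)])
  finally have vertical: "norm (F z - F (of_real ?R)) \<le> norm z / Re (z\<^sup>2)" using z by (simp add: mult_right_mono)
  have "norm (F (of_real ?R) - complex_of_real (sqrt pi / 2)) \<le> 1 / ?R"
    using gauss_integral_tail[OF z(1)] gauss_primitive_of_real[OF F, of ?R] z(1)
    by (simp only: of_real_diff[symmetric] norm_of_real less_imp_le)
  then show ?thesis
    using norm_triangle_mono[OF vertical, of "F (of_real ?R) - complex_of_real (sqrt pi / 2)" "1 / ?R"] by simp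
qed

lemma gauss_primitive_limit_scaled:
  fixes F :: "complex \<Rightarrow> complex"
  assumes F: "\<And>z. (F has_field_derivative exp (- z\<^sup>2)) (at z)" "F 0 = 0"
    and \<kappa>: "Re \<kappa> > 0" "Re (\<kappa>\<^sup>2) > 0" and s: "0 < s" "s \<le> S"
  shows "norm (F (\<kappa> * of_real S) - complex_of_real (sqrt pi / 2)) \<le> 2 * norm \<kappa> / (s * Re (\<kappa>\<^sup>2))"
proof -
  have S: "S > 0" using s by linarith
  have Re_sq: "Re ((\<kappa> * of_real S)\<^sup>2) = S\<^sup>2 * Re (\<kappa>\<^sup>2)"
    by (simp add: power2_eq_square algebra_simps)
  have "Re (\<kappa>\<^sup>2) \<le> Re \<kappa> * Re \<kappa>" by (simp add: power2_eq_square)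
  also have "\<dots> \<le> norm \<kappa> * Re \<kappa>" using \<kappa> complex_Re_le_cmod by (intro mult_right_mono) auto
  finally have inverse_Re: "1 / Re \<kappa> \<le> norm \<kappa> / Re (\<kappa>\<^sup>2)" using \<kappa> by (simp add: field_simps)
  have "norm (F (\<kappa> * of_real S) - complex_of_real (sqrt pi / 2)) \<le>
      norm (\<kappa> * of_real S) / Re ((\<kappa> * of_real S)\<^sup>2) + 1 / Re (\<kappa> * of_real S)"
    using \<kappa> S by (intro gauss_primitive_limit F) (auto simp: Re_sq simp del: power2_eq_square)
  also have "\<dots> = (1 / S) * (norm \<kappa> / Re (\<kappa>\<^sup>2) + 1 / Re \<kappa>)"
    unfolding Re_sq using S \<kappa> by (simp add: norm_mult power2_eq_square[of S] field_simps)
  also have "\<dots> \<le> (1 / s) * (norm \<kappa> / Re (\<kappa>\<^sup>2) + norm \<kappa> / Re (\<kappa>\<^sup>2))"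
    using inverse_Re \<kappa> s by (intro mult_mono add_mono) (auto simp: frac_le)
  finally show ?thesis by (simp add: field_simps)
qed

lemma complex_gaussian_integral:
  fixes \<kappa> :: complex
  assumes \<kappa>: "Re \<kappa> > 0" "Re (\<kappa>\<^sup>2) > 0" and s: "s > 0" "p \<le> \<tau> - s" "\<tau> + s \<le> q"
  shows "norm (integral {p..q} (\<lambda>t. exp (- \<kappa>\<^sup>2 * (of_real (t - \<tau>))\<^sup>2)) - complex_of_real (sqrt pi) / \<kappa>) \<le> 4 / (s * Re (\<kappa>\<^sup>2))"
proof -
  obtain F :: "complex \<Rightarrow> complex" where F: "\<And>z. (F has_field_derivative exp (- z\<^sup>2)) (at z)" "\<And>z. F (- z) = - F z"
    using gauss_primitive by blast
  have F_0: "F 0 = 0" using F(2)[of 0] by simp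
  have \<kappa>_nonzero: "\<kappa> \<noteq> 0" using \<kappa> by auto
  let ?d = "\<lambda>S. F (\<kappa> * of_real S) - complex_of_real (sqrt pi / 2)"
  have "((\<lambda>t. exp (- \<kappa>\<^sup>2 * (of_real (t - \<tau>))\<^sup>2)) has_integral
      F (\<kappa> * (of_real q - of_real \<tau>)) / \<kappa> - F (\<kappa> * (of_real p - of_real \<tau>)) / \<kappa>) {p..q}"
  proof (rule fundamental_theorem_of_calculus)
    show "((\<lambda>t. F (\<kappa> * (of_real t - of_real \<tau>)) / \<kappa>) has_vector_derivative exp (- \<kappa>\<^sup>2 * (of_real (t - \<tau>))\<^sup>2)) (at t within {p..q})" for t
    proof (rule has_vector_derivative_real_field)
      show "((\<lambda>z. F (\<kappa> * (z - of_real \<tau>)) / \<kappa>) has_field_derivative exp (- \<kappa>\<^sup>2 * (of_real (t - \<tau>))\<^sup>2)) (at (of_real t))"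
        using \<kappa>_nonzero by (auto intro!: derivative_eq_intros DERIV_chain2[OF F(1)] simp: power_mult_distrib)
    qed
  qed (use s in auto)
  then have "integral {p..q} (\<lambda>t. exp (- \<kappa>\<^sup>2 * (of_real (t - \<tau>))\<^sup>2)) =
     F (\<kappa> * (of_real q - of_real \<tau>)) / \<kappa> - F (\<kappa> * (of_real p - of_real \<tau>)) / \<kappa>" by (rule integral_unique)
  moreover have "F (\<kappa> * (of_real p - of_real \<tau>)) = - F (\<kappa> * of_real (\<tau> - p))"
    using F(2)[of "\<kappa> * of_real (\<tau> - p)"] by (simp add: algebra_simps)
  ultimately have "integral {p..q} (\<lambda>t. exp (- \<kappa>\<^sup>2 * (of_real (t - \<tau>))\<^sup>2)) - complex_of_real (sqrt pi) / \<kappa> =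
      (?d (q - \<tau>) + ?d (\<tau> - p)) / \<kappa>"
    using \<kappa>_nonzero by (simp add: field_simps)
  also have "norm \<dots> \<le> (2 * norm \<kappa> / (s * Re (\<kappa>\<^sup>2)) + 2 * norm \<kappa> / (s * Re (\<kappa>\<^sup>2))) / norm \<kappa>"
    unfolding norm_divide using s
    by (intro divide_right_mono norm_triangle_mono gauss_primitive_limit_scaled[OF F(1) F_0 \<kappa>]) auto
  also have "\<dots> = 4 / (s * Re (\<kappa>\<^sup>2))" using \<kappa>_nonzero by (simp add: field_simps)
  finally show ?thesis .
qed

section \<open>The saddle point integral\<close>

text \<open>The cofactor of \<open>(b - a)\<^sup>2\<close> in \<open>a\<^sup>3/(2 b\<^sup>2) + b - 3a/2\<close>, where \<open>a = 1 + i\<tau>\<close> is the saddle point and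
  \<open>b = 1 + it\<close>.\<close>

definition saddle_kern :: "real \<Rightarrow> real \<Rightarrow> complex" where
  "saddle_kern \<tau> t = (2 * Complex 1 t + Complex 1 \<tau>) / (2 * (Complex 1 t)\<^sup>2)"

lemma Complex_1_nonzero [simp]: "Complex 1 t \<noteq> 0"
  by (simp add: complex_eq_iff)

lemma norm_Complex_1_ge: "norm (Complex 1 t) \<ge> 1"
  using complex_Re_le_cmod[of "Complex 1 t"] by simp

lemma saddle_phase:
  "(Complex 1 \<tau>) ^ 3 / (2 * (Complex 1 t)\<^sup>2) + Complex 1 t =
     3 / 2 * Complex 1 \<tau> - of_real (t - \<tau>) ^ 2 * saddle_kern \<tau> t"
proof -
  let ?a = "Complex 1 \<tau>" and ?b = "Complex 1 t"
  have square: "of_real (t - \<tau>) ^ 2 = - (?b - ?a)\<^sup>2"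
    by (simp add: complex_eq_iff power2_eq_square)
  show ?thesis unfolding square saddle_kern_def
    by (simp add: field_simps) (simp add: algebra_simps eval_nat_numeral)
qed

lemma Re_saddle_kern:
  "Re (saddle_kern \<tau> t) = ((t + \<tau>)\<^sup>2 + 3 - \<tau>\<^sup>2) / (2 * (1 + t\<^sup>2)\<^sup>2)"
proof -
  have "Complex 1 t * Complex 1 (- t) = 1 + of_real t ^ 2" by (simp add: complex_eq_iff power2_eq_square)
  then have "(1 + of_real t ^ 2)\<^sup>2 = (Complex 1 t)\<^sup>2 * (Complex 1 (- t))\<^sup>2" by (metis power_mult_distrib)
  then have "saddle_kern \<tau> t = (2 * Complex 1 t + Complex 1 \<tau>) * (Complex 1 (- t))\<^sup>2 / (2 * (1 + of_real t ^ 2)\<^sup>2)"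
    by (simp add: saddle_kern_def)
  also have "2 * (1 + complex_of_real t ^ 2)\<^sup>2 = complex_of_real (2 * (1 + t\<^sup>2)\<^sup>2)" by simp
  finally show ?thesis
    by (simp only: Re_divide_of_real) (simp add: power2_eq_square algebra_simps)
qed

lemma Re_saddle_kern_ge:
  assumes "0 \<le> \<delta>" "\<delta> \<le> (t + \<tau>)\<^sup>2 + 3 - \<tau>\<^sup>2" "\<bar>t\<bar> \<le> T"
  shows "\<delta> / (2 * (1 + T\<^sup>2)\<^sup>2) \<le> Re (saddle_kern \<tau> t)"
proof -
  have "t\<^sup>2 \<le> T\<^sup>2" using power_mono[OF assms(3), of 2] by simp
  then have "(1 + t\<^sup>2)\<^sup>2 \<le> (1 + T\<^sup>2)\<^sup>2" by (intro power_mono) auto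
  moreover have "1 + t\<^sup>2 > 0" by (simp add: add_pos_nonneg)
  ultimately show ?thesis unfolding Re_saddle_kern using assms by (intro frac_le) auto
qed

lemma saddle_kern_self: "saddle_kern \<tau> \<tau> = 3 / (2 * Complex 1 \<tau>)"
  unfolding saddle_kern_def by (simp add: power2_eq_square field_simps)

lemma Re_saddle_kern_self: "Re (saddle_kern \<tau> \<tau>) = 3 / (2 * (1 + \<tau>\<^sup>2))"
proof -
  define P where "P = 1 + \<tau>\<^sup>2"
  have "P > 0" by (simp add: P_def add_pos_nonneg)
  moreover have "(\<tau> + \<tau>)\<^sup>2 + 3 - \<tau>\<^sup>2 = 3 * P" by (simp add: P_def power2_eq_square algebra_simps)
  ultimately show ?thesis unfolding Re_saddle_kern P_def[symmetric] by (simp add: power2_eq_square)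
qed

lemma norm_saddle_kern_diff_le: "norm (saddle_kern \<tau> t - saddle_kern \<tau> \<tau>) \<le> 2 * \<bar>t - \<tau>\<bar>"
proof -
  let ?a = "Complex 1 \<tau>" and ?b = "Complex 1 t"
  have "saddle_kern \<tau> t - saddle_kern \<tau> \<tau> = (?a - ?b) * (1 / (2 * ?b\<^sup>2) + 3 / (2 * ?a * ?b))"
    unfolding saddle_kern_def by (simp add: field_simps) (simp add: algebra_simps eval_nat_numeral)
  also have "norm \<dots> = \<bar>t - \<tau>\<bar> * norm (1 / (2 * ?b\<^sup>2) + 3 / (2 * ?a * ?b))"
    by (simp add: norm_mult cmod_eq_Im abs_minus_commute)
  also have "\<dots> \<le> \<bar>t - \<tau>\<bar> * (1 / 2 + 3 / 2)"
  proof (intro mult_left_mono norm_triangle_mono)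
    have "norm ?b ^ 2 \<ge> 1" using norm_Complex_1_ge by (intro one_le_power)
    then show "norm (1 / (2 * ?b\<^sup>2)) \<le> 1 / 2"
      unfolding norm_divide norm_mult norm_power by (intro frac_le) auto
    have "1 * 1 \<le> norm ?a * norm ?b" using norm_Complex_1_ge by (intro mult_mono) auto
    then show "norm (3 / (2 * ?a * ?b)) \<le> 3 / 2"
      unfolding norm_divide norm_mult by (intro frac_le) auto
  qed auto
  finally show ?thesis by simp
qed

lemma norm_exp_diff_le:
  fixes x y :: complex assumes "Re x \<le> M" "Re y \<le> M"
  shows "norm (exp x - exp y) \<le> exp M * norm (x - y)"
proof (rule field_differentiable_bound[where S = "{z. Re z \<le> M}" and f' = exp])
  show "convex {z. Re z \<le> M}" by (rule convex_halfspace_Re_le)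
qed (use assms in \<open>auto intro!: DERIV_subset[OF DERIV_exp]\<close>)

lemma cube_times_exp_minus_square_le:
  fixes y :: real assumes "y \<ge> 0" shows "y ^ 3 * exp (- y\<^sup>2) \<le> 4 / (1 + y\<^sup>2)"
proof -
  define v where "v = y\<^sup>2"
  have v: "v \<ge> 0" by (simp add: v_def)
  have "0 \<le> (y - y\<^sup>2)\<^sup>2" by simp
  then have "y ^ 3 \<le> (v + v\<^sup>2) / 2" by (simp add: v_def power2_eq_square algebra_simps eval_nat_numeral)
  then have "y ^ 3 * (1 + v) \<le> (v + v\<^sup>2) / 2 * (1 + v)" using v by (intro mult_right_mono) auto
  also have "\<dots> \<le> 4 * (1 + v / 2 + (v / 2)\<^sup>2 / 2)\<^sup>2"
  proof -
    have "4 * (1 + v / 2 + (v / 2)\<^sup>2 / 2)\<^sup>2 - (v + v\<^sup>2) / 2 * (1 + v) = 4 + 7 / 2 * v + v\<^sup>2 + v ^ 4 / 16"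
      by (simp add: power2_eq_square field_simps eval_nat_numeral)
    moreover have "\<dots> \<ge> 0" using v by simp
    ultimately show ?thesis by linarith
  qed
  also have "\<dots> \<le> 4 * (exp (v / 2))\<^sup>2"
    using v by (intro mult_left_mono power_mono exp_lower_Taylor_quadratic) auto
  also have "\<dots> = 4 * exp v" by (simp add: exp_double[symmetric])
  finally have "y ^ 3 * (1 + y\<^sup>2) \<le> 4 * exp (y\<^sup>2)" by (simp add: v_def)
  moreover have "1 + y\<^sup>2 > 0" by (simp add: add_pos_nonneg)
  ultimately show ?thesis by (simp add: exp_minus field_simps)
qed

lemma
  fixes \<mu> :: real assumes "\<mu> > 0" "p \<le> q"
  shows integrable_inverse_one_plus_square: "(\<lambda>t. 1 / (1 + (\<mu> * (t - \<tau>))\<^sup>2)) integrable_on {p..q}"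
    and integral_inverse_one_plus_square_le: "integral {p..q} (\<lambda>t. 1 / (1 + (\<mu> * (t - \<tau>))\<^sup>2)) \<le> pi / \<mu>"
proof -
  have "((\<lambda>t. 1 / (1 + (\<mu> * (t - \<tau>))\<^sup>2)) has_integral (arctan (\<mu> * (q - \<tau>)) / \<mu> - arctan (\<mu> * (p - \<tau>)) / \<mu>)) {p..q}"
    using assms
    by (intro fundamental_theorem_of_calculus)
       (auto intro!: derivative_eq_intros simp: has_real_derivative_iff_has_vector_derivative[symmetric] inverse_eq_divide)
  moreover have "arctan (\<mu> * (q - \<tau>)) / \<mu> - arctan (\<mu> * (p - \<tau>)) / \<mu> \<le> pi / \<mu>"
    unfolding diff_divide_distrib[symmetric]
    using assms arctan_bounded[of "\<mu> * (q - \<tau>)"] arctan_bounded[of "\<mu> * (p - \<tau>)"] by (intro divide_right_mono) auto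
  ultimately show "(\<lambda>t. 1 / (1 + (\<mu> * (t - \<tau>))\<^sup>2)) integrable_on {p..q}"
    "integral {p..q} (\<lambda>t. 1 / (1 + (\<mu> * (t - \<tau>))\<^sup>2)) \<le> pi / \<mu>"
    by (auto simp: integral_unique)
qed

lemma saddle_gauss_integral:
  assumes \<tau>: "\<bar>\<tau>\<bar> \<le> 2" and s: "s > 0" "p \<le> \<tau> - s" "\<tau> + s \<le> q" and \<nu>: "\<nu> > 0"
  shows "norm (integral {p..q} (\<lambda>t. exp (- of_real (\<nu> * (t - \<tau>)\<^sup>2) * saddle_kern \<tau> \<tau>))
     - csqrt (2 * of_real pi * Complex 1 \<tau> / 3) / of_real (sqrt \<nu>)) \<le> 14 / s / \<nu>"
proof -
  define y where "y = csqrt (2 * of_real pi * Complex 1 \<tau> / 3)"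
  have y_sq: "y\<^sup>2 = 2 * of_real pi * Complex 1 \<tau> / 3" by (simp add: y_def)
  have "y \<noteq> 0" by (simp add: y_def)
  have "(Re y)\<^sup>2 - (Im y)\<^sup>2 = Re (y\<^sup>2)" by (simp add: power2_eq_square)
  also have "\<dots> = 2 * pi / 3" unfolding y_sq by simp
  finally have "(Re y)\<^sup>2 > 0" using pi_gt_zero zero_le_power2[of "Im y"] by linarith
  then have Re_y: "Re y > 0" using Re_csqrt[of "2 * of_real pi * Complex 1 \<tau> / 3"] by (auto simp: y_def less_le)
  define \<kappa> where "\<kappa> = of_real (sqrt (\<nu> * pi)) / y"
  have "\<kappa>\<^sup>2 = of_real (\<nu> * pi) / y\<^sup>2" using \<nu> by (simp add: \<kappa>_def power_divide flip: of_real_power)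
  then have \<kappa>_sq: "\<kappa>\<^sup>2 = of_real \<nu> * saddle_kern \<tau> \<tau>" unfolding y_sq saddle_kern_self by (simp add: field_simps)
  have "Re \<kappa> = sqrt (\<nu> * pi) * Re (1 / y)" by (simp add: \<kappa>_def Re_divide)
  moreover have "Re (1 / y) > 0" unfolding Re_divide using Re_y by (auto intro!: divide_pos_pos add_pos_nonneg)
  ultimately have Re_\<kappa>: "Re \<kappa> > 0" using \<nu> by simp
  have "\<tau>\<^sup>2 \<le> 4" using power_mono[OF \<tau>, of 2] by simp
  then have "3 / 10 \<le> Re (saddle_kern \<tau> \<tau>)"
    unfolding Re_saddle_kern_self by (intro divide_left_mono mult_pos_pos) (auto simp: add_pos_nonneg)
  then have Re_\<kappa>_sq: "\<nu> * (3 / 10) \<le> Re (\<kappa>\<^sup>2)" unfolding \<kappa>_sq using \<nu> by simp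
  moreover have pos: "0 < \<nu> * (3 / 10)" using \<nu> by simp
  ultimately have "norm (integral {p..q} (\<lambda>t. exp (- \<kappa>\<^sup>2 * (of_real (t - \<tau>))\<^sup>2)) - complex_of_real (sqrt pi) / \<kappa>) \<le> 4 / (s * Re (\<kappa>\<^sup>2))"
    by (intro complex_gaussian_integral Re_\<kappa> s) linarith
  also have "\<dots> \<le> 4 / (s * (\<nu> * (3 / 10)))"
    using Re_\<kappa>_sq pos s by (intro divide_left_mono mult_left_mono mult_pos_pos) auto
  also have "\<dots> \<le> 14 / s / \<nu>" using s \<nu> by (simp add: field_simps)
  also have "complex_of_real (sqrt pi) / \<kappa> = y / of_real (sqrt \<nu>)"
    using \<nu> \<open>y \<noteq> 0\<close> by (simp add: \<kappa>_def real_sqrt_mult field_simps)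
  finally show ?thesis unfolding \<kappa>_sq y_def by (simp add: mult_ac)
qed

lemma saddle_integrand_diff_le:
  assumes c: "c > 0" "c \<le> Re (saddle_kern \<tau> t)" "c \<le> Re (saddle_kern \<tau> \<tau>)" and \<nu>: "\<nu> > 0"
  shows "norm (exp (- of_real (\<nu> * (t - \<tau>)\<^sup>2) * saddle_kern \<tau> t) - exp (- of_real (\<nu> * (t - \<tau>)\<^sup>2) * saddle_kern \<tau> \<tau>))
    \<le> 8 / (c * sqrt (c * \<nu>)) * (1 / (1 + (sqrt (c * \<nu>) * (t - \<tau>))\<^sup>2))"
proof -
  define v where "v = \<nu> * (t - \<tau>)\<^sup>2"
  define \<mu> where "\<mu> = sqrt (c * \<nu>)"
  have v: "v \<ge> 0" using \<nu> by (simp add: v_def)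
  have \<mu>: "\<mu> > 0" "\<mu>\<^sup>2 = c * \<nu>" using c \<nu> by (auto simp: \<mu>_def)
  let ?y = "\<mu> * \<bar>t - \<tau>\<bar>"
  have y_sq: "?y\<^sup>2 = c * v" by (simp add: power_mult_distrib \<mu> v_def)
  have "norm (exp (- of_real v * saddle_kern \<tau> t) - exp (- of_real v * saddle_kern \<tau> \<tau>)) \<le>
      exp (- (c * v)) * norm (- of_real v * saddle_kern \<tau> t - - of_real v * saddle_kern \<tau> \<tau>)"
    using c v by (intro norm_exp_diff_le) (auto simp: mult.commute[of c] mult_left_mono)
  also have "- of_real v * saddle_kern \<tau> t - - of_real v * saddle_kern \<tau> \<tau> = - of_real v * (saddle_kern \<tau> t - saddle_kern \<tau> \<tau>)"
    by (simp add: algebra_simps)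
  also have "exp (- (c * v)) * norm \<dots> \<le> exp (- (c * v)) * (v * (2 * \<bar>t - \<tau>\<bar>))"
    using v norm_saddle_kern_diff_le[of \<tau> t] by (simp add: norm_mult mult_left_mono)
  also have "\<dots> = 2 / (c * \<mu>) * (?y ^ 3 * exp (- ?y\<^sup>2))"
  proof -
    have "?y ^ 3 = c * v * ?y" unfolding y_sq[symmetric] by (simp add: power2_eq_square power3_eq_cube)
    then show ?thesis unfolding y_sq using c(1) \<mu>(1) by simp
  qed
  also have "\<dots> \<le> 2 / (c * \<mu>) * (4 / (1 + ?y\<^sup>2))"
    using c \<mu> by (intro mult_left_mono cube_times_exp_minus_square_le) auto
  finally show ?thesis by (simp add: v_def \<mu>_def power_mult_distrib)
qed

lemma continuous_on_saddle_kern: "continuous_on S (saddle_kern \<tau>)"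
  unfolding saddle_kern_def[abs_def] by (intro continuous_intros) auto

lemma saddle_integral_diff_le:
  assumes pq: "p \<le> \<tau>" "\<tau> \<le> q" and c: "c > 0" "\<And>t. t \<in> {p..q} \<Longrightarrow> c \<le> Re (saddle_kern \<tau> t)" and \<nu>: "\<nu> > 0"
  shows "norm (integral {p..q} (\<lambda>t. exp (- of_real (\<nu> * (t - \<tau>)\<^sup>2) * saddle_kern \<tau> t))
      - integral {p..q} (\<lambda>t. exp (- of_real (\<nu> * (t - \<tau>)\<^sup>2) * saddle_kern \<tau> \<tau>))) \<le> 8 * pi / c\<^sup>2 / \<nu>"
proof -
  let ?f = "\<lambda>t. exp (- of_real (\<nu> * (t - \<tau>)\<^sup>2) * saddle_kern \<tau> t)"
  let ?g = "\<lambda>t. exp (- of_real (\<nu> * (t - \<tau>)\<^sup>2) * saddle_kern \<tau> \<tau>)"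
  define \<mu> where "\<mu> = sqrt (c * \<nu>)"
  have \<mu>: "\<mu> > 0" "\<mu>\<^sup>2 = c * \<nu>" using c \<nu> by (auto simp: \<mu>_def)
  have integrable: "?f integrable_on {p..q}" "?g integrable_on {p..q}"
    by (intro integrable_continuous_real continuous_intros continuous_on_saddle_kern)+
  have "norm (integral {p..q} ?f - integral {p..q} ?g) = norm (integral {p..q} (\<lambda>t. ?f t - ?g t))"
    using integrable by (simp only: Henstock_Kurzweil_Integration.integral_diff)
  also have "\<dots> \<le> integral {p..q} (\<lambda>t. 8 / (c * \<mu>) * (1 / (1 + (\<mu> * (t - \<tau>))\<^sup>2)))"
  proof (rule integral_norm_bound_integral)
    show "(\<lambda>t. 8 / (c * \<mu>) * (1 / (1 + (\<mu> * (t - \<tau>))\<^sup>2))) integrable_on {p..q}"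
      using pq \<mu> by (intro integrable_on_mult_right integrable_inverse_one_plus_square) auto
    show "norm (?f t - ?g t) \<le> 8 / (c * \<mu>) * (1 / (1 + (\<mu> * (t - \<tau>))\<^sup>2))" if "t \<in> {p..q}" for t
      unfolding \<mu>_def using pq c that \<nu> by (intro saddle_integrand_diff_le) auto
  qed (use integrable in \<open>intro integrable_diff\<close>)
  also have "\<dots> = 8 / (c * \<mu>) * integral {p..q} (\<lambda>t. 1 / (1 + (\<mu> * (t - \<tau>))\<^sup>2))"
    by (rule integral_mult_right)
  also have "\<dots> \<le> 8 / (c * \<mu>) * (pi / \<mu>)"
    using c(1) \<mu>(1) by (intro mult_left_mono integral_inverse_one_plus_square_le order_trans[OF pq]) auto
  also have "\<dots> = 8 * pi / (c * \<mu>\<^sup>2)" by (simp add: power2_eq_square)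
  also have "\<dots> = 8 * pi / c\<^sup>2 / \<nu>" unfolding \<mu> by (simp add: power2_eq_square mult_ac)
  finally show ?thesis .
qed

lemma saddle_integral_perturbed:
  fixes \<phi> :: "real \<Rightarrow> complex"
  assumes \<tau>: "\<bar>\<tau>\<bar> \<le> 2" and s: "s > 0" "p \<le> \<tau> - s" "\<tau> + s \<le> q"
    and c: "c > 0" "\<And>t. t \<in> {p..q} \<Longrightarrow> c \<le> Re (saddle_kern \<tau> t)"
    and \<nu>: "\<nu> > 0" and \<phi>: "continuous_on {p..q} \<phi>" "\<And>t. t \<in> {p..q} \<Longrightarrow> norm (\<phi> t - 1) \<le> E / \<nu>"
  shows "norm (integral {p..q} (\<lambda>t. exp (- of_real (\<nu> * (t - \<tau>)\<^sup>2) * saddle_kern \<tau> t) * \<phi> t)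
     - csqrt (2 * of_real pi * Complex 1 \<tau> / 3) / of_real (sqrt \<nu>)) \<le> (E * (q - p) + 8 * pi / c\<^sup>2 + 14 / s) / \<nu>"
    (is "norm (?I - ?Y) \<le> _")
proof -
  let ?f = "\<lambda>t. exp (- of_real (\<nu> * (t - \<tau>)\<^sup>2) * saddle_kern \<tau> t)"
  let ?g = "\<lambda>t. exp (- of_real (\<nu> * (t - \<tau>)\<^sup>2) * saddle_kern \<tau> \<tau>)"
  have cont: "continuous_on {p..q} ?f" by (intro continuous_intros continuous_on_saddle_kern)
  have "norm (?f t * (\<phi> t - 1)) \<le> 1 * (E / \<nu>)" if "t \<in> {p..q}" for t
  proof -
    have "Re (saddle_kern \<tau> t) \<ge> 0" using c that by force
    then have "norm (?f t) \<le> 1" using \<nu> by (simp add: norm_exp_eq_Re)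
    then show ?thesis unfolding norm_mult using \<phi>(2)[OF that] by (intro mult_mono) auto
  qed
  then have "norm (integral {p..q} (\<lambda>t. ?f t * (\<phi> t - 1))) \<le> E / \<nu> * (q - p)"
    using s by (intro integral_bound continuous_intros cont \<phi>(1)) auto
  moreover have "norm (integral {p..q} ?f - integral {p..q} ?g) \<le> 8 * pi / c\<^sup>2 / \<nu>"
    using s c \<nu> by (intro saddle_integral_diff_le) auto
  moreover have "norm (integral {p..q} ?g - ?Y) \<le> 14 / s / \<nu>"
    by (rule saddle_gauss_integral[OF \<tau> s \<nu>])
  ultimately have "norm (integral {p..q} (\<lambda>t. ?f t * (\<phi> t - 1)) + (integral {p..q} ?f - integral {p..q} ?g) + (integral {p..q} ?g - ?Y))
      \<le> E / \<nu> * (q - p) + 8 * pi / c\<^sup>2 / \<nu> + 14 / s / \<nu>"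
    by (intro norm_triangle_mono)
  moreover have "integral {p..q} (\<lambda>t. ?f t * (\<phi> t - 1)) = ?I - integral {p..q} ?f"
    unfolding right_diff_distrib mult_1_right
    by (intro Henstock_Kurzweil_Integration.integral_diff integrable_continuous_real continuous_on_mult cont \<phi>(1))
  ultimately show ?thesis by (simp add: add_divide_distrib)
qed

lemma saddle_integral:
  fixes T :: "real \<Rightarrow> complex"
  assumes \<tau>: "\<bar>\<tau>\<bar> \<le> 2" and s: "s > 0" "p \<le> \<tau> - s" "\<tau> + s \<le> q"
    and c: "c > 0" "\<And>t. t \<in> {p..q} \<Longrightarrow> c \<le> Re (saddle_kern \<tau> t)"
    and \<nu>: "\<nu> > 0" "E \<le> \<nu>" and T: "continuous_on {p..q} T"
    "\<And>t. t \<in> {p..q} \<Longrightarrow> norm (T t - (of_real \<nu> * ((Complex 1 \<tau>) ^ 3 / (2 * (Complex 1 t)\<^sup>2)) + K)) \<le> E / \<nu>"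
  shows "norm (integral {p..q} (\<lambda>t. exp (T t + of_real \<nu> * Complex 1 t))
      - exp (K + 3 / 2 * of_real \<nu> * Complex 1 \<tau>) * (csqrt (2 * of_real pi * Complex 1 \<tau> / 3) / of_real (sqrt \<nu>)))
    \<le> norm (exp (K + 3 / 2 * of_real \<nu> * Complex 1 \<tau>)) * ((3 * E * (q - p) + 8 * pi / c\<^sup>2 + 14 / s) / \<nu>)"
    (is "norm (_ - ?m * ?Y) \<le> norm ?m * ?\<eta>")
proof -
  define d where "d t = T t - (of_real \<nu> * ((Complex 1 \<tau>) ^ 3 / (2 * (Complex 1 t)\<^sup>2)) + K)" for t
  let ?g = "\<lambda>t. exp (- of_real (\<nu> * (t - \<tau>)\<^sup>2) * saddle_kern \<tau> t) * exp (d t)"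
  have cont: "continuous_on {p..q} d"
    unfolding d_def[abs_def] by (intro continuous_intros T(1)) auto
  have d_small: "norm (exp (d t) - 1) \<le> (3 * E) / \<nu>" if "t \<in> {p..q}" for t
  proof -
    have d: "norm (d t) \<le> E / \<nu>" unfolding d_def by (rule T(2)[OF that])
    also have "\<dots> \<le> 1" using \<nu> by simp
    finally have "Re (d t) \<le> 1" using complex_Re_le_cmod[of "d t"] by linarith
    then have "norm (exp (d t) - exp 0) \<le> exp 1 * norm (d t - 0)" by (intro norm_exp_diff_le) auto
    also have "\<dots> \<le> 3 * (E / \<nu>)" using d exp_le by (intro mult_mono) auto
    finally show ?thesis by simp
  qed
  have "exp (T t + of_real \<nu> * Complex 1 t) = ?m * ?g t" for t
  proof -
    have "T t + of_real \<nu> * Complex 1 t = d t + K + of_real \<nu> * ((Complex 1 \<tau>) ^ 3 / (2 * (Complex 1 t)\<^sup>2) + Complex 1 t)"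
      by (simp add: d_def algebra_simps)
    also have "\<dots> = (K + 3 / 2 * of_real \<nu> * Complex 1 \<tau>) + (- of_real (\<nu> * (t - \<tau>)\<^sup>2) * saddle_kern \<tau> t + d t)"
      unfolding saddle_phase by (simp add: algebra_simps)
    finally show ?thesis by (simp only: exp_add)
  qed
  then have "integral {p..q} (\<lambda>t. exp (T t + of_real \<nu> * Complex 1 t)) - ?m * ?Y = ?m * (integral {p..q} ?g - ?Y)"
    by (simp add: integral_mult_right right_diff_distrib)
  moreover have "norm (integral {p..q} ?g - ?Y) \<le> ?\<eta>"
    by (intro saddle_integral_perturbed \<tau> s c \<nu> d_small continuous_on_exp cont)
  ultimately show ?thesis by (simp only: norm_mult mult_left_mono norm_ge_zero)
qed

subsection \<open>The contribution of a major arc\<close>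

definition saddle_abscissa :: "complex \<Rightarrow> nat \<Rightarrow> real" where
  "saddle_abscissa L n = Re L * real n powr (-1/3)"

definition saddle_scale :: "complex \<Rightarrow> nat \<Rightarrow> real" where
  "saddle_scale L n = Re L * real n powr (2/3)"

definition slope :: "complex \<Rightarrow> real" where
  "slope L = Im L / Re L"

definition saddle_main :: "complex \<Rightarrow> complex \<Rightarrow> nat \<Rightarrow> complex" where
  "saddle_main L K n = exp K * csqrt (L / of_real (6 * pi * real n powr (4/3))) * exp (3/2 * of_real (real n powr (2/3)) * L)"

lemma saddle_abscissa_scale:
  assumes "Re L > 0" "n > 0"
  shows saddle_abscissa_pos: "saddle_abscissa L n > 0" and saddle_scale_pos: "saddle_scale L n > 0"
    and saddle_abscissa_square_mult_scale: "(saddle_abscissa L n)\<^sup>2 * saddle_scale L n = Re L ^ 3"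
    and n_mult_saddle_abscissa: "real n * saddle_abscissa L n = saddle_scale L n"
proof -
  have n: "real n > 0" using assms by simp
  show "saddle_abscissa L n > 0" "saddle_scale L n > 0"
    using assms n by (auto simp: saddle_abscissa_def saddle_scale_def)
  have "real n powr (-1/3) * real n powr (-1/3) * real n powr (2/3) = 1" using n by (simp add: powr_add[symmetric])
  then show "(saddle_abscissa L n)\<^sup>2 * saddle_scale L n = Re L ^ 3"
    by (simp add: saddle_abscissa_def saddle_scale_def power2_eq_square power3_eq_cube mult_ac)
  have "real n * real n powr (-1/3) = real n powr (2/3)" using powr_mult_base[of "real n" "-1/3"] n by simp
  then show "real n * saddle_abscissa L n = saddle_scale L n"
    by (simp add: saddle_abscissa_def saddle_scale_def mult_ac)
qed

lemma csqrt_of_real_square_mult: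
  assumes "\<rho> > 0" shows "csqrt (of_real (\<rho>\<^sup>2) * z) = of_real \<rho> * csqrt z"
  using csqrt_principal[of z] assms
  by (intro csqrt_unique) (auto simp: power_mult_distrib zero_less_mult_iff)

lemma saddle_main_eq:
  assumes L: "Re L > 0" and n: "n > 0"
  defines "\<sigma> \<equiv> saddle_abscissa L n" and "\<nu> \<equiv> saddle_scale L n" and "a \<equiv> Complex 1 (slope L)"
  shows "of_real \<sigma> * (exp (K + 3 / 2 * of_real \<nu> * a) * (csqrt (2 * of_real pi * a / 3) / of_real (sqrt \<nu>))) =
    2 * of_real pi * saddle_main L K n"
proof -
  have \<sigma>: "\<sigma> > 0" and \<nu>: "\<nu> > 0" using saddle_abscissa_scale[OF L n] by (auto simp: \<sigma>_def \<nu>_def)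
  have L_eq: "L = of_real (Re L) * a" using L by (simp add: complex_eq_iff a_def slope_def)
  define \<rho> where "\<rho> = \<sigma> / (2 * pi * sqrt \<nu>)"
  have \<rho>: "\<rho> > 0" using \<sigma> \<nu> by (simp add: \<rho>_def)
  have "real n powr (4/3) * (real n powr (-1/3) * real n powr (-1/3)) = real n powr (2/3)"
    using n by (simp add: powr_add[symmetric])
  then have "\<rho>\<^sup>2 * (2 * pi / 3) = Re L / (6 * pi * real n powr (4/3))"
    using L n \<nu> by (simp add: \<rho>_def \<sigma>_def \<nu>_def saddle_abscissa_def saddle_scale_def power_divide
        power_mult_distrib power2_eq_square field_simps)
  then have "of_real (\<rho>\<^sup>2) * (2 * of_real pi * a / 3) = of_real (Re L / (6 * pi * real n powr (4/3))) * a"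
    by (metis (no_types, opaque_lifting) mult.assoc of_real_mult of_real_divide of_real_numeral times_divide_eq_left times_divide_eq_right)
  also have "\<dots> = L / of_real (6 * pi * real n powr (4/3))" by (subst (2) L_eq) simp
  finally have csqrt: "csqrt (L / of_real (6 * pi * real n powr (4/3))) = of_real \<rho> * csqrt (2 * of_real pi * a / 3)"
    using csqrt_of_real_square_mult[OF \<rho>, of "2 * of_real pi * a / 3"] by (simp only:)
  have "of_real \<nu> * a = of_real (real n powr (2/3)) * L"
    by (subst L_eq) (simp add: \<nu>_def saddle_scale_def)
  then have exp: "exp (K + 3 / 2 * of_real \<nu> * a) = exp K * exp (3/2 * of_real (real n powr (2/3)) * L)"
    by (simp add: exp_add mult.assoc)
  show ?thesis unfolding saddle_main_def csqrt exp using \<nu> by (simp add: \<rho>_def)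
qed

lemma norm_saddle_main_ge:
  assumes L: "Re L > 0" and n: "n > 0"
  shows "saddle_abscissa L n * norm (exp (K + 3 / 2 * of_real (saddle_scale L n) * Complex 1 (slope L)))
    \<le> norm (2 * of_real pi * saddle_main L K n) * sqrt (saddle_scale L n)"
proof -
  let ?a = "Complex 1 (slope L)"
  have "1 * 1 \<le> 2 * pi / 3 * norm ?a" using pi_gt3 norm_Complex_1_ge by (intro mult_mono) auto
  then have "1 \<le> norm (csqrt (2 * of_real pi * ?a / 3))" by (simp add: norm_mult norm_divide)
  then show ?thesis
    unfolding saddle_main_eq[OF L n, symmetric] using saddle_abscissa_pos[OF L n] saddle_scale_pos[OF L n]
    by (simp add: norm_mult norm_divide)
qed

lemma integral_scale_real:
  fixes h :: "real \<Rightarrow> 'a::euclidean_space"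
  assumes h: "h integrable_on {\<sigma> * p..\<sigma> * q}" and \<sigma>: "\<sigma> > 0"
  shows "integral {\<sigma> * p..\<sigma> * q} h = \<sigma> *\<^sub>R integral {p..q} (\<lambda>t. h (\<sigma> * t))"
proof -
  have "((\<lambda>t. h (\<sigma> * t)) has_integral (1 / \<bar>\<sigma>\<bar>) *\<^sub>R integral {\<sigma> * p..\<sigma> * q} h) ((\<lambda>t. t / \<sigma>) ` {\<sigma> * p..\<sigma> * q})"
    using has_integral_stretch_real[OF integrable_integral[OF h], of \<sigma>] \<sigma> by simp
  moreover have "(\<lambda>t. t / \<sigma>) ` {\<sigma> * p..\<sigma> * q} = {p..q}"
    using \<sigma> by (auto simp: image_iff field_simps intro!: bexI[of _ "\<sigma> * _"])
  ultimately show ?thesis using \<sigma> by (simp add: integral_unique)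
qed

lemma major_arc_integral:
  fixes L K :: complex and G :: "real \<Rightarrow> complex" and n :: nat
  defines "\<sigma> \<equiv> saddle_abscissa L n" and "\<nu> \<equiv> saddle_scale L n" and "\<tau> \<equiv> slope L"
  assumes L: "Re L > 0" "norm L \<le> 2 * Re L" and n: "n > 0"
    and s: "s > 0" "p \<le> \<tau> - s" "\<tau> + s \<le> q"
    and c: "c > 0" "\<And>t. t \<in> {p..q} \<Longrightarrow> c \<le> Re (saddle_kern \<tau> t)"
    and E: "0 \<le> E" "E \<le> \<nu>" and G: "continuous_on UNIV G"
      "\<And>t. t \<in> {p..q} \<Longrightarrow> norm (G (\<sigma> * t) - (L ^ 3 / (2 * (Complex \<sigma> (\<sigma> * t))\<^sup>2) + K)) \<le> E / \<nu>"
  shows "norm (integral {\<sigma> * p..\<sigma> * q} (\<lambda>\<theta>. exp (G \<theta> + of_nat n * Complex \<sigma> \<theta>)) - 2 * of_real pi * saddle_main L K n)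
    \<le> norm (2 * of_real pi * saddle_main L K n) * ((3 * E * (q - p) + 8 * pi / c\<^sup>2 + 14 / s) / sqrt \<nu>)"
proof -
  let ?a = "Complex 1 \<tau>" and ?C = "3 * E * (q - p) + 8 * pi / c\<^sup>2 + 14 / s"
  let ?h = "\<lambda>\<theta>. exp (G \<theta> + of_nat n * Complex \<sigma> \<theta>)"
  let ?V = "exp (K + 3 / 2 * of_real \<nu> * ?a)"
  let ?Y = "csqrt (2 * of_real pi * ?a / 3) / of_real (sqrt \<nu>)"
  note scaling = saddle_abscissa_scale[OF L(1) n, folded \<sigma>_def \<nu>_def]
  have C: "?C \<ge> 0" using E c s by simp
  have Complex_scale: "Complex \<sigma> (\<sigma> * t) = of_real \<sigma> * Complex 1 t" for t by (simp add: complex_eq_iff)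
  have "of_nat n * Complex \<sigma> (\<sigma> * t) = of_real \<nu> * Complex 1 t" for t
    unfolding scaling(4)[symmetric] by (simp add: complex_eq_iff)
  moreover have "?h integrable_on {\<sigma> * p..\<sigma> * q}"
    unfolding Complex_eq_of_real
    by (intro integrable_continuous_real continuous_intros continuous_on_subset[OF G(1)]) auto
  ultimately have scale: "integral {\<sigma> * p..\<sigma> * q} ?h = of_real \<sigma> * integral {p..q} (\<lambda>t. exp (G (\<sigma> * t) + of_real \<nu> * Complex 1 t))"
    using integral_scale_real[of ?h \<sigma> p q] scaling(1) by (simp add: scaleR_conv_of_real)
  have "L = of_real (Re L) * ?a" using L by (simp add: complex_eq_iff \<tau>_def slope_def)
  then have "L ^ 3 = of_real (\<sigma>\<^sup>2 * \<nu>) * ?a ^ 3" unfolding scaling(3) by (metis of_real_power power_mult_distrib)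
  then have "L ^ 3 / (2 * (Complex \<sigma> (\<sigma> * t))\<^sup>2) = of_real \<nu> * (?a ^ 3 / (2 * (Complex 1 t)\<^sup>2))" for t
    using scaling(1) by (simp add: Complex_scale power_mult_distrib)
  moreover have "\<bar>\<tau>\<bar> \<le> 2"
    using L abs_Im_le_cmod[of L] by (simp add: \<tau>_def slope_def abs_divide divide_le_eq)
  moreover have "continuous_on {p..q} (\<lambda>t. G (\<sigma> * t))"
    by (intro continuous_on_compose2[OF G(1)] continuous_intros) auto
  ultimately have saddle: "norm (integral {p..q} (\<lambda>t. exp (G (\<sigma> * t) + of_real \<nu> * Complex 1 t)) - ?V * ?Y) \<le> norm ?V * (?C / \<nu>)"
    using G(2) by (intro saddle_integral s c scaling(2) E(2)) auto
  have "norm (integral {\<sigma> * p..\<sigma> * q} ?h - 2 * of_real pi * saddle_main L K n) =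
      \<sigma> * norm (integral {p..q} (\<lambda>t. exp (G (\<sigma> * t) + of_real \<nu> * Complex 1 t)) - ?V * ?Y)"
    using scaling(1) unfolding scale saddle_main_eq[OF L(1) n, symmetric, folded \<sigma>_def \<nu>_def \<tau>_def]
    by (simp only: right_diff_distrib[symmetric] norm_mult norm_of_real abs_of_pos)
  also have "\<dots> \<le> \<sigma> * (norm ?V * (?C / \<nu>))" using saddle scaling(1) by (intro mult_left_mono) auto
  also have "\<dots> = \<sigma> * norm ?V * (?C / \<nu>)" by simp
  also have "\<dots> \<le> norm (2 * of_real pi * saddle_main L K n) * sqrt \<nu> * (?C / \<nu>)"
    using norm_saddle_main_ge[OF L(1) n, of K, folded \<sigma>_def \<nu>_def \<tau>_def] C scaling(2)
    by (intro mult_right_mono divide_nonneg_pos) auto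
  also have "\<dots> = norm (2 * of_real pi * saddle_main L K n) * (?C / sqrt \<nu>)"
  proof -
    have "sqrt \<nu> * (D / \<nu>) = D / sqrt \<nu>" for D using scaling(2) by (simp add: field_simps)
    then show ?thesis by (simp only: mult.assoc)
  qed
  finally show ?thesis .
qed

section \<open>The circle method\<close>

definition circle_integrand :: "nat \<Rightarrow> complex \<Rightarrow> real \<Rightarrow> nat \<Rightarrow> real \<Rightarrow> complex" where
  "circle_integrand k x \<sigma> n \<theta> = exp (pp_log x ((-1) ^ Suc k * exp (- Complex \<sigma> \<theta>)) + of_nat n * Complex \<sigma> \<theta>)"

definition circle_arc :: "nat \<Rightarrow> complex \<Rightarrow> real \<Rightarrow> nat \<Rightarrow> real \<Rightarrow> real \<Rightarrow> complex" where
  "circle_arc k x \<sigma> n p q = integral {\<sigma> * p..\<sigma> * q} (circle_integrand k x \<sigma> n)"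

lemma norm_minus_one_power_mult [simp]: "norm ((-1) ^ k * z) = norm (z :: complex)"
  by (simp add: norm_mult norm_power)

lemma continuous_on_pp_log_circle:
  assumes "norm x < 1" "\<sigma> > 0"
  shows "continuous_on S (\<lambda>\<theta>. pp_log x ((-1) ^ k * exp (- Complex \<sigma> \<theta>)))"
proof (rule continuous_on_compose2[OF holomorphic_on_imp_continuous_on[OF holomorphic_pp_log_snd[OF assms(1)]]])
  show "continuous_on S (\<lambda>\<theta>. (-1) ^ k * exp (- Complex \<sigma> \<theta>))"
    unfolding Complex_eq_of_real by (intro continuous_intros)
qed (use assms in auto)

lemma continuous_on_circle_integrand:
  assumes "norm x < 1" "\<sigma> > 0" shows "continuous_on S (circle_integrand k x \<sigma> n)"
  unfolding circle_integrand_def[abs_def]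
  by (intro continuous_intros continuous_on_pp_log_circle[OF assms])

lemma integrable_circle_integrand:
  assumes "norm x < 1" "\<sigma> > 0" shows "circle_integrand k x \<sigma> n integrable_on {a..b}"
  by (intro integrable_continuous_real continuous_on_circle_integrand assms)

lemma circle_integrand_add_pi: "circle_integrand 1 x \<sigma> n (\<theta> + pi) = (-1) ^ n * circle_integrand 2 x \<sigma> n \<theta>"
proof -
  have shift: "Complex \<sigma> (\<theta> + pi) = Complex \<sigma> \<theta> + \<i> * of_real pi" by (simp add: complex_eq_iff)
  have "exp (of_nat n * (\<i> * of_real pi)) = (-1) ^ n" by (subst exp_of_nat_mult) simp
  then show ?thesis
    unfolding circle_integrand_def shift by (simp add: exp_add exp_diff distrib_left mult_ac)
qed

lemma integral_circle_integrand_near_minus_1: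
  assumes "norm x < 1" "\<sigma> > 0" "d \<ge> 0"
  shows "integral {pi - d..pi + d} (circle_integrand 1 x \<sigma> n) = (-1) ^ n * integral {-d..d} (circle_integrand 2 x \<sigma> n)"
proof -
  have "(circle_integrand 1 x \<sigma> n has_integral integral {pi - d..pi + d} (circle_integrand 1 x \<sigma> n)) (cbox (pi - d) (pi + d))"
    using integrable_circle_integrand[OF assms(1,2)] by (simp add: integrable_integral)
  from has_integral_affinity[OF this, of 1 pi]
  have "((\<lambda>\<theta>. circle_integrand 1 x \<sigma> n (\<theta> + pi)) has_integral integral {pi - d..pi + d} (circle_integrand 1 x \<sigma> n))
      ((\<lambda>\<theta>. \<theta> - pi) ` {pi - d..pi + d})" by simp
  also have "(\<lambda>\<theta>. \<theta> - pi) ` {pi - d..pi + d} = {-d..d}"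
    using image_affinity_atLeastAtMost[of 1 "- pi" "pi - d" "pi + d"] assms(3) by simp
  finally show ?thesis
    unfolding circle_integrand_add_pi by (simp flip: integral_mult_right add: integral_unique)
qed

lemma norm_circle_integrand_minor_arc:
  assumes "norm x < 1" "\<sigma> > 0" "12 * \<sigma> \<le> \<bar>sin \<theta>\<bar>"
  shows "norm (circle_integrand 1 x \<sigma> n \<theta>) \<le> exp (35 / 384 * norm x / \<sigma>\<^sup>2 + real n * \<sigma>)"
proof -
  have "Re (pp_log x (exp (- Complex \<sigma> \<theta>))) \<le> 35 / 384 * norm x / \<sigma>\<^sup>2"
    using norm_pp_log_minor_arc[OF assms] complex_Re_le_cmod order_trans by blast
  then show ?thesis by (simp add: circle_integrand_def norm_exp_eq_Re)
qed

lemma pp_poly_minus_major_arcs: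
  assumes x: "norm x < 1" and \<sigma>: "\<sigma> > 0" "24 * \<sigma> \<le> 1" and n: "n > 0"
  shows "norm (2 * of_real pi * pp_poly n x - (circle_arc 1 x \<sigma> n (-24) 24 + (-1) ^ n * circle_arc 2 x \<sigma> n (-24) 24))
    \<le> 2 * pi * exp (35 / 384 * norm x / \<sigma>\<^sup>2 + real n * \<sigma>)" (is "_ \<le> 2 * pi * ?B")
proof -
  define d where "d = 24 * \<sigma>"
  have d: "0 \<le> d" "d \<le> 1" "d / 2 = 12 * \<sigma>" using \<sigma> by (auto simp: d_def)
  let ?f = "circle_integrand 1 x \<sigma> n"
  let ?I = "\<lambda>a b. integral {a..b} ?f"
  note integrable = integrable_circle_integrand[OF x \<sigma>(1)]
  have "(?f has_integral 2 * of_real pi * pp_poly n x) {-pi/2..-pi/2 + 2 * pi}"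
    using has_integral_pp_poly[OF x \<sigma>(1), of n "-pi/2"] n by (simp add: circle_integrand_def[abs_def])
  then have "2 * of_real pi * pp_poly n x = ?I (-pi/2) (3*pi/2)" by (simp add: integral_unique)
  also have "\<dots> = ?I (-pi/2) (-d) + (?I (-d) d + (?I d (pi - d) + (?I (pi - d) (pi + d) + ?I (pi + d) (3*pi/2))))"
    using d pi_gt3 by (simp add: Henstock_Kurzweil_Integration.integral_combine integrable)
  finally have "2 * of_real pi * pp_poly n x - (?I (-d) d + ?I (pi - d) (pi + d)) =
      ?I (-pi/2) (-d) + ?I d (pi - d) + ?I (pi + d) (3*pi/2)" by simp
  also have "norm \<dots> \<le> ?B * (-d - (-pi/2)) + ?B * (pi - d - d) + ?B * (3*pi/2 - (pi + d))"
  proof -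
    have "norm (?f \<theta>) \<le> ?B" if "\<theta> \<in> {-pi/2..-d} \<union> {d..pi - d} \<union> {pi + d..3*pi/2}" for \<theta>
      using abs_sin_ge_off_major_arcs[OF d(1,2) that] d(3) by (intro norm_circle_integrand_minor_arc x \<sigma>) simp
    then show ?thesis
      using d pi_gt3 by (intro norm_triangle_mono integral_bound continuous_on_circle_integrand x \<sigma>) auto
  qed
  also have "\<dots> = ?B * (2 * pi - 4 * d)" by (simp add: algebra_simps)
  also have "\<dots> \<le> ?B * (2 * pi)" using d by (intro mult_left_mono) auto
  finally show ?thesis
    using integral_circle_integrand_near_minus_1[OF x \<sigma>(1) d(1)] by (simp add: circle_arc_def d_def mult.commute)
qed

subsection \<open>The saddle point terms\<close>

definition saddle_term :: "nat \<Rightarrow> nat \<Rightarrow> complex \<Rightarrow> complex" where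
  "saddle_term k n x = saddle_main (L_phase k x) (pp_const k x) n"

lemma exp_minus_le_inverse_square: fixes y :: real assumes "y > 0" shows "exp (- y) \<le> 2 / y\<^sup>2"
  using exp_lower_Taylor_quadratic[of y] assms by (simp add: exp_minus field_simps)

lemma norm_saddle_main_lower:
  assumes \<alpha>: "0 < \<alpha>" "\<alpha> \<le> Re L" and \<kappa>: "\<kappa> \<le> Re K" and n: "n > 0"
  shows "exp \<kappa> / (sqrt (6 * pi / \<alpha>) * real n powr (2/3)) * exp (3/2 * saddle_scale L n) \<le> norm (saddle_main L K n)"
proof -
  have n_pos: "real n > 0" using n by simp
  then have "sqrt (real n powr (4/3)) = real n powr (2/3)"
    by (simp add: powr_half_sqrt[symmetric] powr_powr)
  then have "1 / (sqrt (6 * pi / \<alpha>) * real n powr (2/3)) = sqrt (\<alpha> / (6 * pi * real n powr (4/3)))"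
    using \<alpha> by (simp add: real_sqrt_divide real_sqrt_mult field_simps)
  also have "\<dots> \<le> sqrt (norm (L / of_real (6 * pi * real n powr (4/3))))"
    using \<alpha> n_pos complex_Re_le_cmod[of L] by (simp add: norm_divide norm_mult divide_right_mono)
  finally have "exp \<kappa> * (1 / (sqrt (6 * pi / \<alpha>) * real n powr (2/3))) * exp (3/2 * saddle_scale L n) \<le>
      exp (Re K) * sqrt (norm (L / of_real (6 * pi * real n powr (4/3)))) * exp (3/2 * saddle_scale L n)"
    using \<kappa> \<alpha> by (intro mult_right_mono mult_mono) auto
  then show ?thesis
    by (simp add: saddle_main_def saddle_scale_def norm_mult norm_exp_eq_Re mult_ac)
qed

lemma negligible_of_exp_smaller:
  assumes \<alpha>: "0 < \<alpha>" "\<alpha> \<le> Re L" and \<kappa>: "\<kappa> \<le> Re K" and \<epsilon>: "\<epsilon> > 0" and n: "n > 0" and B: "B \<ge> 0"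
    and R: "norm (R :: complex) \<le> B * exp ((3/2 - \<epsilon>) * saddle_scale L n)"
  shows "norm R \<le> norm (saddle_main L K n) * (B * (2 * sqrt (6 * pi / \<alpha>) * exp (- \<kappa>) / (\<epsilon> * \<alpha>)\<^sup>2) * real n powr (-1/3))"
proof -
  let ?m = "real n" and ?\<nu> = "saddle_scale L n" and ?M = "norm (saddle_main L K n)"
  let ?y = "\<epsilon> * (\<alpha> * ?m powr (2/3))"
  have n_pos: "?m > 0" using n by simp
  have "?y \<le> \<epsilon> * ?\<nu>" using \<alpha> \<epsilon> by (simp add: saddle_scale_def mult_right_mono)
  then have "exp (- (\<epsilon> * ?\<nu>)) \<le> exp (- ?y)" by simp
  also have "\<dots> \<le> 2 / ?y\<^sup>2" using \<epsilon> \<alpha> n_pos by (intro exp_minus_le_inverse_square) simp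
  finally have decay: "exp (- (\<epsilon> * ?\<nu>)) \<le> 2 / ?y\<^sup>2" .
  have "exp (3/2 * ?\<nu>) \<le> ?M * (sqrt (6 * pi / \<alpha>) * exp (- \<kappa>) * ?m powr (2/3))"
    using norm_saddle_main_lower[OF \<alpha> \<kappa> n] \<alpha> n_pos by (simp add: exp_minus field_simps)
  then have "exp (3/2 * ?\<nu>) * exp (- (\<epsilon> * ?\<nu>)) \<le> ?M * (sqrt (6 * pi / \<alpha>) * exp (- \<kappa>) * ?m powr (2/3)) * (2 / ?y\<^sup>2)"
    using decay \<alpha> by (intro mult_mono) auto
  also have "\<dots> = ?M * ((2 * sqrt (6 * pi / \<alpha>) * exp (- \<kappa>) / (\<epsilon> * \<alpha>)\<^sup>2) * ?m powr (-2/3))"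
    using n_pos by (simp add: power_mult_distrib power2_eq_square powr_minus_divide field_simps)
  also have "\<dots> \<le> ?M * ((2 * sqrt (6 * pi / \<alpha>) * exp (- \<kappa>) / (\<epsilon> * \<alpha>)\<^sup>2) * ?m powr (-1/3))"
    using n \<alpha> by (intro mult_left_mono powr_mono) auto
  finally have "B * (exp (3/2 * ?\<nu>) * exp (- (\<epsilon> * ?\<nu>))) \<le>
      B * (?M * ((2 * sqrt (6 * pi / \<alpha>) * exp (- \<kappa>) / (\<epsilon> * \<alpha>)\<^sup>2) * ?m powr (-1/3)))"
    using B by (rule mult_left_mono)
  moreover have "exp (3/2 * ?\<nu>) * exp (- (\<epsilon> * ?\<nu>)) = exp ((3/2 - \<epsilon>) * ?\<nu>)"
    by (simp add: exp_add[symmetric] algebra_simps)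
  ultimately show ?thesis using R by (simp add: mult_ac)
qed

text \<open>The minor arcs are smaller than the saddle point term because \<open>35/384 = 35/76 \<cdot> 19/96\<close> and \<open>35/76 < 1/2\<close>.\<close>

lemma minor_arc_exponent_le:
  assumes x: "0 < norm x" "norm x < 1" and n: "n > 0"
  defines "\<sigma> \<equiv> saddle_abscissa (L_phase 1 x) n" and "\<nu> \<equiv> saddle_scale (L_phase 1 x) n"
  shows "35 / 384 * norm x / \<sigma>\<^sup>2 + real n * \<sigma> \<le> (3/2 - 3/76) * \<nu>"
proof -
  have "Re (L_phase 1 x) > 0" using x by (intro Re_L_phase_pos) auto
  note scaling = saddle_abscissa_scale[OF this n, folded \<sigma>_def \<nu>_def]
  have "19 / 96 * norm x \<le> \<sigma>\<^sup>2 * \<nu>" unfolding scaling(3) using x by (intro Re_L_phase_1_cube_ge) auto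
  then have "35 / 384 * norm x \<le> 35 / 76 * \<nu> * \<sigma>\<^sup>2" by (simp add: mult_ac)
  then have "35 / 384 * norm x / \<sigma>\<^sup>2 \<le> 35 / 76 * \<nu>" using scaling by (simp add: divide_le_eq)
  then show ?thesis unfolding scaling(4) by (simp add: algebra_simps)
qed

lemma saddle_abscissa_le:
  assumes "0 < Re L" "Re L ^ 3 \<le> 29 / 12" "n \<ge> 48 ^ 3" shows "24 * saddle_abscissa L n \<le> 1"
proof -
  have "Re L \<le> 2"
  proof (rule ccontr)
    assume "\<not> Re L \<le> 2"
    then have "2 ^ 3 \<le> Re L ^ 3" by (intro power_mono) auto
    then show False using assms(2) by simp
  qed
  moreover have "real n powr (-1/3) \<le> 1 / 48"
  proof -
    have "(48 ^ 3 :: real) \<le> real n" using assms(3) by (metis of_nat_le_iff of_nat_numeral of_nat_power)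
    then have "real n powr (-1/3) \<le> (48 ^ 3) powr (-1/3)" by (intro powr_mono2') auto
    also have "(48 ^ 3 :: real) powr (-1/3) = 48 powr (-1)"
      by (simp only: powr_numeral[symmetric] powr_powr) simp
    finally show ?thesis by (simp add: powr_minus_divide)
  qed
  ultimately have "Re L * real n powr (-1/3) \<le> 2 * (1 / 48)" using assms(1) by (intro mult_mono) auto
  then show ?thesis by (simp add: saddle_abscissa_def)
qed

lemma norm_saddle_line_square_le:
  assumes "0 < Re L" "n > 0" "\<bar>t\<bar> \<le> A"
  defines "\<sigma> \<equiv> saddle_abscissa L n"
  shows "norm (Complex \<sigma> (\<sigma> * t)) ^ 2 \<le> (1 + A\<^sup>2) * Re L ^ 3 / saddle_scale L n"
proof -
  note scaling = saddle_abscissa_scale[OF assms(1,2), folded \<sigma>_def]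
  have "t\<^sup>2 \<le> A\<^sup>2" using power_mono[OF assms(3), of 2] by simp
  then have "norm (Complex \<sigma> (\<sigma> * t)) ^ 2 \<le> (1 + A\<^sup>2) * \<sigma>\<^sup>2"
    using mult_right_mono[of "1 + t\<^sup>2" "1 + A\<^sup>2" "\<sigma>\<^sup>2"] by (simp add: cmod_power2 power_mult_distrib algebra_simps)
  also have "\<sigma>\<^sup>2 = Re L ^ 3 / saddle_scale L n" using scaling by (simp flip: scaling(3))
  finally show ?thesis by simp
qed

lemma norm_pp_log_error_arc_le:
  assumes "0 \<le> r" "r < 1"
  obtains E where "E \<ge> 0" "\<And>j k x n t. j \<in> {1, 2} \<Longrightarrow> k \<in> {1, 2} \<Longrightarrow> 0 < norm x \<Longrightarrow> norm x \<le> r \<Longrightarrow> n > 0 \<Longrightarrow> \<bar>t\<bar> \<le> 24 \<Longrightarrow>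
    norm (pp_log_error k x (Complex (saddle_abscissa (L_phase j x) n) (saddle_abscissa (L_phase j x) n * t)))
    \<le> E / saddle_scale (L_phase j x) n"
proof -
  obtain C where C: "C > 0" "\<And>k x w. k \<in> {1, 2} \<Longrightarrow> 0 < norm x \<Longrightarrow> norm x \<le> r \<Longrightarrow> w \<in> cone 24 \<Longrightarrow>
      norm (pp_log_error k x w) \<le> C * norm w ^ 2"
    using norm_pp_log_error_le[of 24 r] assms by auto
  show ?thesis
  proof (rule that[of "C * (577 * (29 / 12))"])
    fix j k n :: nat and x :: complex and t :: real
    assume j: "j \<in> {1, 2}" and k: "k \<in> {1, 2}" and x: "0 < norm x" "norm x \<le> r" and n: "n > 0" and t: "\<bar>t\<bar> \<le> 24"
    let ?L = "L_phase j x"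
    let ?w = "Complex (saddle_abscissa ?L n) (saddle_abscissa ?L n * t)"
    have L: "0 < Re ?L" "Re ?L ^ 3 \<le> 29 / 12"
      using j x assms Re_L_phase_pos[of x j] Re_L_phase_cube_le[of x j] by auto
    have "?w \<in> cone 24" using saddle_abscissa_pos[OF L(1) n] t by (simp add: cone_def abs_mult)
    then have "norm (pp_log_error k x ?w) \<le> C * norm ?w ^ 2" by (rule C(2)[OF k x])
    also have "norm ?w ^ 2 \<le> 577 * Re ?L ^ 3 / saddle_scale ?L n"
      using norm_saddle_line_square_le[OF L(1) n t] by simp
    also have "\<dots> \<le> 577 * (29 / 12) / saddle_scale ?L n"
      using L saddle_scale_pos[OF L(1) n] by (intro divide_right_mono) auto
    finally show "norm (pp_log_error k x ?w) \<le> C * (577 * (29 / 12)) / saddle_scale ?L n"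
      using C(1) by simp
  qed (use C(1) in simp)
qed

lemma eventually_saddle_scale_ge:
  assumes "\<alpha> > 0" obtains N where "N > 0" "\<And>L n. \<alpha> \<le> Re L \<Longrightarrow> n \<ge> N \<Longrightarrow> E \<le> saddle_scale L n"
proof -
  have "filterlim (\<lambda>n. real n powr (2/3)) at_top sequentially" by real_asymp
  then have "\<forall>\<^sub>F n in sequentially. E / \<alpha> \<le> real n powr (2/3)" by (simp add: filterlim_at_top)
  then obtain N where N: "\<And>n. n \<ge> N \<Longrightarrow> E \<le> \<alpha> * real n powr (2/3)"
    using assms by (auto simp: eventually_sequentially divide_le_eq mult.commute)
  have "E \<le> saddle_scale L n" if "\<alpha> \<le> Re L" "n \<ge> Suc N" for L n
    unfolding saddle_scale_def using that by (intro order_trans[OF N mult_right_mono]) auto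
  then show ?thesis using that[of "Suc N"] by blast
qed

lemma divide_sqrt_saddle_scale_le:
  assumes "0 < \<alpha>" "\<alpha> \<le> Re L" "n > 0" "D \<ge> 0"
  shows "D / sqrt (saddle_scale L n) \<le> D / sqrt \<alpha> * real n powr (-1/3)"
proof -
  have n: "real n > 0" using assms by simp
  then have "sqrt (real n powr (2/3)) = real n powr (1/3)" by (simp add: powr_half_sqrt[symmetric] powr_powr)
  then have "D / sqrt (saddle_scale L n) \<le> D / (sqrt \<alpha> * real n powr (1/3))"
    unfolding saddle_scale_def real_sqrt_mult using assms n by (intro divide_left_mono mult_mono) auto
  also have "\<dots> = D / sqrt \<alpha> * real n powr (-1/3)" by (simp add: powr_minus_divide)
  finally show ?thesis .
qed

definition phase_domain :: "nat \<Rightarrow> real \<Rightarrow> real \<Rightarrow> complex set" where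
  "phase_domain k r \<alpha> = {x. 0 < norm x \<and> norm x \<le> r \<and> \<alpha> \<le> Re (L_phase k x)}"

definition saddle_range :: "real \<Rightarrow> real \<Rightarrow> real \<Rightarrow> real \<Rightarrow> bool" where
  "saddle_range \<delta> \<tau> p q \<longleftrightarrow> -24 \<le> p \<and> p + 1 \<le> \<tau> \<and> \<tau> + 1 \<le> q \<and> q \<le> 24 \<and> (\<forall>t\<in>{p..q}. \<delta> \<le> (t + \<tau>)\<^sup>2 + 3 - \<tau>\<^sup>2)"

lemma circle_arc_minus_saddle_term_le:
  assumes k: "k > 0" and x: "0 < norm x" "norm x < 1" and n: "n > 0" and \<delta>: "\<delta> > 0"
  defines "L \<equiv> L_phase k x" and "c \<equiv> \<delta> / (2 * (1 + 24\<^sup>2)\<^sup>2)"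
  defines "\<sigma> \<equiv> saddle_abscissa L n" and "\<nu> \<equiv> saddle_scale L n"
  assumes range: "saddle_range \<delta> (slope L) p q" and E: "0 \<le> E" "E \<le> \<nu>"
    and error: "\<And>t. \<bar>t\<bar> \<le> 24 \<Longrightarrow> norm (pp_log_error k x (Complex \<sigma> (\<sigma> * t))) \<le> E / \<nu>"
  shows "norm (circle_arc k x \<sigma> n p q - 2 * of_real pi * saddle_term k n x)
    \<le> norm (2 * of_real pi * saddle_term k n x) * ((144 * E + 8 * pi / c\<^sup>2 + 14) / sqrt \<nu>)"
proof -
  have L_pos: "Re L > 0" unfolding L_def using k x by (intro Re_L_phase_pos) auto
  note scaling = saddle_abscissa_scale[OF L_pos n, folded \<sigma>_def \<nu>_def]
  have pq: "-24 \<le> p" "p + 1 \<le> slope L" "slope L + 1 \<le> q" "q \<le> 24"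
    and \<delta>_le: "\<And>t. t \<in> {p..q} \<Longrightarrow> \<delta> \<le> (t + slope L)\<^sup>2 + 3 - (slope L)\<^sup>2"
    using range by (auto simp: saddle_range_def)
  let ?M = "2 * of_real pi * saddle_main L (pp_const k x) n"
  have "norm (integral {\<sigma> * p..\<sigma> * q} (\<lambda>\<theta>. exp (pp_log x ((-1) ^ Suc k * exp (- Complex \<sigma> \<theta>)) + of_nat n * Complex \<sigma> \<theta>)) - ?M)
      \<le> norm ?M * ((3 * E * (q - p) + 8 * pi / c\<^sup>2 + 14 / 1) / sqrt \<nu>)"
  proof (rule major_arc_integral[OF L_pos _ n, folded \<sigma>_def \<nu>_def])
    show "norm L \<le> 2 * Re L" unfolding L_def using x by (intro norm_L_phase_le) auto
    show "c > 0" using \<delta> by (simp add: c_def)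
    show "c \<le> Re (saddle_kern (slope L) t)" if "t \<in> {p..q}" for t
      unfolding c_def using \<delta> \<delta>_le[OF that] that pq by (intro Re_saddle_kern_ge) auto
    show "continuous_on UNIV (\<lambda>\<theta>. pp_log x ((-1) ^ Suc k * exp (- Complex \<sigma> \<theta>)))"
      using x scaling(1) by (intro continuous_on_pp_log_circle) auto
    show "norm (pp_log x ((-1) ^ Suc k * exp (- Complex \<sigma> (\<sigma> * t))) -
        (L ^ 3 / (2 * (Complex \<sigma> (\<sigma> * t))\<^sup>2) + pp_const k x)) \<le> E / \<nu>"
      if "t \<in> {p..q}" for t
      using error[of t] that pq by (auto simp: pp_log_error_def L_def abs_le_iff)
  qed (use E pq in auto)
  also have "3 * E * (q - p) \<le> 144 * E" using pq E(1) mult_left_mono[of "q - p" 48 "3 * E"] by simp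
  finally show ?thesis
    using scaling(2) unfolding circle_arc_def saddle_term_def circle_integrand_def[abs_def] L_def
    by (simp add: mult_left_mono divide_right_mono)
qed

lemma circle_arc_saddle_term:
  assumes r: "0 \<le> r" "r < 1" and \<alpha>: "\<alpha> > 0" and \<delta>: "\<delta> > 0"
  obtains C N where "C \<ge> 0" "N > 0" "\<And>k x n p q. k \<in> {1, 2} \<Longrightarrow> x \<in> phase_domain k r \<alpha> \<Longrightarrow> n \<ge> N \<Longrightarrow>
    saddle_range \<delta> (slope (L_phase k x)) p q \<Longrightarrow>
    norm (circle_arc k x (saddle_abscissa (L_phase k x) n) n p q - 2 * of_real pi * saddle_term k n x)
    \<le> norm (2 * of_real pi * saddle_term k n x) * (C * real n powr (-1/3))"
proof -
  obtain E where E: "E \<ge> 0" "\<And>j k x n t. j \<in> {1, 2} \<Longrightarrow> k \<in> {1, 2} \<Longrightarrow> 0 < norm x \<Longrightarrow> norm x \<le> r \<Longrightarrow> n > 0 \<Longrightarrow> \<bar>t\<bar> \<le> 24 \<Longrightarrow>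
    norm (pp_log_error k x (Complex (saddle_abscissa (L_phase j x) n) (saddle_abscissa (L_phase j x) n * t)))
    \<le> E / saddle_scale (L_phase j x) n"
    using norm_pp_log_error_arc_le[OF r] by blast
  obtain N where N: "N > 0" "\<And>L n. \<alpha> \<le> Re L \<Longrightarrow> n \<ge> N \<Longrightarrow> E \<le> saddle_scale L n"
    using eventually_saddle_scale_ge[OF \<alpha>] by blast
  define D where "D = 144 * E + 8 * pi / (\<delta> / (2 * (1 + 24\<^sup>2)\<^sup>2))\<^sup>2 + 14"
  have D: "D \<ge> 0" using E(1) by (simp add: D_def)
  show ?thesis
  proof (rule that[of "D / sqrt \<alpha>" N])
    fix k n :: nat and x :: complex and p q :: real
    let ?L = "L_phase k x" and ?M = "2 * of_real pi * saddle_term k n x"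
    assume k: "k \<in> {1, 2}" and "x \<in> phase_domain k r \<alpha>" and n: "n \<ge> N" and range: "saddle_range \<delta> (slope ?L) p q"
    then have x: "0 < norm x" "norm x \<le> r" "norm x < 1" and L_ge: "\<alpha> \<le> Re ?L"
      using r by (auto simp: phase_domain_def)
    have "n > 0" "k > 0" using n N(1) k by auto
    then have "norm (circle_arc k x (saddle_abscissa ?L n) n p q - ?M) \<le> norm ?M * (D / sqrt (saddle_scale ?L n))"
      unfolding D_def using E N(2)[OF L_ge n]
      by (intro circle_arc_minus_saddle_term_le x \<delta> range E(2)[OF k k x(1,2)]) auto
    also have "\<dots> \<le> norm ?M * (D / sqrt \<alpha> * real n powr (-1/3))"
      using \<alpha> L_ge \<open>n > 0\<close> D by (intro mult_left_mono divide_sqrt_saddle_scale_le) auto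
    finally show "norm (circle_arc k x (saddle_abscissa ?L n) n p q - ?M) \<le> norm ?M * (D / sqrt \<alpha> * real n powr (-1/3))" .
  qed (use N(1) D \<alpha> in auto)
qed

subsection \<open>Uniformity on compact sets\<close>

lemma compact_positive_lower_bound:
  fixes f :: "'a::topological_space \<Rightarrow> real"
  assumes "compact X" "continuous_on X f" and pos: "\<And>x. x \<in> X \<Longrightarrow> 0 < f x"
  obtains \<delta> where "\<delta> > 0" "\<And>x. x \<in> X \<Longrightarrow> \<delta> \<le> f x"
proof (cases "X = {}")
  case False
  then obtain y where "y \<in> X" "\<And>x. x \<in> X \<Longrightarrow> f y \<le> f x"
    using continuous_attains_inf[OF assms(1) _ assms(2)] by auto
  then show ?thesis using that[of "f y"] pos by blast
qed (use that[of 1] in simp)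

lemma compact_norm_upper_bound:
  fixes X :: "'a::real_normed_vector set"
  assumes "compact X" "\<And>x. x \<in> X \<Longrightarrow> norm x < 1"
  obtains r where "0 \<le> r" "r < 1" "\<And>x. x \<in> X \<Longrightarrow> norm x \<le> r"
proof -
  have "continuous_on X (\<lambda>x. 1 - norm x)" by (intro continuous_intros)
  then obtain \<delta> where \<delta>: "\<delta> > 0" "\<And>x. x \<in> X \<Longrightarrow> \<delta> \<le> 1 - norm x"
    using compact_positive_lower_bound[OF assms(1)] assms(2) by (metis diff_gt_0_iff_gt)
  show ?thesis
  proof (rule that[of "max 0 (1 - \<delta>)"])
    show "norm x \<le> max 0 (1 - \<delta>)" if "x \<in> X" for x using \<delta>(2)[OF that] by linarith
  qed (use \<delta>(1) in auto)
qed

lemma eventually_Ball_choice2: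
  assumes "\<forall>\<^sub>F n in F. \<forall>x\<in>X. \<exists>a b. P n x a b"
  shows "\<exists>A B. \<forall>\<^sub>F n in F. \<forall>x\<in>X. P n x (A n x) (B n x)"
proof -
  define S where "S n x = (SOME p. P n x (fst p) (snd p))" for n x
  have "P n x (fst (S n x)) (snd (S n x))" if "P n x a b" for n x a b
    unfolding S_def using that by (rule someI[where P = "\<lambda>p. P n x (fst p) (snd p)" and x = "(a, b)", simplified])
  with assms have "\<forall>\<^sub>F n in F. \<forall>x\<in>X. P n x (fst (S n x)) (snd (S n x))"
    by (auto elim!: eventually_mono)
  then show ?thesis by (intro exI)
qed

lemma relative_error:
  fixes z m :: "'a::real_normed_field"
  assumes "norm (z - m) \<le> norm m * \<eta>" "0 \<le> \<eta>"
  obtains e where "norm e \<le> \<eta>" "z = m * (1 + e)"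
proof (cases "m = 0")
  case True
  then show ?thesis using that[of 0] assms by simp
next
  case False
  show ?thesis
  proof (rule that[of "(z - m) / m"])
    show "norm ((z - m) / m) \<le> \<eta>" using assms False by (simp add: norm_divide divide_le_eq mult.commute)
  qed (use False in \<open>simp add: field_simps\<close>)
qed

lemma ln_le_Re_pp_const_1:
  assumes "norm x \<le> r" "r < 1" shows "ln (1 - r) / 12 \<le> Re (pp_const 1 x)"
proof -
  have "1 - r \<le> norm (1 - x)" using norm_triangle_ineq2[of 1 x] assms by simp
  then have "ln (1 - r) \<le> ln (norm (1 - x))" using assms by (intro ln_mono) auto
  moreover have "x \<noteq> 1" using assms by auto
  ultimately show ?thesis by (simp add: pp_const_def)
qed

lemma Re_pp_const_2_le:
  assumes "norm x \<le> r" "r < 1" shows "Re (pp_const 2 x) \<le> ln 2 / 24 + ln (2 / (1 - r)) / 8"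
proof -
  have x: "norm x < 1" using assms by simp
  then have ne: "1 - x \<noteq> 0" "1 + x \<noteq> 0" "1 - x\<^sup>2 \<noteq> 0"
    by (auto simp: add_eq_0_iff power2_eq_1_iff)
  have "norm (1 - x\<^sup>2) \<le> 2"
    using norm_triangle_ineq4[of 1 "x\<^sup>2"] power_le_one[of "norm x" 2] x by (simp add: norm_power)
  then have "Re (Ln (1 - x\<^sup>2)) \<le> ln 2" using ne by simp
  moreover have "norm ((1 - x) / (1 + x)) \<le> 2 / (1 - r)"
    unfolding norm_divide using norm_triangle_ineq4[of 1 x] norm_triangle_ineq2[of 1 "- x"] assms x
    by (intro frac_le) auto
  then have "ln (norm ((1 - x) / (1 + x))) \<le> ln (2 / (1 - r))" using ne by (intro ln_mono) auto
  then have "Re (Ln ((1 - x) / (1 + x))) \<le> ln (2 / (1 - r))" using ne by simp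
  ultimately show ?thesis by (simp add: pp_const_def)
qed

subsection \<open>Splitting the circle\<close>

definition major_arc :: "nat \<Rightarrow> complex \<Rightarrow> nat \<Rightarrow> complex" where
  "major_arc k x n = circle_arc k x (saddle_abscissa (L_phase 1 x) n) n (-24) 24"

lemma saddle_abscissa_L_phase_1:
  assumes "0 < norm x" "norm x < 1" "n \<ge> 48 ^ 3"
  shows "0 < saddle_abscissa (L_phase 1 x) n" "24 * saddle_abscissa (L_phase 1 x) n \<le> 1"
proof -
  have "Re (L_phase 1 x) > 0" "Re (L_phase 1 x) ^ 3 \<le> 29 / 12"
    using assms Re_L_phase_cube_le[of x 1] by (auto intro: Re_L_phase_pos)
  then show "0 < saddle_abscissa (L_phase 1 x) n" "24 * saddle_abscissa (L_phase 1 x) n \<le> 1"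
    using assms(3) saddle_abscissa_pos[of "L_phase 1 x" n] saddle_abscissa_le[of "L_phase 1 x" n] by auto
qed

lemma minor_arcs_negligible:
  assumes r: "r < 1" and \<alpha>: "\<alpha> > 0"
  obtains Z where "Z \<ge> 0" "\<And>x n. x \<in> phase_domain 1 r \<alpha> \<Longrightarrow> n \<ge> 48 ^ 3 \<Longrightarrow>
    norm (2 * of_real pi * pp_poly n x - (major_arc 1 x n + (-1) ^ n * major_arc 2 x n))
    \<le> norm (2 * of_real pi * saddle_term 1 n x) * (Z * real n powr (-1/3))"
proof -
  define Z where "Z = 2 * sqrt (6 * pi / \<alpha>) * exp (- (ln (1 - r) / 12)) / (3 / 76 * \<alpha>)\<^sup>2"
  show ?thesis
  proof (rule that[of Z])
    fix x n assume "x \<in> phase_domain 1 r \<alpha>" and n: "n \<ge> (48::nat) ^ 3"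
    then have x: "0 < norm x" "norm x \<le> r" and L: "\<alpha> \<le> Re (L_phase 1 x)" by (auto simp: phase_domain_def)
    have x_less: "norm x < 1" and n_pos: "n > 0" using x r n by auto
    let ?\<sigma> = "saddle_abscissa (L_phase 1 x) n"
    let ?R = "2 * of_real pi * pp_poly n x - (major_arc 1 x n + (-1) ^ n * major_arc 2 x n)"
    have "norm ?R \<le> 2 * pi * exp (35 / 384 * norm x / ?\<sigma>\<^sup>2 + real n * ?\<sigma>)"
      unfolding major_arc_def
      by (rule pp_poly_minus_major_arcs[OF x_less saddle_abscissa_L_phase_1[OF x(1) x_less n] n_pos])
    also have "\<dots> \<le> 2 * pi * exp ((3/2 - 3/76) * saddle_scale (L_phase 1 x) n)"
      using minor_arc_exponent_le[OF x(1) x_less n_pos] by simp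
    finally have "norm ?R \<le> norm (saddle_term 1 n x) * (2 * pi * Z * real n powr (-1/3))"
      unfolding Z_def saddle_term_def
      by (intro negligible_of_exp_smaller \<alpha> L ln_le_Re_pp_const_1[OF x(2) r] n_pos) auto
    then show "norm ?R \<le> norm (2 * of_real pi * saddle_term 1 n x) * (Z * real n powr (-1/3))"
      by (simp add: norm_mult mult_ac)
  qed (use \<alpha> in \<open>simp add: Z_def\<close>)
qed

section \<open>The asymptotics on the level set\<close>

definition level_domain :: "real \<Rightarrow> real \<Rightarrow> real \<Rightarrow> complex set" where
  "level_domain r \<alpha> \<delta> = {x \<in> phase_domain 1 r \<alpha>. Re (L_phase 1 x) = Re (L_phase 2 x) \<and>
     (\<forall>k\<in>{1, 2}. \<delta> \<le> 3 - (slope (L_phase k x))\<^sup>2)}"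

lemma major_arc_level_domain:
  assumes r: "0 \<le> r" "r < 1" and \<alpha>: "\<alpha> > 0" and \<delta>: "\<delta> > 0"
  obtains C N where "C \<ge> 0" "N > 0" "\<And>k x n. k \<in> {1, 2} \<Longrightarrow> x \<in> level_domain r \<alpha> \<delta> \<Longrightarrow> n \<ge> N \<Longrightarrow>
    norm (major_arc k x n - 2 * of_real pi * saddle_term k n x)
    \<le> norm (2 * of_real pi * saddle_term k n x) * (C * real n powr (-1/3))"
proof -
  obtain C N where CN: "C \<ge> 0" "N > 0" and arc: "\<And>k x n p q. k \<in> {1, 2} \<Longrightarrow> x \<in> phase_domain k r \<alpha> \<Longrightarrow> n \<ge> N \<Longrightarrow>
    saddle_range \<delta> (slope (L_phase k x)) p q \<Longrightarrow>
    norm (circle_arc k x (saddle_abscissa (L_phase k x) n) n p q - 2 * of_real pi * saddle_term k n x)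
    \<le> norm (2 * of_real pi * saddle_term k n x) * (C * real n powr (-1/3))"
    using circle_arc_saddle_term[OF assms] by blast
  show ?thesis
  proof (rule that[of C N, OF CN])
    fix k x n assume k: "k \<in> {1, 2 :: nat}" and "x \<in> level_domain r \<alpha> \<delta>" and n: "n \<ge> N"
    then have "x \<in> phase_domain 1 r \<alpha>" and level: "Re (L_phase k x) = Re (L_phase 1 x)"
      and \<delta>_le: "\<delta> \<le> 3 - (slope (L_phase k x))\<^sup>2"
      by (auto simp: level_domain_def)
    then have x: "x \<in> phase_domain k r \<alpha>" by (simp add: phase_domain_def)
    let ?\<tau> = "slope (L_phase k x)"
    have "?\<tau>\<^sup>2 \<le> 2\<^sup>2" using \<delta>_le \<delta> by simp
    then have "\<bar>?\<tau>\<bar> \<le> 2" using abs_le_square_iff[of ?\<tau> 2] by simp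
    moreover have "\<delta> \<le> (t + ?\<tau>)\<^sup>2 + 3 - ?\<tau>\<^sup>2" for t using \<delta>_le zero_le_power2[of "t + ?\<tau>"] by linarith
    ultimately have "saddle_range \<delta> ?\<tau> (-24) 24" by (auto simp: saddle_range_def)
    from arc[OF k x n this] show "norm (major_arc k x n - 2 * of_real pi * saddle_term k n x)
        \<le> norm (2 * of_real pi * saddle_term k n x) * (C * real n powr (-1/3))"
      unfolding major_arc_def saddle_abscissa_def level .
  qed
qed

lemma relative_errors_add:
  fixes z u v M M' s :: "'a::real_normed_field"
  assumes "norm (u - M) \<le> norm M * \<eta>" "norm (v - M') \<le> norm M' * \<eta>" "norm (z - (u + s * v)) \<le> norm M * \<zeta>"
    and "0 \<le> \<eta>" "0 \<le> \<zeta>"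
  obtains e e' where "norm e \<le> \<eta> + \<zeta>" "norm e' \<le> \<eta> + \<zeta>" "z = M * (1 + e) + s * (M' * (1 + e'))"
proof -
  have "norm ((u - M) + (z - (u + s * v))) \<le> norm M * \<eta> + norm M * \<zeta>"
    by (rule norm_triangle_mono[OF assms(1,3)])
  then have "norm ((z - s * v) - M) \<le> norm M * (\<eta> + \<zeta>)" by (simp add: algebra_simps)
  moreover have "0 \<le> \<eta> + \<zeta>" using assms by simp
  ultimately obtain e where e: "norm e \<le> \<eta> + \<zeta>" "z - s * v = M * (1 + e)" by (rule relative_error)
  obtain e' where e': "norm e' \<le> \<eta>" "v = M' * (1 + e')" using assms(2,4) by (rule relative_error)
  have "z = M * (1 + e) + s * (M' * (1 + e'))" unfolding e(2)[symmetric] e'(2)[symmetric] by simp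
  with e(1) e'(1) \<open>0 \<le> \<zeta>\<close> show ?thesis using that[of e e'] by simp
qed

lemma pp_poly_level_domain:
  assumes r: "0 \<le> r" "r < 1" and \<alpha>: "\<alpha> > 0" and \<delta>: "\<delta> > 0"
  obtains C N where "\<And>x n. x \<in> level_domain r \<alpha> \<delta> \<Longrightarrow> n \<ge> N \<Longrightarrow>
    \<exists>e1 e2. norm e1 \<le> C * real n powr (-1/3) \<and> norm e2 \<le> C * real n powr (-1/3) \<and>
      pp_poly n x = saddle_term 1 n x * (1 + e1) + (-1) ^ n * saddle_term 2 n x * (1 + e2)"
proof -
  obtain C N where CN: "C \<ge> 0" "N > 0" and major: "\<And>k x n. k \<in> {1, 2} \<Longrightarrow> x \<in> level_domain r \<alpha> \<delta> \<Longrightarrow> n \<ge> N \<Longrightarrow>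
    norm (major_arc k x n - 2 * of_real pi * saddle_term k n x)
    \<le> norm (2 * of_real pi * saddle_term k n x) * (C * real n powr (-1/3))"
    using major_arc_level_domain[OF assms] by blast
  obtain Z where Z: "Z \<ge> 0" and minor: "\<And>x n. x \<in> phase_domain 1 r \<alpha> \<Longrightarrow> n \<ge> 48 ^ 3 \<Longrightarrow>
    norm (2 * of_real pi * pp_poly n x - (major_arc 1 x n + (-1) ^ n * major_arc 2 x n))
    \<le> norm (2 * of_real pi * saddle_term 1 n x) * (Z * real n powr (-1/3))"
    using minor_arcs_negligible[OF r(2) \<alpha>] by blast
  show ?thesis
  proof (rule that[of "max N (48 ^ 3)" "C + Z"])
    fix x n assume x: "x \<in> level_domain r \<alpha> \<delta>" and n: "n \<ge> max N (48 ^ 3)"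
    let ?\<eta> = "real n powr (-1/3)"
    have major_x: "norm (major_arc k x n - 2 * of_real pi * saddle_term k n x)
        \<le> norm (2 * of_real pi * saddle_term k n x) * (C * ?\<eta>)" if "k \<in> {1, 2}" for k
      using major[OF that x] n by simp
    have minor_x: "norm (2 * of_real pi * pp_poly n x - (major_arc 1 x n + (-1) ^ n * major_arc 2 x n))
        \<le> norm (2 * of_real pi * saddle_term 1 n x) * (Z * ?\<eta>)"
      using x n by (intro minor) (auto simp: level_domain_def)
    have "0 \<le> C * ?\<eta>" "0 \<le> Z * ?\<eta>" using CN Z by auto
    then obtain e1 e2 where e: "norm e1 \<le> C * ?\<eta> + Z * ?\<eta>" "norm e2 \<le> C * ?\<eta> + Z * ?\<eta>"
      and "2 * of_real pi * pp_poly n x = 2 * of_real pi * saddle_term 1 n x * (1 + e1)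
        + (-1) ^ n * (2 * of_real pi * saddle_term 2 n x * (1 + e2))"
      using relative_errors_add[OF major_x[of 1] major_x[of 2] minor_x] by auto
    then have "2 * of_real pi * pp_poly n x =
        2 * of_real pi * (saddle_term 1 n x * (1 + e1) + (-1) ^ n * saddle_term 2 n x * (1 + e2))"
      by (simp add: distrib_left mult_ac)
    then have "pp_poly n x = saddle_term 1 n x * (1 + e1) + (-1) ^ n * saddle_term 2 n x * (1 + e2)" by simp
    then show "\<exists>e1 e2. norm e1 \<le> (C + Z) * ?\<eta> \<and> norm e2 \<le> (C + Z) * ?\<eta> \<and>
        pp_poly n x = saddle_term 1 n x * (1 + e1) + (-1) ^ n * saddle_term 2 n x * (1 + e2)"
      using e unfolding distrib_right by blast
  qed
qed

lemma saddle_term_eq: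
  assumes "norm x < 1"
  shows "saddle_term 1 n x = (1 - x) powr (1/12) * csqrt (L_phase 1 x / complex_of_real (6 * pi * real n powr (4/3)))
      * exp (3/2 * complex_of_real (real n powr (2/3)) * L_phase 1 x)"
    and "saddle_term 2 n x = (1 - x\<^sup>2) powr (1/24) * ((1 - x) / (1 + x)) powr (1/8)
      * csqrt (L_phase 2 x / complex_of_real (6 * pi * real n powr (4/3)))
      * exp (3/2 * complex_of_real (real n powr (2/3)) * L_phase 2 x)"
proof -
  have "1 - x \<noteq> 0" "1 + x \<noteq> 0" "1 - x\<^sup>2 \<noteq> 0"
    using assms by (auto simp: add_eq_0_iff power2_eq_1_iff)
  then have "exp (pp_const 1 x) = (1 - x) powr (1/12)"
    "exp (pp_const 2 x) = (1 - x\<^sup>2) powr (1/24) * ((1 - x) / (1 + x)) powr (1/8)"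
    by (auto simp: pp_const_def powr_def exp_add)
  then show "saddle_term 1 n x = (1 - x) powr (1/12) * csqrt (L_phase 1 x / complex_of_real (6 * pi * real n powr (4/3)))
      * exp (3/2 * complex_of_real (real n powr (2/3)) * L_phase 1 x)"
    "saddle_term 2 n x = (1 - x\<^sup>2) powr (1/24) * ((1 - x) / (1 + x)) powr (1/8)
      * csqrt (L_phase 2 x / complex_of_real (6 * pi * real n powr (4/3)))
      * exp (3/2 * complex_of_real (real n powr (2/3)) * L_phase 2 x)"
    by (simp_all only: saddle_term_def saddle_main_def)
qed

lemma level_set_minus_x_star:
  assumes "x \<in> level_set - {complex_of_real x_star}"
  shows "0 < norm x" "norm x < 1" "Re (L_phase 1 x) = Re (L_phase 2 x)" "Im x \<noteq> 0" "Im (x\<^sup>2) \<noteq> 0"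
proof -
  show "0 < norm x" "norm x < 1" "Re (L_phase 1 x) = Re (L_phase 2 x)"
    using assms by (auto simp: level_set_def)
  show "Im x \<noteq> 0"
  proof
    assume "Im x = 0"
    then have "x = complex_of_real (Re x)" by (simp add: complex_eq_iff)
    then show False using real_level_set_eq_x_star[of "Re x"] assms by auto
  qed
  then show "Im (x\<^sup>2) \<noteq> 0" using level_set_Im_square assms by blast
qed

lemma slope_square_less:
  assumes "norm L < 2 * Re L" shows "(slope L)\<^sup>2 < 3"
proof -
  have "Re L > 0" using assms norm_ge_zero[of L] by linarith
  have "norm L ^ 2 < (2 * Re L)\<^sup>2" using assms by (intro power_strict_mono) auto
  then have "(Im L)\<^sup>2 < 3 * (Re L)\<^sup>2" unfolding cmod_power2 by (simp add: power_mult_distrib)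
  then show ?thesis using \<open>Re L > 0\<close> by (simp add: slope_def power_divide divide_less_eq)
qed

lemma compact_subset_level_domain:
  assumes X: "compact X" "X \<subseteq> level_set - {complex_of_real x_star}"
  obtains r \<alpha> \<delta> where "0 \<le> r" "r < 1" "\<alpha> > 0" "\<delta> > 0" "X \<subseteq> level_domain r \<alpha> \<delta>"
proof -
  note level_x = level_set_minus_x_star[OF subsetD[OF X(2)]]
  have level: "Im (x ^ k) \<noteq> 0" if "x \<in> X" "k \<in> {1, 2}" for x k
    using level_x(4,5)[OF that(1)] that(2) by auto
  have L_pos: "Re (L_phase k x) > 0" if "x \<in> X" "k \<in> {1, 2}" for x k
    using level_x(1,2)[OF that(1)] that(2) by (intro Re_L_phase_pos) auto
  have cont: "continuous_on X (L_phase k)" if "k \<in> {1, 2}" for k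
    using level level_x(2) that by (intro continuous_on_L_phase) auto
  have "\<exists>\<delta>>0. \<forall>x\<in>X. \<delta> \<le> 3 - (slope (L_phase k x))\<^sup>2" if k: "k \<in> {1, 2}" for k
  proof -
    have "Re (L_phase k x) \<noteq> 0" if "x \<in> X" for x using L_pos[OF that k] by simp
    then have cont_slope: "continuous_on X (\<lambda>x. 3 - (slope (L_phase k x))\<^sup>2)"
      unfolding slope_def by (intro continuous_intros cont k) auto
    have pos: "0 < 3 - (slope (L_phase k x))\<^sup>2" if "x \<in> X" for x
      using slope_square_less[OF norm_L_phase_less[OF level_x(2)[OF that] level[OF that k]]] by simp
    show ?thesis by (rule compact_positive_lower_bound[OF X(1) cont_slope pos]) auto
  qed
  from this[of 1] this[of 2] obtain \<delta>1 \<delta>2 where \<delta>: "\<delta>1 > 0" "\<delta>2 > 0"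
    "\<And>x. x \<in> X \<Longrightarrow> \<delta>1 \<le> 3 - (slope (L_phase 1 x))\<^sup>2" "\<And>x. x \<in> X \<Longrightarrow> \<delta>2 \<le> 3 - (slope (L_phase 2 x))\<^sup>2"
    by auto
  obtain r where r: "0 \<le> r" "r < 1" "\<And>x. x \<in> X \<Longrightarrow> norm x \<le> r"
    by (rule compact_norm_upper_bound[OF X(1) level_x(2)]) auto
  obtain \<alpha> where \<alpha>: "\<alpha> > 0" "\<And>x. x \<in> X \<Longrightarrow> \<alpha> \<le> Re (L_phase 1 x)"
    using compact_positive_lower_bound[OF X(1) continuous_on_Re[OF cont[OF insertI1]] L_pos[OF _ insertI1]] by blast
  have "X \<subseteq> level_domain r \<alpha> (min \<delta>1 \<delta>2)"
    using r(3) \<alpha>(2) level_x(1,3) \<delta>(3,4)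
    by (auto simp: level_domain_def phase_domain_def min_le_iff_disj simp del: One_nat_def)
  then show ?thesis using that[OF r(1,2) \<alpha>(1), of "min \<delta>1 \<delta>2"] \<delta>(1,2) by simp
qed

theorem pp_poly_asymp_level_set:
  assumes X: "compact X" "X \<subseteq> level_set - {complex_of_real x_star}"
  shows "\<exists>(E1 :: nat \<Rightarrow> complex \<Rightarrow> complex) (E2 :: nat \<Rightarrow> complex \<Rightarrow> complex) (C :: real).
    \<forall>\<^sub>F n in sequentially. \<forall>x\<in>X.
      norm (E1 n x) \<le> C * real n powr (-1/3) \<and> norm (E2 n x) \<le> C * real n powr (-1/3) \<and>
      pp_poly n x = saddle_term 1 n x * (1 + E1 n x) + (-1) ^ n * saddle_term 2 n x * (1 + E2 n x)"
proof -
  obtain r \<alpha> \<delta> where bounds: "0 \<le> r" "r < 1" "\<alpha> > 0" "\<delta> > 0" and X_sub: "X \<subseteq> level_domain r \<alpha> \<delta>"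
    by (rule compact_subset_level_domain[OF X])
  obtain C N where "\<And>x n. x \<in> level_domain r \<alpha> \<delta> \<Longrightarrow> n \<ge> N \<Longrightarrow>
    \<exists>e1 e2. norm e1 \<le> C * real n powr (-1/3) \<and> norm e2 \<le> C * real n powr (-1/3) \<and>
      pp_poly n x = saddle_term 1 n x * (1 + e1) + (-1) ^ n * saddle_term 2 n x * (1 + e2)"
    using pp_poly_level_domain[OF bounds] by metis
  then have "\<forall>\<^sub>F n in sequentially. \<forall>x\<in>X. \<exists>e1 e2. norm e1 \<le> C * real n powr (-1/3) \<and> norm e2 \<le> C * real n powr (-1/3) \<and>
      pp_poly n x = saddle_term 1 n x * (1 + e1) + (-1) ^ n * saddle_term 2 n x * (1 + e2)"
    using X_sub by (intro eventually_mono[OF eventually_ge_at_top[of N]]) blast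
  from eventually_Ball_choice2[OF this] show ?thesis by blast
qed

section \<open>The asymptotics at negative real arguments\<close>

subsection \<open>The arc near \<open>-1\<close>\<close>

lemma norm_circle_integrand_le:
  assumes "\<sigma> > 0" "norm (pp_log_error k x (Complex \<sigma> \<theta>)) \<le> 1"
  shows "norm (circle_integrand k x \<sigma> n \<theta>) \<le> exp (norm (L_phase k x) ^ 3 / (2 * \<sigma>\<^sup>2) + Re (pp_const k x) + 1 + real n * \<sigma>)"
proof -
  let ?w = "Complex \<sigma> \<theta>"
  have "\<sigma>\<^sup>2 \<le> norm ?w ^ 2" using complex_Re_le_cmod[of ?w] assms(1) by (intro power_mono) auto
  then have "norm (L_phase k x ^ 3 / (2 * ?w\<^sup>2)) \<le> norm (L_phase k x) ^ 3 / (2 * \<sigma>\<^sup>2)"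
    unfolding norm_divide norm_mult norm_power using assms(1) by (intro frac_le) auto
  then have "Re (L_phase k x ^ 3 / (2 * ?w\<^sup>2)) \<le> norm (L_phase k x) ^ 3 / (2 * \<sigma>\<^sup>2)"
    using complex_Re_le_cmod order_trans by blast
  moreover have "Re (pp_log_error k x ?w) \<le> 1" using complex_Re_le_cmod assms(2) by (rule order_trans)
  ultimately have "Re (pp_log x ((-1) ^ Suc k * exp (- ?w))) \<le> norm (L_phase k x) ^ 3 / (2 * \<sigma>\<^sup>2) + Re (pp_const k x) + 1"
    unfolding pp_log_error_def minus_complex.sel plus_complex.sel by argo
  then show ?thesis by (simp add: circle_integrand_def norm_exp_eq_Re)
qed

lemma norm_circle_integrand_2_le:
  assumes x: "norm x \<le> r" "r < 1" and L: "Re L > 0" and n: "n > 0"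
    and smaller: "norm (L_phase 2 x) ^ 3 \<le> (1 - 2 * \<epsilon>) * Re L ^ 3"
  defines "\<sigma> \<equiv> saddle_abscissa L n" and "\<nu> \<equiv> saddle_scale L n"
  assumes error: "norm (pp_log_error 2 x (Complex \<sigma> \<theta>)) \<le> 1"
  shows "norm (circle_integrand 2 x \<sigma> n \<theta>) \<le> exp (ln 2 / 24 + ln (2 / (1 - r)) / 8 + 1) * exp ((3/2 - \<epsilon>) * \<nu>)"
proof -
  note scaling = saddle_abscissa_scale[OF L n, folded \<sigma>_def \<nu>_def]
  have "norm (circle_integrand 2 x \<sigma> n \<theta>) \<le> exp (norm (L_phase 2 x) ^ 3 / (2 * \<sigma>\<^sup>2) + Re (pp_const 2 x) + 1 + real n * \<sigma>)"
    by (rule norm_circle_integrand_le[OF scaling(1) error])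
  also have "norm (L_phase 2 x) ^ 3 / (2 * \<sigma>\<^sup>2) \<le> (1 - 2 * \<epsilon>) * (\<sigma>\<^sup>2 * \<nu>) / (2 * \<sigma>\<^sup>2)"
    unfolding scaling(3) using smaller by (intro divide_right_mono) auto
  also have "(1 - 2 * \<epsilon>) * (\<sigma>\<^sup>2 * \<nu>) / (2 * \<sigma>\<^sup>2) = (1/2 - \<epsilon>) * \<nu>" using scaling(1) by (simp add: field_simps)
  also have "Re (pp_const 2 x) \<le> ln 2 / 24 + ln (2 / (1 - r)) / 8" by (rule Re_pp_const_2_le[OF x])
  also have "(1/2 - \<epsilon>) * \<nu> + (ln 2 / 24 + ln (2 / (1 - r)) / 8) + 1 + real n * \<sigma> =
      (ln 2 / 24 + ln (2 / (1 - r)) / 8 + 1) + (3/2 - \<epsilon>) * \<nu>"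
    unfolding scaling(4) by (simp add: algebra_simps)
  finally show ?thesis by (simp add: exp_add)
qed

lemma major_arc_2_le_exp:
  assumes r: "0 \<le> r" "r < 1" and \<alpha>: "\<alpha> > 0"
  obtains B N where "B \<ge> 0" "N > 0" "\<And>x n \<epsilon>. x \<in> phase_domain 1 r \<alpha> \<Longrightarrow>
    norm (L_phase 2 x) ^ 3 \<le> (1 - 2 * \<epsilon>) * Re (L_phase 1 x) ^ 3 \<Longrightarrow> n \<ge> N \<Longrightarrow>
    norm (major_arc 2 x n) \<le> B * exp ((3/2 - \<epsilon>) * saddle_scale (L_phase 1 x) n)"
proof -
  obtain E where E: "E \<ge> 0" "\<And>j k x n t. j \<in> {1, 2} \<Longrightarrow> k \<in> {1, 2} \<Longrightarrow> 0 < norm x \<Longrightarrow> norm x \<le> r \<Longrightarrow> n > 0 \<Longrightarrow> \<bar>t\<bar> \<le> 24 \<Longrightarrow>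
    norm (pp_log_error k x (Complex (saddle_abscissa (L_phase j x) n) (saddle_abscissa (L_phase j x) n * t)))
    \<le> E / saddle_scale (L_phase j x) n"
    using norm_pp_log_error_arc_le[OF r] by blast
  obtain N where N: "\<And>L n. \<alpha> \<le> Re L \<Longrightarrow> n \<ge> N \<Longrightarrow> E \<le> saddle_scale L n"
    using eventually_saddle_scale_ge[OF \<alpha>] by blast
  define B where "B = exp (ln 2 / 24 + ln (2 / (1 - r)) / 8 + 1)"
  show ?thesis
  proof (rule that[of "2 * B" "max N (48 ^ 3)"])
    fix x n \<epsilon> assume "x \<in> phase_domain 1 r \<alpha>" and n: "n \<ge> max N (48 ^ 3)"
      and smaller: "norm (L_phase 2 x) ^ 3 \<le> (1 - 2 * \<epsilon>) * Re (L_phase 1 x) ^ 3"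
    then have x: "0 < norm x" "norm x \<le> r" "norm x < 1" and \<alpha>_le: "\<alpha> \<le> Re (L_phase 1 x)" and n_pos: "n > 0"
      using r by (auto simp: phase_domain_def)
    then have L: "Re (L_phase 1 x) > 0" using \<alpha> by simp
    define \<sigma> \<nu> where "\<sigma> = saddle_abscissa (L_phase 1 x) n" and "\<nu> = saddle_scale (L_phase 1 x) n"
    have \<sigma>\<nu>: "\<sigma> > 0" "\<nu> > 0" using saddle_abscissa_scale[OF L n_pos] by (auto simp: \<sigma>_def \<nu>_def)
    have "norm (circle_integrand 2 x \<sigma> n \<theta>) \<le> B * exp ((3/2 - \<epsilon>) * \<nu>)" if \<theta>: "\<theta> \<in> {\<sigma> * -24..\<sigma> * 24}" for \<theta>
    proof -
      have "\<bar>\<theta> / \<sigma>\<bar> \<le> 24" using \<theta> \<sigma>\<nu>(1) by (auto simp: abs_divide divide_le_eq abs_le_iff mult.commute)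
      then have "norm (pp_log_error 2 x (Complex \<sigma> \<theta>)) \<le> E / \<nu>"
        using E(2)[of 1 2, OF _ _ x(1,2) n_pos, of "\<theta> / \<sigma>", folded \<sigma>_def \<nu>_def] \<sigma>\<nu>(1) by simp
      also have "\<dots> \<le> 1" using N[of "L_phase 1 x" n] n \<alpha>_le \<sigma>\<nu>(2) by (simp add: \<nu>_def)
      finally show ?thesis
        unfolding B_def \<sigma>_def \<nu>_def by (rule norm_circle_integrand_2_le[OF x(2) r(2) L n_pos smaller])
    qed
    then have "norm (major_arc 2 x n) \<le> B * exp ((3/2 - \<epsilon>) * \<nu>) * (\<sigma> * 24 - \<sigma> * -24)"
      unfolding major_arc_def circle_arc_def \<sigma>_def[symmetric]
      using \<sigma>\<nu>(1) by (intro integral_bound continuous_on_circle_integrand x) auto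
    also have "\<dots> \<le> B * exp ((3/2 - \<epsilon>) * \<nu>) * 2"
      using saddle_abscissa_L_phase_1[OF x(1,3), of n] n by (intro mult_left_mono) (auto simp: \<sigma>_def B_def)
    finally show "norm (major_arc 2 x n) \<le> 2 * B * exp ((3/2 - \<epsilon>) * saddle_scale (L_phase 1 x) n)"
      by (simp add: \<nu>_def)
  qed (auto simp: B_def)
qed

lemma major_arc_2_negligible:
  assumes r: "0 \<le> r" "r < 1" and \<alpha>: "\<alpha> > 0" and \<epsilon>: "\<epsilon> > 0"
  obtains Z N where "Z \<ge> 0" "N > 0" "\<And>x n. x \<in> phase_domain 1 r \<alpha> \<Longrightarrow>
    norm (L_phase 2 x) ^ 3 \<le> (1 - 2 * \<epsilon>) * Re (L_phase 1 x) ^ 3 \<Longrightarrow> n \<ge> N \<Longrightarrow>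
    norm (major_arc 2 x n) \<le> norm (2 * of_real pi * saddle_term 1 n x) * (Z * real n powr (-1/3))"
proof -
  obtain B N where B: "B \<ge> 0" "N > 0" "\<And>x n. x \<in> phase_domain 1 r \<alpha> \<Longrightarrow>
    norm (L_phase 2 x) ^ 3 \<le> (1 - 2 * \<epsilon>) * Re (L_phase 1 x) ^ 3 \<Longrightarrow> n \<ge> N \<Longrightarrow>
    norm (major_arc 2 x n) \<le> B * exp ((3/2 - \<epsilon>) * saddle_scale (L_phase 1 x) n)"
    using major_arc_2_le_exp[OF r \<alpha>] by metis
  define Z where "Z = B * (2 * sqrt (6 * pi / \<alpha>) * exp (- (ln (1 - r) / 12)) / (\<epsilon> * \<alpha>)\<^sup>2)"
  have Z: "Z \<ge> 0" using B(1) \<alpha> by (simp add: Z_def)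
  show ?thesis
  proof (rule that[of "Z / (2 * pi)" N])
    fix x n assume x: "x \<in> phase_domain 1 r \<alpha>" "norm (L_phase 2 x) ^ 3 \<le> (1 - 2 * \<epsilon>) * Re (L_phase 1 x) ^ 3" and n: "n \<ge> N"
    have "norm (major_arc 2 x n) \<le> norm (saddle_term 1 n x) * (Z * real n powr (-1/3))"
      unfolding Z_def saddle_term_def using x n B
      by (intro negligible_of_exp_smaller \<alpha> \<epsilon> ln_le_Re_pp_const_1[OF _ r(2)] B(3)) (auto simp: phase_domain_def)
    then show "norm (major_arc 2 x n) \<le> norm (2 * of_real pi * saddle_term 1 n x) * (Z / (2 * pi) * real n powr (-1/3))"
      by (simp add: norm_mult)
  qed (use Z B in auto)
qed

subsection \<open>Conjugate saddle points\<close>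

lemma
  assumes "-1 < x" "x < 0"
  shows Re_L_phase_1_of_neg_real: "Re (L_phase 1 (of_real x)) = (2 * \<bar>Li3 x\<bar>) powr (1/3) / 2"
    and Im_L_phase_1_of_neg_real: "Im (L_phase 1 (of_real x)) = sqrt 3 * Re (L_phase 1 (of_real x))"
  unfolding L_phase_1_of_neg_real[OF assms] by (simp_all add: Re_exp Im_exp cos_60 sin_60)

lemma L_phase_cubes_of_neg_real:
  fixes x :: real assumes "-1 < x" "x < 0"
  shows "norm (L_phase 2 (of_real x)) ^ 3 = Li3 (x\<^sup>2) / 4" "Re (L_phase 1 (of_real x)) ^ 3 = \<bar>Li3 x\<bar> / 4"
proof -
  have "0 < x\<^sup>2" "x\<^sup>2 < 1" using assms by (auto simp: abs_square_less_1)
  then show "norm (L_phase 2 (of_real x)) ^ 3 = Li3 (x\<^sup>2) / 4"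
    using norm_L_phase_cube[of "of_real x" 2] assms Li3_real_pos[of "x\<^sup>2"] Li3_of_real[of "x\<^sup>2"] by simp
  show "Re (L_phase 1 (of_real x)) ^ 3 = \<bar>Li3 x\<bar> / 4"
    unfolding Re_L_phase_1_of_neg_real[OF assms]
    using powr_powr[of "2 * \<bar>Li3 x\<bar>" "1/3" 3] by (simp add: power_divide)
qed

lemma pp_log_cnj:
  assumes "norm x < 1" "norm u < 1" shows "pp_log (cnj x) (cnj u) = cnj (pp_log x u)"
proof -
  have "(\<lambda>k. cnj (x ^ Suc k / of_nat (Suc k) * koebe (u ^ Suc k))) sums cnj (pp_log x u)"
    using pp_log_sums[OF assms] by (subst sums_cnj)
  then have "(\<lambda>k. cnj x ^ Suc k / of_nat (Suc k) * koebe (cnj u ^ Suc k)) sums cnj (pp_log x u)"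
    by (simp add: koebe_def)
  then show ?thesis using pp_log_sums[of "cnj x" "cnj u"] assms by (auto intro: sums_unique2)
qed

lemma circle_integrand_uminus:
  assumes "\<bar>x\<bar> < 1" "\<sigma> > 0"
  shows "circle_integrand k (of_real x) \<sigma> n (- \<theta>) = cnj (circle_integrand k (of_real x) \<sigma> n \<theta>)"
proof -
  have "Complex \<sigma> (- \<theta>) = cnj (Complex \<sigma> \<theta>)" by (simp add: complex_eq_iff)
  moreover have "pp_log (of_real x) (cnj ((-1) ^ Suc k * exp (- Complex \<sigma> \<theta>))) =
      cnj (pp_log (of_real x) ((-1) ^ Suc k * exp (- Complex \<sigma> \<theta>)))"
    using pp_log_cnj[of "of_real x" "(-1) ^ Suc k * exp (- Complex \<sigma> \<theta>)"] assms by simp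
  ultimately show ?thesis by (simp add: circle_integrand_def exp_cnj)
qed

lemma Re_integral_symmetric_cnj:
  fixes f :: "real \<Rightarrow> complex"
  assumes f: "f integrable_on {-d..d}" "\<And>t. f (- t) = cnj (f t)" and d: "d \<ge> 0"
  shows "Re (integral {-d..d} f) = 2 * Re (integral {0..d} f)"
proof -
  have "integral {-d..d} f = integral {-d..0} f + integral {0..d} f"
    using d f(1) by (intro Henstock_Kurzweil_Integration.integral_combine[symmetric]) auto
  also have "integral {-d..0} f = integral {0..d} (\<lambda>t. f (- t))"
    using Henstock_Kurzweil_Integration.integral_reflect_real[where a = 0 and b = d and f = "\<lambda>t. f (- t)"] by simp
  also have "\<dots> = cnj (integral {0..d} f)" unfolding f(2) by (rule integral_cnj[symmetric])
  finally show ?thesis by simp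
qed

definition negative_domain :: "real \<Rightarrow> real \<Rightarrow> real \<Rightarrow> real set" where
  "negative_domain r \<alpha> \<epsilon> = {x. x < 0 \<and> of_real x \<in> phase_domain 1 r \<alpha> \<and>
     norm (L_phase 2 (of_real x)) ^ 3 \<le> (1 - 2 * \<epsilon>) * Re (L_phase 1 (of_real x)) ^ 3}"

lemma saddle_range_half_arc: "saddle_range 3 (sqrt 3) 0 24"
proof -
  have "3 \<le> (t + sqrt 3)\<^sup>2 + 3 - (sqrt 3)\<^sup>2" if "t \<in> {0..24}" for t
    using that power_mono[of "sqrt 3" "t + sqrt 3" 2] by simp
  moreover have "0 + 1 \<le> sqrt 3" "sqrt 3 + 1 \<le> 24"
    using real_sqrt_le_iff[of 3 "4"] by auto
  ultimately show ?thesis by (simp add: saddle_range_def)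
qed

lemma Re_major_arc_1_of_real:
  assumes r: "0 \<le> r" "r < 1" and \<alpha>: "\<alpha> > 0"
  obtains C N where "C \<ge> 0" "N > 0" "\<And>x n. x < 0 \<Longrightarrow> of_real x \<in> phase_domain 1 r \<alpha> \<Longrightarrow> n \<ge> N \<Longrightarrow>
    \<bar>Re (major_arc 1 (of_real x) n) - 2 * Re (2 * of_real pi * saddle_term 1 n (of_real x))\<bar>
    \<le> 2 * norm (2 * of_real pi * saddle_term 1 n (of_real x)) * (C * real n powr (-1/3))"
proof -
  obtain C N where CN: "C \<ge> 0" "N > 0" and arc: "\<And>k x n p q. k \<in> {1, 2} \<Longrightarrow> x \<in> phase_domain k r \<alpha> \<Longrightarrow> n \<ge> N \<Longrightarrow>
    saddle_range 3 (slope (L_phase k x)) p q \<Longrightarrow>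
    norm (circle_arc k x (saddle_abscissa (L_phase k x) n) n p q - 2 * of_real pi * saddle_term k n x)
    \<le> norm (2 * of_real pi * saddle_term k n x) * (C * real n powr (-1/3))"
    using circle_arc_saddle_term[OF r \<alpha>, of 3] by auto
  show ?thesis
  proof (rule that[OF CN])
    fix x :: real and n assume neg: "x < 0" and dom: "of_real x \<in> phase_domain 1 r \<alpha>" and n: "n \<ge> N"
    then have x: "-1 < x" "\<bar>x\<bar> < 1" and Re_pos: "Re (L_phase 1 (of_real x)) > 0"
      using r \<alpha> by (auto simp: phase_domain_def)
    define \<sigma> where "\<sigma> = saddle_abscissa (L_phase 1 (of_real x)) n"
    let ?M = "2 * of_real pi * saddle_term 1 n (of_real x)" and ?half = "circle_arc 1 (of_real x) \<sigma> n 0 24"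
    have \<sigma>: "\<sigma> > 0" using saddle_abscissa_pos[OF Re_pos] n CN(2) by (simp add: \<sigma>_def)
    have "slope (L_phase 1 (of_real x)) = sqrt 3"
      using Im_L_phase_1_of_neg_real[OF x(1) neg] Re_pos by (simp add: slope_def)
    then have "norm (?half - ?M) \<le> norm ?M * (C * real n powr (-1/3))"
      using arc[of 1 "of_real x", OF _ dom n] saddle_range_half_arc by (simp add: \<sigma>_def)
    then have "\<bar>Re (?half - ?M)\<bar> \<le> norm ?M * (C * real n powr (-1/3))"
      using abs_Re_le_cmod order_trans by blast
    moreover have "Re (major_arc 1 (of_real x) n) = 2 * Re ?half"
      unfolding major_arc_def circle_arc_def \<sigma>_def[symmetric]
      using Re_integral_symmetric_cnj[of "circle_integrand 1 (of_real x) \<sigma> n" "\<sigma> * 24"] \<sigma> x(2)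
      by (simp add: circle_integrand_uminus integrable_circle_integrand)
    ultimately show "\<bar>Re (major_arc 1 (of_real x) n) - 2 * Re ?M\<bar> \<le> 2 * norm ?M * (C * real n powr (-1/3))"
      unfolding minus_complex.sel by (simp only: abs_le_iff mult.assoc) argo
  qed
qed

lemma abs_Re_minus_double_le:
  assumes "\<bar>Re u - 2 * Re M\<bar> \<le> 2 * norm M * \<eta>" "norm v \<le> norm M * \<zeta>" "norm (z - (u + v)) \<le> norm M * \<xi>"
    and "0 \<le> \<zeta>" "0 \<le> \<xi>"
  shows "\<bar>Re z - 2 * Re M\<bar> \<le> 2 * norm M * (\<eta> + \<zeta> + \<xi>)"
proof -
  have "\<bar>Re v\<bar> \<le> norm M * \<zeta>" "\<bar>Re (z - (u + v))\<bar> \<le> norm M * \<xi>"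
    using assms(2,3) abs_Re_le_cmod order_trans by blast+
  moreover have "0 \<le> norm M * \<zeta>" "0 \<le> norm M * \<xi>" using assms(4,5) by auto
  ultimately have "\<bar>Re z - 2 * Re M\<bar> \<le> 2 * norm M * \<eta> + 2 * (norm M * \<zeta>) + 2 * (norm M * \<xi>)"
    using assms(1) unfolding minus_complex.sel plus_complex.sel by linarith
  then show ?thesis by (simp add: distrib_left mult.assoc)
qed

lemma pp_poly_negative_domain:
  assumes r: "0 \<le> r" "r < 1" and \<alpha>: "\<alpha> > 0" and \<epsilon>: "\<epsilon> > 0"
  obtains C N where "N > 0" "\<And>x n. x \<in> negative_domain r \<alpha> \<epsilon> \<Longrightarrow> n \<ge> N \<Longrightarrow>
    \<bar>pp_poly n x - 2 * Re (saddle_term 1 n (of_real x))\<bar> \<le> 2 * norm (saddle_term 1 n (of_real x)) * (C * real n powr (-1/3))"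
proof -
  obtain C1 N1 where CN1: "C1 \<ge> 0" "N1 > 0" and arc_1: "\<And>x n. x < 0 \<Longrightarrow> of_real x \<in> phase_domain 1 r \<alpha> \<Longrightarrow> n \<ge> N1 \<Longrightarrow>
    \<bar>Re (major_arc 1 (of_real x) n) - 2 * Re (2 * of_real pi * saddle_term 1 n (of_real x))\<bar>
    \<le> 2 * norm (2 * of_real pi * saddle_term 1 n (of_real x)) * (C1 * real n powr (-1/3))"
    using Re_major_arc_1_of_real[OF r \<alpha>] by metis
  obtain C2 N2 where CN2: "C2 \<ge> 0" "N2 > 0" and arc_2: "\<And>x n. x \<in> phase_domain 1 r \<alpha> \<Longrightarrow>
    norm (L_phase 2 x) ^ 3 \<le> (1 - 2 * \<epsilon>) * Re (L_phase 1 x) ^ 3 \<Longrightarrow> n \<ge> N2 \<Longrightarrow>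
    norm (major_arc 2 x n) \<le> norm (2 * of_real pi * saddle_term 1 n x) * (C2 * real n powr (-1/3))"
    using major_arc_2_negligible[OF assms] by metis
  obtain C3 where C3: "C3 \<ge> 0" and minor: "\<And>x n. x \<in> phase_domain 1 r \<alpha> \<Longrightarrow> n \<ge> 48 ^ 3 \<Longrightarrow>
    norm (2 * of_real pi * pp_poly n x - (major_arc 1 x n + (-1) ^ n * major_arc 2 x n))
    \<le> norm (2 * of_real pi * saddle_term 1 n x) * (C3 * real n powr (-1/3))"
    using minor_arcs_negligible[OF r(2) \<alpha>] by metis
  show ?thesis
  proof (rule that[of "max (max N1 N2) (48 ^ 3)" "C1 + C2 + C3"])
    fix x n assume x: "x \<in> negative_domain r \<alpha> \<epsilon>" and n: "n \<ge> max (max N1 N2) (48 ^ 3)"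
    define z where "z = complex_of_real x"
    let ?\<eta> = "real n powr (-1/3)" and ?M = "2 * of_real pi * saddle_term 1 n z"
    have "\<bar>Re (major_arc 1 z n) - 2 * Re ?M\<bar> \<le> 2 * norm ?M * (C1 * ?\<eta>)"
      unfolding z_def using x n by (intro arc_1) (auto simp: negative_domain_def)
    moreover have "norm ((-1) ^ n * major_arc 2 z n) \<le> norm ?M * (C2 * ?\<eta>)"
      unfolding norm_minus_one_power_mult z_def using x n by (intro arc_2) (auto simp: negative_domain_def)
    moreover have "norm (2 * of_real pi * pp_poly n z - (major_arc 1 z n + (-1) ^ n * major_arc 2 z n)) \<le> norm ?M * (C3 * ?\<eta>)"
      unfolding z_def using x n by (intro minor) (auto simp: negative_domain_def)
    ultimately have "\<bar>Re (2 * of_real pi * pp_poly n z) - 2 * Re ?M\<bar> \<le> 2 * norm ?M * (C1 * ?\<eta> + C2 * ?\<eta> + C3 * ?\<eta>)"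
      using CN2 C3 by (intro abs_Re_minus_double_le) auto
    also have "2 * of_real pi * pp_poly n z = of_real (2 * pi * pp_poly n x)" by (simp add: pp_poly_def z_def)
    also have "Re (of_real (2 * pi * pp_poly n x)) - 2 * Re ?M = 2 * pi * (pp_poly n x - 2 * Re (saddle_term 1 n z))"
      by (simp add: algebra_simps)
    also have "2 * norm ?M * (C1 * ?\<eta> + C2 * ?\<eta> + C3 * ?\<eta>) =
        2 * pi * (2 * norm (saddle_term 1 n z) * ((C1 + C2 + C3) * ?\<eta>))"
      by (simp add: norm_mult algebra_simps)
    finally show "\<bar>pp_poly n x - 2 * Re (saddle_term 1 n (of_real x))\<bar>
        \<le> 2 * norm (saddle_term 1 n (of_real x)) * ((C1 + C2 + C3) * ?\<eta>)"
      unfolding abs_mult z_def by (simp add: mult_ac)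
  qed simp
qed

subsection \<open>Amplitude and phase\<close>

definition real_amplitude :: "nat \<Rightarrow> real \<Rightarrow> real" where
  "real_amplitude n x = 2 powr (7/6) * root 12 (1 - x) * (1 / sqrt (6 * pi * real n powr (4/3)))
     * \<bar>Li3 x\<bar> powr (1/6) * exp (3/4 * root 3 2 * real n powr (2/3) * \<bar>Li3 x\<bar> powr (1/3))"

definition real_phase :: "nat \<Rightarrow> real \<Rightarrow> real" where
  "real_phase n x = 3 * sqrt 3 / 4 * root 3 2 * real n powr (2/3) * \<bar>Li3 x\<bar> powr (1/3) + pi / 6"

lemma csqrt_polar:
  assumes "\<rho> > 0" "\<bar>\<phi>\<bar> < pi"
  shows "csqrt (of_real \<rho> * exp (\<i> * of_real \<phi>)) = of_real (sqrt \<rho>) * exp (\<i> * of_real (\<phi> / 2))"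
proof (rule csqrt_unique)
  have "(of_real (sqrt \<rho>) :: complex)\<^sup>2 = of_real \<rho>" using assms(1) by (simp flip: of_real_power)
  then show "(of_real (sqrt \<rho>) * exp (\<i> * of_real (\<phi> / 2)))\<^sup>2 = of_real \<rho> * exp (\<i> * of_real \<phi>)"
    by (simp add: power_mult_distrib exp_double[symmetric])
  have "0 < sqrt \<rho> * cos (\<phi> / 2)" using assms by (intro mult_pos_pos cos_gt_zero_pi) auto
  then show "0 < Re (of_real (sqrt \<rho>) * exp (\<i> * of_real (\<phi> / 2))) \<or>
      Re (of_real (sqrt \<rho>) * exp (\<i> * of_real (\<phi> / 2))) = 0 \<and> 0 \<le> Im (of_real (sqrt \<rho>) * exp (\<i> * of_real (\<phi> / 2)))"
    by (simp add: Re_exp)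
qed

lemma exp_pp_const_1_of_real:
  assumes "x < 1" shows "exp (pp_const 1 (of_real x)) = of_real (root 12 (1 - x))"
proof -
  have "Ln (1 - complex_of_real x) = of_real (ln (1 - x))"
    using assms Ln_of_real[of "1 - x"] by simp
  then have "exp (pp_const 1 (of_real x)) = of_real (exp (ln (1 - x) / 12))"
    by (simp add: pp_const_def flip: exp_of_real)
  also have "exp (ln (1 - x) / 12) = root 12 (1 - x)" using assms by (simp add: root_powr_inverse powr_def)
  finally show ?thesis .
qed

lemma csqrt_L_phase_1_of_neg_real:
  assumes x: "-1 < x" "x < 0" and m: "m > 0"
  shows "csqrt (L_phase 1 (of_real x) / of_real m) =
    of_real (2 powr (7/6) * \<bar>Li3 x\<bar> powr (1/6) / sqrt m / 2) * exp (\<i> * of_real (pi / 6))"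
proof -
  let ?l = "\<bar>Li3 x\<bar>"
  have l: "?l > 0" using Li3_real_neg[of x] x by auto
  have "csqrt (L_phase 1 (of_real x) / of_real m) = csqrt (of_real ((2 * ?l) powr (1/3) / m) * exp (\<i> * of_real (pi / 3)))"
    unfolding L_phase_1_of_neg_real[OF x] by simp
  also have "\<dots> = of_real (sqrt ((2 * ?l) powr (1/3) / m)) * exp (\<i> * of_real (pi / 3 / 2))"
    using l m by (intro csqrt_polar) auto
  also have "sqrt ((2 * ?l) powr (1/3) / m) = (2 * ?l) powr (1/6) / sqrt m"
    using l by (simp add: real_sqrt_divide powr_half_sqrt[symmetric] powr_powr)
  also have "(2 * ?l) powr (1/6) = 2 powr (7/6) * ?l powr (1/6) / 2"
    using l powr_add[of 2 1 "1/6 :: real"] by (simp add: powr_mult)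
  finally show ?thesis by simp
qed

lemma exp_L_phase_1_of_neg_real:
  fixes s :: real assumes "-1 < x" "x < 0"
  shows "exp (3/2 * of_real s * L_phase 1 (of_real x)) =
    of_real (exp (3/4 * root 3 2 * s * \<bar>Li3 x\<bar> powr (1/3))) *
    exp (\<i> * of_real (3 * sqrt 3 / 4 * root 3 2 * s * \<bar>Li3 x\<bar> powr (1/3)))"
proof -
  have "(2 * \<bar>Li3 x\<bar>) powr (1/3) = root 3 2 * \<bar>Li3 x\<bar> powr (1/3)"
    by (simp add: root_powr_inverse powr_mult)
  then have "3/2 * of_real s * L_phase 1 (of_real x) = of_real (3/4 * root 3 2 * s * \<bar>Li3 x\<bar> powr (1/3)) +
      \<i> * of_real (3 * sqrt 3 / 4 * root 3 2 * s * \<bar>Li3 x\<bar> powr (1/3))"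
    using Re_L_phase_1_of_neg_real[OF assms] Im_L_phase_1_of_neg_real[OF assms]
    by (simp add: complex_eq_iff)
  then show ?thesis by (simp only: exp_add exp_of_real)
qed

lemma saddle_term_1_of_neg_real:
  assumes x: "-1 < x" "x < 0" and n: "n > 0"
  shows "saddle_term 1 n (of_real x) = of_real (real_amplitude n x / 2) * exp (\<i> * of_real (real_phase n x))"
proof -
  have "6 * pi * real n powr (4/3) > 0" "x < 1" using x n by auto
  then show ?thesis
    unfolding saddle_term_def saddle_main_def real_amplitude_def real_phase_def
      exp_pp_const_1_of_real[OF \<open>x < 1\<close>] exp_L_phase_1_of_neg_real[OF x]
      csqrt_L_phase_1_of_neg_real[OF x \<open>6 * pi * real n powr (4/3) > 0\<close>] of_real_add distrib_left exp_add
    by (simp add: mult_ac)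
qed

lemma real_amplitude_pos:
  assumes "-1 < x" "x < 0" "n > 0" shows "real_amplitude n x > 0"
  using assms Li3_real_neg[of x] by (simp add: real_amplitude_def)

lemma compact_subset_negative_domain:
  assumes X: "compact X" "X \<subseteq> {x_star<..<0}"
  obtains r \<alpha> \<epsilon> where "0 \<le> r" "r < 1" "\<alpha> > 0" "\<epsilon> > 0" "X \<subseteq> negative_domain r \<alpha> \<epsilon>"
proof -
  have x: "-1 < x" "x < 0" "x_star < x" if "x \<in> X" for x using that X(2) x_star_gt by fastforce+
  have square: "0 < x\<^sup>2" "x\<^sup>2 < 1" if "x \<in> X" for x using x[OF that] by (auto simp: abs_square_less_1)
  have "X \<subseteq> {-1<..<1}" using x by (force intro: less_trans[of _ 0])
  then have cont_Li3: "continuous_on X Li3" by (rule continuous_on_subset[OF continuous_on_Li3_real])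
  have "x\<^sup>2 \<in> {-1<..<1}" if "x \<in> X" for x
    unfolding greaterThanLessThan_iff using square[OF that] by linarith
  then have "continuous_on X (\<lambda>x. Li3 (x\<^sup>2))"
    by (intro continuous_on_compose2[OF continuous_on_Li3_real] continuous_intros) auto
  note cont = cont_Li3 this
  have nonzero: "\<bar>Li3 x\<bar> \<noteq> 0" if "x \<in> X" for x using Li3_real_neg[of x] x[OF that] by simp
  have "norm x < 1" if "x \<in> X" for x using x[OF that] by simp
  then obtain r where r: "0 \<le> r" "r < 1" "\<And>x. x \<in> X \<Longrightarrow> norm x \<le> r"
    by (rule compact_norm_upper_bound[OF X(1)]) auto
  have "continuous_on X (\<lambda>x. (2 * \<bar>Li3 x\<bar>) powr (1/3) / 2)"
    using nonzero by (intro continuous_intros cont) auto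
  moreover have "0 < (2 * \<bar>Li3 x\<bar>) powr (1/3) / 2" if "x \<in> X" for x using nonzero[OF that] by simp
  ultimately obtain \<alpha> where \<alpha>: "\<alpha> > 0" "\<And>x. x \<in> X \<Longrightarrow> \<alpha> \<le> (2 * \<bar>Li3 x\<bar>) powr (1/3) / 2"
    using compact_positive_lower_bound[OF X(1)] by blast
  have "continuous_on X (\<lambda>x. 1 - Li3 (x\<^sup>2) / \<bar>Li3 x\<bar>)"
    using nonzero by (intro continuous_intros cont) auto
  moreover have "0 < 1 - Li3 (x\<^sup>2) / \<bar>Li3 x\<bar>" if "x \<in> X" for x
    using Li3_square_less_abs_Li3[of x] x[OF that] nonzero[OF that] by simp
  ultimately obtain \<epsilon> where \<epsilon>: "\<epsilon> > 0" "\<And>x. x \<in> X \<Longrightarrow> \<epsilon> \<le> 1 - Li3 (x\<^sup>2) / \<bar>Li3 x\<bar>"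
    using compact_positive_lower_bound[OF X(1)] by blast
  have "x \<in> negative_domain r \<alpha> (\<epsilon> / 2)" if "x \<in> X" for x
  proof -
    have "Li3 (x\<^sup>2) \<le> (1 - \<epsilon>) * \<bar>Li3 x\<bar>" using \<epsilon>(2)[OF that] nonzero[OF that] by (simp add: field_simps)
    then have "norm (L_phase 2 (of_real x)) ^ 3 \<le> (1 - 2 * (\<epsilon> / 2)) * Re (L_phase 1 (of_real x)) ^ 3"
      unfolding L_phase_cubes_of_neg_real[OF x(1,2)[OF that]] by simp
    moreover have "of_real x \<in> phase_domain 1 r \<alpha>"
      using r(3)[OF that] \<alpha>(2)[OF that] x[OF that] Re_L_phase_1_of_neg_real[OF x(1,2)[OF that]]
      by (simp add: phase_domain_def)
    ultimately show ?thesis using x(2)[OF that] unfolding negative_domain_def by blast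
  qed
  then show ?thesis using that[of r \<alpha> "\<epsilon> / 2"] r(1,2) \<alpha>(1) \<epsilon>(1) by auto
qed

theorem pp_poly_asymp_negative_real:
  assumes X: "compact X" "X \<subseteq> {x_star<..<0}"
  shows "\<exists>(E :: nat \<Rightarrow> real \<Rightarrow> real) (C :: real). \<forall>\<^sub>F n in sequentially. \<forall>x\<in>X.
    \<bar>E n x\<bar> \<le> C * real n powr (-1/3) \<and> pp_poly n x = real_amplitude n x * (cos (real_phase n x) + E n x)"
proof -
  obtain r \<alpha> \<epsilon> where bounds: "0 \<le> r" "r < 1" "\<alpha> > 0" "\<epsilon> > 0" and X_sub: "X \<subseteq> negative_domain r \<alpha> \<epsilon>"
    by (rule compact_subset_negative_domain[OF X])
  obtain C N where "N > 0" and asymp: "\<And>x n. x \<in> negative_domain r \<alpha> \<epsilon> \<Longrightarrow> n \<ge> N \<Longrightarrow>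
    \<bar>pp_poly n x - 2 * Re (saddle_term 1 n (of_real x))\<bar> \<le> 2 * norm (saddle_term 1 n (of_real x)) * (C * real n powr (-1/3))"
    using pp_poly_negative_domain[OF bounds] by metis
  define E where "E n x = pp_poly n x / real_amplitude n x - cos (real_phase n x)" for n x
  have "\<bar>E n x\<bar> \<le> C * real n powr (-1/3) \<and> pp_poly n x = real_amplitude n x * (cos (real_phase n x) + E n x)"
    if "n \<ge> N" "x \<in> X" for n x
  proof -
    have x: "-1 < x" "x < 0" and n: "n > 0" using that X(2) x_star_gt \<open>N > 0\<close> by fastforce+
    let ?A = "real_amplitude n x"
    have A: "?A > 0" using x n by (rule real_amplitude_pos)
    have E_eq: "pp_poly n x = ?A * (cos (real_phase n x) + E n x)" using A by (simp add: E_def field_simps)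
    have "\<bar>pp_poly n x - ?A * cos (real_phase n x)\<bar> \<le> ?A * (C * real n powr (-1/3))"
      using asymp[OF subsetD[OF X_sub that(2)] that(1)] A
      unfolding saddle_term_1_of_neg_real[OF x n] by (simp add: norm_mult Re_exp)
    then have "?A * \<bar>E n x\<bar> \<le> ?A * (C * real n powr (-1/3))"
      using A unfolding E_eq by (simp add: distrib_left abs_mult)
    then show ?thesis using A E_eq by simp
  qed
  then have "\<forall>\<^sub>F n in sequentially. \<forall>x\<in>X. \<bar>E n x\<bar> \<le> C * real n powr (-1/3) \<and>
      pp_poly n x = real_amplitude n x * (cos (real_phase n x) + E n x)"
    by (auto simp: eventually_sequentially)
  then show ?thesis by (intro exI)
qed

theorem theorem3:
  "(\<forall>X::real set. compact X \<and> X \<subseteq> {x_star<..<0} \<longrightarrow>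
      (\<exists>(E :: nat \<Rightarrow> real \<Rightarrow> real) (C :: real). \<forall>\<^sub>F n in sequentially. \<forall>x\<in>X.
         \<bar>E n x\<bar> \<le> C * real n powr (-1/3) \<and>
         pp_poly n x =
           2 powr (7/6) * root 12 (1 - x) * (1 / sqrt (6 * pi * real n powr (4/3)))
           * \<bar>Li3 x\<bar> powr (1/6)
           * exp (3/4 * root 3 2 * real n powr (2/3) * \<bar>Li3 x\<bar> powr (1/3))
           * (cos (3 * sqrt 3 / 4 * root 3 2 * real n powr (2/3) * \<bar>Li3 x\<bar> powr (1/3) + pi / 6)
              + E n x)))
   \<and>
   (\<forall>X::complex set. compact X \<and> X \<subseteq> level_set - {complex_of_real x_star} \<longrightarrow>
      (\<exists>(E1 :: nat \<Rightarrow> complex \<Rightarrow> complex) (E2 :: nat \<Rightarrow> complex \<Rightarrow> complex) (C :: real).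
         \<forall>\<^sub>F n in sequentially. \<forall>x\<in>X.
         norm (E1 n x) \<le> C * real n powr (-1/3) \<and>
         norm (E2 n x) \<le> C * real n powr (-1/3) \<and>
         pp_poly n x =
           (1 - x) powr (1/12)
           * csqrt (L_phase 1 x / complex_of_real (6 * pi * real n powr (4/3)))
           * exp (3/2 * complex_of_real (real n powr (2/3)) * L_phase 1 x)
           * (1 + E1 n x)
           + (-1) ^ n * (1 - x\<^sup>2) powr (1/24) * ((1 - x) / (1 + x)) powr (1/8)
           * csqrt (L_phase 2 x / complex_of_real (6 * pi * real n powr (4/3)))
           * exp (3/2 * complex_of_real (real n powr (2/3)) * L_phase 2 x)
           * (1 + E2 n x)))"
proof (intro conjI allI impI, goal_cases)
  case (1 X)
  then show ?case
    using pp_poly_asymp_negative_real[of X] unfolding real_amplitude_def real_phase_def by blast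
next
  case (2 X)
  then have disc: "norm x < 1" if "x \<in> X" for x using that by (auto simp: level_set_def)
  obtain E1 E2 C where asymp: "\<forall>\<^sub>F n in sequentially. \<forall>x\<in>X.
      norm (E1 n x) \<le> C * real n powr (-1/3) \<and> norm (E2 n x) \<le> C * real n powr (-1/3) \<and>
      pp_poly n x = saddle_term 1 n x * (1 + E1 n x) + (-1) ^ n * saddle_term 2 n x * (1 + E2 n x)"
    using pp_poly_asymp_level_set[of X] 2 by metis
  show ?case
    by (rule exI[of _ E1], rule exI[of _ E2], rule exI[of _ C], rule eventually_mono[OF asymp])
      (simp add: saddle_term_eq[OF disc] mult.assoc del: One_nat_def)
qed

end
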